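(* If $D$ is a classical link diagram, then $RC(D)$ is isomorphic to the free product $\mathbb{Z} * AC(D)$.
   Context: A classical link diagram $D$ is a finite collection of closed curves immersed in the plane whose only (self-)intersections are transverse double points (called classical crossings), where at each crossing one of the two segments is designated the overpasser and the other the underpasser. $C(D)$ is the set of crossings. An arc of $D$ is a segment that extends in both directions until it arrives at a crossing where it is an underpasser (a component that never underpasses is a single closed arc); $A(D)$ is the set of arcs. Arc core group: for a crossing $c$ with overpassing arc $a_1(c)$ and underpassing arcs $a_2(c),a_3(c)$, let $r_c=g_{a_1(c)}g_{a_2(c)}^{-1}g_{a_1(c)}g_{a_3(c)}^{-1}$. Then $AC(D)$ is the group with presentation $\langle \{g_a \mid a\in A(D)\};\{r_c\mid c\in C(D)\}\rangle$. (Interchanging $a_2(c)$ and $a_3(c)$ does not change the group.) $R(D)$ is the set of regions of $D$: the connected components of the complement in the plane of the union of the immersed curves. First regional core group: at a crossing $c$, label the four incident regions (not necessarily distinct) as follows: draw $c$ with the overpasser vertical and the underpasser horizontal; $V$ is upper left, $W$ upper right, $Y$ lower left, $X$ lower right. (So $W$ is across the overpasser from $V$, $Y$ is across the underpasser from $V$, and $X$ is diagonally opposite $V$.) Let $\rho_c=\gamma_V\gamma_W^{-1}\gamma_Y\gamma_X^{-1}$. Then $RC(D)$ is the group with presentation $\langle \{\gamma_R\mid R\in R(D)\};\{\rho_c\mid c\in C(D)\}\rangle$. (The choice of which of the two possible vertical drawings is used does not change the group.) *)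

theory Defs
  imports "HOL-Analysis.Analysis" "HOL-Algebra.Elementary_Groups"
begin

section \<open>Presentations and free products\<close>

text \<open>The quotient of the free monoid on \<open>A\<close> (lists over \<open>A\<close> under concatenation) by the
  congruence generated by the pairs in \<open>E\<close>.\<close>

inductive word_cong :: "'a set \<Rightarrow> ('a list \<times> 'a list) set \<Rightarrow> 'a list \<Rightarrow> 'a list \<Rightarrow> bool"
  for A E where
  refl: "u \<in> lists A \<Longrightarrow> word_cong A E u u"
| sym: "word_cong A E u v \<Longrightarrow> word_cong A E v u"
| trans: "word_cong A E u v \<Longrightarrow> word_cong A E v w \<Longrightarrow> word_cong A E u w"
| step: "(l, r) \<in> E \<Longrightarrow> p @ l @ q \<in> lists A \<Longrightarrow> p @ r @ q \<in> lists A
    \<Longrightarrow> word_cong A E (p @ l @ q) (p @ r @ q)"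

definition word_class :: "'a set \<Rightarrow> ('a list \<times> 'a list) set \<Rightarrow> 'a list \<Rightarrow> 'a list set" where
  "word_class A E u = {v. word_cong A E u v}"

definition presented_monoid :: "'a set \<Rightarrow> ('a list \<times> 'a list) set \<Rightarrow> 'a list set monoid" where
  "presented_monoid A E =
    \<lparr>carrier = word_class A E ` lists A,
     mult = (\<lambda>P Q. {w. \<exists>u\<in>P. \<exists>v\<in>Q. word_cong A E (u @ v) w}),
     one = word_class A E []\<rparr>"

text \<open>In a group word, the letter \<open>(x, True)\<close> stands for the generator \<open>x\<close> and \<open>(x, False)\<close> for
  its inverse.\<close>

definition presented_group :: "'a set \<Rightarrow> ('a \<times> bool) list set \<Rightarrow> ('a \<times> bool) list set monoid" where
  "presented_group X R = presented_monoid (X \<times> UNIV)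
    ({([(x, b), (x, \<not> b)], []) | x b. x \<in> X} \<union> {(r, []) | r. r \<in> R})"

definition free_product ::
  "('a, 'm) monoid_scheme \<Rightarrow> ('b, 'n) monoid_scheme \<Rightarrow> ('a + 'b) list set monoid" where
  "free_product G H = presented_monoid (carrier G <+> carrier H)
    ({([Inl a, Inl b], [Inl (a \<otimes>\<^bsub>G\<^esub> b)]) | a b. a \<in> carrier G \<and> b \<in> carrier G}
     \<union> {([Inr a, Inr b], [Inr (a \<otimes>\<^bsub>H\<^esub> b)]) | a b. a \<in> carrier H \<and> b \<in> carrier H}
     \<union> {([Inl \<one>\<^bsub>G\<^esub>], []), ([Inr \<one>\<^bsub>H\<^esub>], [])})"

lemma word_cong_lists:
  "word_cong A E u v \<Longrightarrow> u \<in> lists A \<and> v \<in> lists A"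
  by (induction rule: word_cong.induct) auto

lemma word_cong_rel:
  "(l, r) \<in> E \<Longrightarrow> l \<in> lists A \<Longrightarrow> r \<in> lists A \<Longrightarrow> word_cong A E l r"
  using word_cong.step[of l r E "[]" "[]" A] by simp

lemma word_cong_append_left:
  assumes "word_cong A E u v" "w \<in> lists A"
  shows "word_cong A E (w @ u) (w @ v)"
  using assms
proof (induction rule: word_cong.induct)
  case (refl u)
  then show ?case by (intro word_cong.refl) auto
next
  case (step l r p q)
  then show ?case using word_cong.step[of l r E "w @ p" q A] by simp
qed (auto intro: word_cong.sym word_cong.trans)

lemma word_cong_append_right:
  assumes "word_cong A E u v" "w \<in> lists A"
  shows "word_cong A E (u @ w) (v @ w)"
  using assms
proof (induction rule: word_cong.induct)
  case (refl u)
  then show ?case by (intro word_cong.refl) auto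
next
  case (step l r p q)
  then show ?case using word_cong.step[of l r E p "q @ w" A] by simp
qed (auto intro: word_cong.sym word_cong.trans)

lemma word_cong_append:
  "word_cong A E u u' \<Longrightarrow> word_cong A E v v' \<Longrightarrow> word_cong A E (u @ v) (u' @ v')"
  by (meson word_cong.trans word_cong_append_left word_cong_append_right word_cong_lists)

lemma word_class_eq_iff:
  "u \<in> lists A \<Longrightarrow> word_class A E u = word_class A E v \<longleftrightarrow> word_cong A E u v"
  unfolding word_class_def by (auto intro: word_cong.intros)

lemma presented_monoid_mult:
  assumes "u \<in> lists A" "v \<in> lists A"
  shows "word_class A E u \<otimes>\<^bsub>presented_monoid A E\<^esub> word_class A E v = word_class A E (u @ v)"
  unfolding presented_monoid_def word_class_def monoid.simps
  using assms
  by (auto intro: word_cong.refl word_cong.trans word_cong_append)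

lemma monoid_presented_monoid: "Group.monoid (presented_monoid A E)"
proof -
  let ?M = "presented_monoid A E"
  have car: "carrier ?M = word_class A E ` lists A" and one: "\<one>\<^bsub>?M\<^esub> = word_class A E []"
    by (simp_all add: presented_monoid_def)
  note [simp del] = in_lists_conv_set
  show ?thesis
  proof (rule monoidI)
    fix P Q T assume "P \<in> carrier ?M" "Q \<in> carrier ?M" "T \<in> carrier ?M"
    then obtain u v w where *: "u \<in> lists A" "v \<in> lists A" "w \<in> lists A"
      "P = word_class A E u" "Q = word_class A E v" "T = word_class A E w"
      unfolding car by blast
    then show "P \<otimes>\<^bsub>?M\<^esub> Q \<otimes>\<^bsub>?M\<^esub> T = P \<otimes>\<^bsub>?M\<^esub> (Q \<otimes>\<^bsub>?M\<^esub> T)"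
      by (simp add: presented_monoid_mult)
  next
    fix P Q assume "P \<in> carrier ?M" "Q \<in> carrier ?M"
    then obtain u v where *: "u \<in> lists A" "v \<in> lists A"
      "P = word_class A E u" "Q = word_class A E v"
      unfolding car by blast
    then show "P \<otimes>\<^bsub>?M\<^esub> Q \<in> carrier ?M"
      by (simp add: presented_monoid_mult car)
  next
    show "\<one>\<^bsub>?M\<^esub> \<in> carrier ?M" by (simp add: one car)
  next
    fix P assume "P \<in> carrier ?M"
    then obtain u where u: "u \<in> lists A" "P = word_class A E u"
      unfolding car by blast
    then show "\<one>\<^bsub>?M\<^esub> \<otimes>\<^bsub>?M\<^esub> P = P"
      using presented_monoid_mult[of "[]" A u E] by (simp add: one)
    show "P \<otimes>\<^bsub>?M\<^esub> \<one>\<^bsub>?M\<^esub> = P"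
      using u presented_monoid_mult[of u A "[]" E] by (simp add: one)
  qed
qed

lemma group_presented_monoid:
  assumes "\<And>x. x \<in> A \<Longrightarrow> \<exists>y\<in>A. word_cong A E [y, x] []"
  shows "group (presented_monoid A E)"
proof -
  interpret Group.monoid "presented_monoid A E" by (rule monoid_presented_monoid)
  have inv: "\<exists>v\<in>lists A. word_cong A E (v @ u) []" if "u \<in> lists A" for u
    using that
  proof (induction u)
    case Nil
    then show ?case by (auto intro: word_cong.refl)
  next
    case (Cons x u)
    then obtain v where v: "v \<in> lists A" "word_cong A E (v @ u) []" by auto
    obtain y where y: "y \<in> A" "word_cong A E [y, x] []"
      using assms Cons.hyps by blast
    have "word_cong A E ((v @ [y, x]) @ u) ((v @ []) @ u)"
      using Cons.hyps v y by (intro word_cong_append_left word_cong_append_right) auto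
    then have "word_cong A E ((v @ [y]) @ x # u) []"
      using v(2) by (auto intro: word_cong.trans)
    then show ?case using v y by (intro bexI[of _ "v @ [y]"]) auto
  qed
  show ?thesis
  proof (rule groupI)
    fix P assume "P \<in> carrier (presented_monoid A E)"
    then obtain u where u: "u \<in> lists A" "P = word_class A E u"
      by (auto simp: presented_monoid_def)
    from inv[OF u(1)] obtain v where v: "v \<in> lists A" "word_cong A E (v @ u) []" by blast
    then have "word_class A E v \<otimes>\<^bsub>presented_monoid A E\<^esub> P = \<one>\<^bsub>presented_monoid A E\<^esub>"
      using u by (simp add: presented_monoid_mult word_class_eq_iff)
        (simp add: presented_monoid_def word_class_eq_iff)
    moreover have "word_class A E v \<in> carrier (presented_monoid A E)"
      using v by (simp add: presented_monoid_def)
    ultimately show "\<exists>Q\<in>carrier (presented_monoid A E).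
        Q \<otimes>\<^bsub>presented_monoid A E\<^esub> P = \<one>\<^bsub>presented_monoid A E\<^esub>" by blast
  qed (auto simp: m_assoc)
qed

lemma group_presented_group: "group (presented_group X R)"
  unfolding presented_group_def
proof (rule group_presented_monoid)
  fix x :: "'a \<times> bool" assume x: "x \<in> X \<times> UNIV"
  let ?E = "{([(x, b), (x, \<not> b)], []) | x b. x \<in> X} \<union> {(r, []) | r. r \<in> R}"
  have "([(fst x, \<not> snd x), x], []) \<in> ?E" using x by (cases x) auto
  then have "word_cong (X \<times> UNIV) ?E [(fst x, \<not> snd x), x] []"
    using x by (intro word_cong_rel) auto
  then show "\<exists>y\<in>X \<times> UNIV. word_cong (X \<times> UNIV) ?E [y, x] []" using x by force
qed

lemma group_free_product:
  assumes "group G" "group H"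
  shows "group (free_product G H)"
  unfolding free_product_def
proof (rule group_presented_monoid)
  interpret G: group G by fact
  interpret H: group H by fact
  let ?A = "carrier G <+> carrier H"
  let ?E = "{([Inl a, Inl b], [Inl (a \<otimes>\<^bsub>G\<^esub> b)]) | a b. a \<in> carrier G \<and> b \<in> carrier G}
     \<union> {([Inr a, Inr b], [Inr (a \<otimes>\<^bsub>H\<^esub> b)]) | a b. a \<in> carrier H \<and> b \<in> carrier H}
     \<union> {([Inl \<one>\<^bsub>G\<^esub>], []), ([Inr \<one>\<^bsub>H\<^esub>], [])}"
  have step: "word_cong ?A ?E l r" if "(l, r) \<in> ?E" for l r
    using that by (intro word_cong_rel) auto
  fix x assume "x \<in> ?A"
  then consider a where "x = Inl a" "a \<in> carrier G" | b where "x = Inr b" "b \<in> carrier H" by auto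
  then show "\<exists>y\<in>?A. word_cong ?A ?E [y, x] []"
  proof cases
    case 1
    have "word_cong ?A ?E [Inl (inv\<^bsub>G\<^esub> a), Inl a] [Inl (inv\<^bsub>G\<^esub> a \<otimes>\<^bsub>G\<^esub> a)]"
      using 1 by (intro step) auto
    moreover have "word_cong ?A ?E [Inl \<one>\<^bsub>G\<^esub>] []" by (rule step) auto
    ultimately show ?thesis using 1
      by (intro bexI[of _ "Inl (inv\<^bsub>G\<^esub> a)"]) (auto intro: word_cong.trans)
  next
    case 2
    have "word_cong ?A ?E [Inr (inv\<^bsub>H\<^esub> b), Inr b] [Inr (inv\<^bsub>H\<^esub> b \<otimes>\<^bsub>H\<^esub> b)]"
      using 2 by (intro step) auto
    moreover have "word_cong ?A ?E [Inr \<one>\<^bsub>H\<^esub>] []" by (rule step) auto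
    ultimately show ?thesis using 2
      by (intro bexI[of _ "Inr (inv\<^bsub>H\<^esub> b)"]) (auto intro: word_cong.trans)
  qed
qed


section \<open>Link diagrams\<close>

text \<open>The plane is \<open>complex\<close>. A closed curve is parametrized by the unit circle \<open>sphere 0 1\<close>, and
  a \<^emph>\<open>strand\<close> is a pair \<open>(i, z)\<close> of a component index and a parameter value. The set \<open>overpass\<close>
  records the strands that are overpassers; it only matters at crossings.\<close>

record diagram =
  num_curves :: nat
  curve :: "nat \<Rightarrow> complex \<Rightarrow> complex"
  overpass :: "(nat \<times> complex) set"

definition strands :: "diagram \<Rightarrow> complex \<Rightarrow> (nat \<times> complex) set" where
  "strands D p = {(i, z). i < num_curves D \<and> z \<in> sphere 0 1 \<and> curve D i z = p}"

text \<open>Velocity with respect to the angle.\<close>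

definition tangent :: "diagram \<Rightarrow> nat \<times> complex \<Rightarrow> complex" where
  "tangent D = (\<lambda>(i, z). vector_derivative (\<lambda>s. curve D i (z * cis s)) (at 0))"

definition crossings :: "diagram \<Rightarrow> complex set" where
  "crossings D = {p. card (strands D p) = 2}"

definition link_diagram :: "diagram \<Rightarrow> bool" where
  "link_diagram D \<longleftrightarrow>
    (\<forall>i<num_curves D.
      (\<forall>z\<in>sphere 0 1. (\<lambda>s. curve D i (z * cis s)) differentiable (at 0) \<and> tangent D (i, z) \<noteq> 0)
      \<and> continuous_on (sphere 0 1) (\<lambda>z. tangent D (i, z)))
    \<and> (\<forall>p. finite (strands D p) \<and> card (strands D p) \<le> 2)
    \<and> (\<forall>p. \<forall>s\<in>strands D p. \<forall>s'\<in>strands D p. s \<noteq> s' \<longrightarrow> span {tangent D s, tangent D s'} = UNIV)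
    \<and> (\<forall>c\<in>crossings D. card (strands D c \<inter> overpass D) = 1)"

definition over_strand :: "diagram \<Rightarrow> complex \<Rightarrow> nat \<times> complex \<Rightarrow> bool" where
  "over_strand D c s \<longleftrightarrow> c \<in> crossings D \<and> s \<in> strands D c \<inter> overpass D"

definition under_strand :: "diagram \<Rightarrow> complex \<Rightarrow> nat \<times> complex \<Rightarrow> bool" where
  "under_strand D c s \<longleftrightarrow> c \<in> crossings D \<and> s \<in> strands D c - overpass D"


section \<open>The arc core group\<close>

text \<open>An arc is given by its parameter values: it is a component of a parameter circle cut at all the
  parameter values where the curve is an underpasser. The cut points are not included.\<close>

definition arcs :: "diagram \<Rightarrow> (nat \<times> complex set) set" where
  "arcs D = {(i, K). i < num_curves D \<and>
    K \<in> components (sphere 0 1 - {z. \<exists>c. under_strand D c (i, z)})}"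

text \<open>The arcs \<open>a\<^sub>2\<close> and \<open>a\<^sub>3\<close> are those leaving the crossing along the underpasser, against and along
  the direction of the parametrization; interchanging them does not change the group.\<close>

definition arc_relators :: "diagram \<Rightarrow> ((nat \<times> complex set) \<times> bool) list set" where
  "arc_relators D = {[(a\<^sub>1, True), (a\<^sub>2, False), (a\<^sub>1, True), (a\<^sub>3, False)] | a\<^sub>1 a\<^sub>2 a\<^sub>3.
    a\<^sub>1 \<in> arcs D \<and> a\<^sub>2 \<in> arcs D \<and> a\<^sub>3 \<in> arcs D \<and>
    (\<exists>c i z j w. over_strand D c (i, z) \<and> under_strand D c (j, w) \<and>
      fst a\<^sub>1 = i \<and> z \<in> snd a\<^sub>1 \<and>
      fst a\<^sub>2 = j \<and> (\<forall>\<^sub>F t in at_right 0. w * cis (- t) \<in> snd a\<^sub>2) \<and>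
      fst a\<^sub>3 = j \<and> (\<forall>\<^sub>F t in at_right 0. w * cis t \<in> snd a\<^sub>3))}"

definition AC :: "diagram \<Rightarrow> ((nat \<times> complex set) \<times> bool) list set monoid" where
  "AC D = presented_group (arcs D) (arc_relators D)"


section \<open>The first regional core group\<close>

definition regions :: "diagram \<Rightarrow> complex set set" where
  "regions D = components (- (\<Union>i<num_curves D. curve D i ` sphere 0 1))"

text \<open>The region incident at the crossing \<open>c\<close> that lies in the direction \<open>d\<close> from \<open>c\<close>.\<close>

definition region_towards :: "diagram \<Rightarrow> complex \<Rightarrow> complex \<Rightarrow> complex set \<Rightarrow> bool" where
  "region_towards D c d R \<longleftrightarrow> R \<in> regions D \<and> (\<forall>\<^sub>F t in at_right 0. c + t *\<^sub>R d \<in> R)"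

text \<open>Draw the crossing with the tangent vector \<open>u\<close> of the overpasser pointing up; \<open>v\<close> is the one of
  the two opposite tangent vectors of the underpasser that then points to the right, i.e.
  the angle from \<open>v\<close> to \<open>u\<close> is counterclockwise. The drawing with \<open>- u\<close> pointing up gives
  an equivalent relator.\<close>

definition region_relators :: "diagram \<Rightarrow> (complex set \<times> bool) list set" where
  "region_relators D = {[(V, True), (W, False), (Y, True), (X, False)] | V W Y X.
    \<exists>c s s' u v. over_strand D c s \<and> under_strand D c s' \<and>
      u = tangent D s \<and> (v = tangent D s' \<or> v = - tangent D s') \<and> Im (cnj v * u) > 0 \<and>
      region_towards D c (u - v) V \<and> region_towards D c (u + v) W \<and>
      region_towards D c (- u - v) Y \<and> region_towards D c (- u + v) X}"

definition RC :: "diagram \<Rightarrow> (complex set \<times> bool) list set monoid" where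
  "RC D = presented_group (regions D) (region_relators D)"

end

(* In RC(D), the quotient of the generators of the two sides of an arc a, taken in the order white by
   black of a checkerboard colouring, does not change along a, not even where a overpasses: this is
   what the regional relation says. These quotients
   satisfy the arc relations, so g_a |-> white * black^-1, together with sending the generator of Z
   to the generator of a base region, maps Z * AC(D) to RC(D). Conversely, a locally constant function
   on the complement of the diagram with values in Z * AC(D) and jump g_a across each arc a exists
   near every point of the plane, by the arc relation near a crossing; two such functions differ by
   right multiplication with a constant, so local solutions glue over squares and then over the
   plane. Such a function, normalized at the base region, maps RC(D) to Z * AC(D), and the uniqueness
   up to constants shows that the two maps are mutually inverse. The colouring is the same gluing
   argument with values in the group of order two.

   A C^1 strand is near each point the graph of a function with Lipschitz constant 1/2 in suitable
   linear coordinates, which gives the two sides of an arc and the four quadrants of a crossing. *)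
theory Submission
  imports Defs
begin

section \<open>Local graphs in the plane\<close>

text \<open>Why colours are needed: following an overpasser upwards through a crossing, its left and
  right sides are Y, X before and V, W after it. The relator says V W^-1 = X Y^-1, so the quotient
  left by right turns into its inverse. But V and X are opposite quadrants and share a colour, so
  ordering by colour repairs this. It also makes the direction of the strands irrelevant, as it is
  in the arc core group. Jumps act by multiplication from the left, so right multiplication
  preserves solutions. This freedom is the factor Z: the relators control only quotients of
  neighbouring generators, and the value at one base region stays free. The curves are merely C^1
  and the regions are bare connected components, so no cell structure is at hand. Everything is read
  off in charts around single points, and connected overlaps take the place of planar graph theory.
  At a crossing the normal of one strand may run along the other one, so sides are tested only off
  crossings, and arcs are compared through their non-crossing points, which are dense in
  them.\<close>

definition coord :: "complex \<Rightarrow> complex \<Rightarrow> complex \<Rightarrow> real" where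
  "coord u v p = Im (cnj v * p) / Im (cnj v * u)"

lemma linear_coord: "linear (coord u v)"
  by (rule linearI) (simp_all add: coord_def algebra_simps add_divide_distrib diff_divide_distrib)

lemmas coord_add = linear_add[OF linear_coord]
lemmas coord_diff = linear_diff[OF linear_coord]
lemmas coord_minus = linear_neg[OF linear_coord]
lemmas coord_scale = linear_scale[OF linear_coord]
lemmas coord_zero = linear_0[OF linear_coord]
lemmas coord_linear = coord_add coord_diff coord_minus coord_scale coord_zero

lemma continuous_on_coord [continuous_intros]:
  "continuous_on S f \<Longrightarrow> continuous_on S (\<lambda>x. coord u v (f x))"
  unfolding coord_def by (cases "Im (cnj v * u) = 0") (auto intro!: continuous_intros)

lemma isCont_coord [continuous_intros]:
  "isCont f x \<Longrightarrow> isCont (\<lambda>x. coord u v (f x)) x"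
  unfolding coord_def by (cases "Im (cnj v * u) = 0") (auto intro!: continuous_intros)

lemma Im_cnj_swap: "Im (cnj v * u) = - Im (cnj u * v)"
  by simp

lemma coord_self: "Im (cnj u * v) \<noteq> 0 \<Longrightarrow> coord u v u = 1"
  by (simp add: coord_def mult.commute)

lemma coord_other: "coord u v v = 0"
  by (simp add: coord_def)

text \<open>Cramer's rule, proved after multiplication by the determinant
  \<open>Im (cnj u * v)\<close>, so that the final identity is polynomial.\<close>

lemma coord_expand:
  assumes "Im (cnj u * v) \<noteq> 0"
  shows "p = coord u v p *\<^sub>R u + coord v u p *\<^sub>R v"
proof -
  have d: "Re u * Im v - Im u * Re v \<noteq> 0" using assms by simp
  have "(Re u * Im v - Im u * Re v) *\<^sub>R p =
      (Re u * Im v - Im u * Re v) *\<^sub>R (coord u v p *\<^sub>R u + coord v u p *\<^sub>R v)"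
  proof -
    have 1: "(Re u * Im v - Im u * Re v) * coord u v p = Re p * Im v - Im p * Re v"
      using d by (simp add: coord_def divide_simps) (simp add: algebra_simps)
    have 2: "(Re u * Im v - Im u * Re v) * coord v u p = Re u * Im p - Im u * Re p"
      using d by (simp add: coord_def)
    have "(Re u * Im v - Im u * Re v) *\<^sub>R (coord u v p *\<^sub>R u + coord v u p *\<^sub>R v) =
      ((Re u * Im v - Im u * Re v) * coord u v p) *\<^sub>R u
      + ((Re u * Im v - Im u * Re v) * coord v u p) *\<^sub>R v"
      by (simp add: scaleR_add_right)
    also have "\<dots> = (Re u * Im v - Im u * Re v) *\<^sub>R p"
      unfolding 1 2 by (simp add: complex_eq_iff algebra_simps)
    finally show ?thesis ..
  qed
  then show ?thesis using d by (metis scaleR_cancel_left)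
qed

lemma coord_combine:
  assumes "Im (cnj u * v) \<noteq> 0"
  shows "coord u v (x *\<^sub>R u + y *\<^sub>R v) = x" "coord v u (x *\<^sub>R u + y *\<^sub>R v) = y"
proof -
  have "Im (cnj v * u) \<noteq> 0" using assms by (simp add: mult.commute)
  then show "coord u v (x *\<^sub>R u + y *\<^sub>R v) = x" "coord v u (x *\<^sub>R u + y *\<^sub>R v) = y"
    using assms by (simp_all add: coord_linear coord_self coord_other)
qed

lemma abs_coord_le: "\<bar>coord u v p\<bar> \<le> norm v / \<bar>Im (cnj v * u)\<bar> * norm p"
proof -
  have "\<bar>Im (cnj v * p)\<bar> \<le> norm v * norm p"
    using abs_Im_le_cmod[of "cnj v * p"] by (simp add: norm_mult)
  then show ?thesis
    unfolding coord_def abs_divide by (simp add: divide_right_mono)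
qed

text \<open>In the coordinates \<open>p = x *\<^sub>R u + y *\<^sub>R v\<close> around \<open>\<gamma> 0\<close> the curve is the graph \<open>y = \<phi> x\<close>; the last
  clause says on which side of this graph the two normal vectors of the curve point.\<close>

definition local_graph ::
  "(real \<Rightarrow> complex) \<Rightarrow> (real \<Rightarrow> complex) \<Rightarrow> complex \<Rightarrow> complex \<Rightarrow> real \<Rightarrow> real \<Rightarrow> (real \<Rightarrow> real) \<Rightarrow> bool" where
  "local_graph \<gamma> \<gamma>' u v \<eta> \<delta> \<phi> \<longleftrightarrow> 0 < \<eta> \<and> 0 < \<delta> \<and> \<phi> 0 = 0 \<and>
    (\<forall>x x'. \<bar>\<phi> x - \<phi> x'\<bar> \<le> \<bar>x - x'\<bar> / 2) \<and>
    (\<forall>s. \<bar>s\<bar> \<le> \<eta> \<longrightarrow> \<bar>coord u v (\<gamma> s - \<gamma> 0)\<bar> \<le> \<delta> \<longrightarrow>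
      coord v u (\<gamma> s - \<gamma> 0) = \<phi> (coord u v (\<gamma> s - \<gamma> 0))) \<and>
    (\<forall>x. \<bar>x\<bar> \<le> \<delta> \<longrightarrow> (\<exists>s. \<bar>s\<bar> \<le> \<eta> \<and> coord u v (\<gamma> s - \<gamma> 0) = x)) \<and>
    (\<forall>s s'. \<bar>s\<bar> \<le> \<eta> \<longrightarrow> \<bar>s'\<bar> \<le> \<eta> \<longrightarrow> s < s' \<longrightarrow> coord u v (\<gamma> s) < coord u v (\<gamma> s')) \<and>
    (\<forall>s h. \<bar>s\<bar> \<le> \<eta> \<longrightarrow> h \<noteq> 0 \<longrightarrow>
      \<bar>coord u v (\<gamma> s - \<gamma> 0)\<bar> \<le> \<delta> \<longrightarrow> \<bar>coord u v (\<gamma> s + h *\<^sub>R (\<i> * \<gamma>' s) - \<gamma> 0)\<bar> \<le> \<delta> \<longrightarrow>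
      0 < h * sgn (Im (cnj u * v)) * (coord v u (\<gamma> s + h *\<^sub>R (\<i> * \<gamma>' s) - \<gamma> 0)
        - \<phi> (coord u v (\<gamma> s + h *\<^sub>R (\<i> * \<gamma>' s) - \<gamma> 0))))"

text \<open>Near 0 the velocity differs from \<open>u\<close> by less than \<epsilon>, so in these
  coordinates the curve moves like its parameter in the first direction and hardly at all in the
  second. The first coordinate is thus a monotone parameter and the second a function of it with
  small slope. \<open>v\<close> need not be normal to the curve: at a crossing it is the direction
  of the other strand. For the side clause the graph must therefore be flatter than the
  normals.\<close>

lemma local_graph_exists:
  fixes \<gamma> \<gamma>' :: "real \<Rightarrow> complex"
  assumes der: "\<And>s. (\<gamma> has_vector_derivative \<gamma>' s) (at s)"
    and cont: "isCont \<gamma>' 0" and u: "u = \<gamma>' 0"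
    and uv: "Im (cnj u * v) \<noteq> 0" and \<eta>0: "0 < \<eta>0"
  obtains \<eta> \<delta> \<phi> where "\<eta> \<le> \<eta>0" "local_graph \<gamma> \<gamma>' u v \<eta> \<delta> \<phi>"
proof -
  define d where "d = Im (cnj u * v)"
  have d: "d \<noteq> 0" using uv by (simp add: d_def)
  have vu: "Im (cnj v * u) = - d" using Im_cnj_swap[of v u] by (simp add: d_def)
  define X where "X = coord u v"
  define Y where "Y = coord v u"
  note lin = coord_linear[of u v, folded X_def] coord_linear[of v u, folded Y_def]
  define C where "C = (norm u + norm v) / \<bar>d\<bar>"
  have u0: "u \<noteq> 0" using uv by auto
  have C: "C > 0" unfolding C_def using u0 d by (simp add: add_pos_nonneg)
  have XC: "\<bar>X p\<bar> \<le> C * norm p" for p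
  proof -
    have "norm v / \<bar>d\<bar> * norm p \<le> C * norm p"
      unfolding C_def by (intro mult_right_mono divide_right_mono) auto
    then show ?thesis using abs_coord_le[of u v p] vu by (simp add: X_def)
  qed
  have YC: "\<bar>Y p\<bar> \<le> C * norm p" for p
  proof -
    have "norm u / \<bar>d\<bar> * norm p \<le> C * norm p"
      unfolding C_def by (intro mult_right_mono divide_right_mono) auto
    then show ?thesis using abs_coord_le[of v u p] by (simp add: Y_def d_def)
  qed
  \<comment> \<open>Second coordinate of the left normal, up to the orientation of
    \<open>(u, v)\<close>. It has to beat the slope of the graph times the first coordinate of the
    normal.\<close>
  define b where "b = sgn d * Y (\<i> * u)"
  have b: "b > 0"
  proof -
    have "Im (cnj u * (\<i> * u)) = (norm u)\<^sup>2"
      unfolding cmod_power2 by (simp add: power2_eq_square)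
    then have "b = sgn d * ((norm u)\<^sup>2 / d)" by (simp add: b_def Y_def coord_def d_def)
    also have "\<dots> = (norm u)\<^sup>2 / \<bar>d\<bar>" using d by (auto simp: sgn_if)
    finally show ?thesis using u0 d by simp
  qed
  \<comment> \<open>The slope bound of the graph: at most 1/2 for the sake of the quadrants, and
    small enough for \<open>\<kappa>b\<close>, which says that the normal at 0 is steeper than the
    graph. The summand 1 avoids division by zero when the normal is parallel to
    \<open>v\<close>.\<close>
  define \<kappa> where "\<kappa> = min (1/2) (b / (2 * (\<bar>X (\<i> * u)\<bar> + 1)))"
  have \<kappa>: "0 < \<kappa>" "\<kappa> \<le> 1/2" using b unfolding \<kappa>_def by (simp_all only: min_less_iff_conj min.cobounded1) simp
  have \<kappa>b: "\<kappa> * \<bar>X (\<i> * u)\<bar> < b"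
  proof -
    have "\<kappa> * \<bar>X (\<i> * u)\<bar> \<le> b / (2 * (\<bar>X (\<i> * u)\<bar> + 1)) * \<bar>X (\<i> * u)\<bar>"
      by (intro mult_right_mono) (auto simp: \<kappa>_def)
    also have "\<dots> = b * (\<bar>X (\<i> * u)\<bar> / (2 * (\<bar>X (\<i> * u)\<bar> + 1)))" by simp
    also have "\<dots> < b * 1" using b by (intro mult_strict_left_mono) (simp_all add: divide_less_eq)
    also have "\<dots> = b" by simp
    finally show ?thesis .
  qed
  \<comment> \<open>Both coordinates are bounded by \<open>C\<close> times the norm, so an error
    \<epsilon> in the velocity becomes an error of at most \<kappa>/2 in the speed of each
    coordinate.\<close>
  define \<epsilon> where "\<epsilon> = \<kappa> / (2 * C)"
  have \<epsilon>: "\<epsilon> > 0" using \<kappa> C by (simp add: \<epsilon>_def)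
  have C\<epsilon>: "C * \<epsilon> = \<kappa> / 2" using C by (simp add: \<epsilon>_def)
  have "\<forall>\<^sub>F s in nhds 0. norm (\<gamma>' s - u) < \<epsilon>"
    using cont \<epsilon> unfolding u continuous_at tendsto_at_iff_tendsto_nhds
    by (simp add: tendsto_iff dist_norm)
  moreover have "\<forall>\<^sub>F s in nhds 0. \<kappa> * \<bar>X (\<i> * \<gamma>' s)\<bar> - sgn d * Y (\<i> * \<gamma>' s) < 0"
  proof -
    have "isCont (\<lambda>s. \<kappa> * \<bar>X (\<i> * \<gamma>' s)\<bar> - sgn d * Y (\<i> * \<gamma>' s)) 0"
      unfolding X_def Y_def using cont by (intro continuous_intros)
    then show ?thesis
      unfolding continuous_at
        tendsto_at_iff_tendsto_nhds[of "\<lambda>s. \<kappa> * \<bar>X (\<i> * \<gamma>' s)\<bar> - sgn d * Y (\<i> * \<gamma>' s)"]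
      using \<kappa>b by (elim order_tendstoD(2)) (simp add: b_def u)
  qed
  ultimately have "\<forall>\<^sub>F s in nhds 0. norm (\<gamma>' s - u) < \<epsilon> \<and>
      \<kappa> * \<bar>X (\<i> * \<gamma>' s)\<bar> < sgn d * Y (\<i> * \<gamma>' s)"
    by eventually_elim auto
  then obtain e where e: "e > 0" and near: "\<And>s. \<bar>s\<bar> < e \<Longrightarrow> norm (\<gamma>' s - u) < \<epsilon> \<and>
      \<kappa> * \<bar>X (\<i> * \<gamma>' s)\<bar> < sgn d * Y (\<i> * \<gamma>' s)"
    unfolding eventually_nhds_metric by (auto simp: dist_real_def)
  define \<eta> where "\<eta> = min \<eta>0 (e/2)"
  have \<eta>: "0 < \<eta>" "\<eta> \<le> \<eta>0" "\<eta> < e" using e \<eta>0 by (auto simp: \<eta>_def)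
  have bd: "norm (\<gamma> s' - \<gamma> s - (s' - s) *\<^sub>R u) \<le> \<bar>s' - s\<bar> * \<epsilon>" if "\<bar>s\<bar> \<le> \<eta>" "\<bar>s'\<bar> \<le> \<eta>" for s s'
  proof -
    have "norm (\<gamma> s' - \<gamma> s - (s' - s) *\<^sub>R \<gamma>' 0) \<le> norm (s' - s) * \<epsilon>"
    proof (rule vector_differentiable_bound_linearization[where S = "{-\<eta>..\<eta>}"])
      show "(\<gamma> has_vector_derivative \<gamma>' x) (at x within {-\<eta>..\<eta>})" for x
        using der by (rule has_vector_derivative_at_within)
      show "closed_segment s s' \<subseteq> {-\<eta>..\<eta>}"
        using that by (auto simp: closed_segment_eq_real_ivl)
      show "norm (\<gamma>' x - \<gamma>' 0) \<le> \<epsilon>" if "x \<in> {-\<eta>..\<eta>}" for x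
        using near[of x] that \<eta> u by force
    qed (use \<eta> in auto)
    then show ?thesis by (simp add: u)
  qed
  have X1: "X u = 1" "Y u = 0" using uv by (auto simp: X_def Y_def coord_self coord_other)
  have dX: "\<bar>X (\<gamma> s' - \<gamma> s) - (s' - s)\<bar> \<le> \<kappa>/2 * \<bar>s' - s\<bar>"
    and dY: "\<bar>Y (\<gamma> s' - \<gamma> s)\<bar> \<le> \<kappa>/2 * \<bar>s' - s\<bar>" if "\<bar>s\<bar> \<le> \<eta>" "\<bar>s'\<bar> \<le> \<eta>" for s s'
  proof -
    have *: "C * norm (\<gamma> s' - \<gamma> s - (s' - s) *\<^sub>R u) \<le> \<kappa>/2 * \<bar>s' - s\<bar>"
    proof -
      have "C * norm (\<gamma> s' - \<gamma> s - (s' - s) *\<^sub>R u) \<le> C * (\<bar>s' - s\<bar> * \<epsilon>)"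
        using bd[OF that] C by (intro mult_left_mono) auto
      also have "\<dots> = C * \<epsilon> * \<bar>s' - s\<bar>" by simp
      finally show ?thesis unfolding C\<epsilon> .
    qed
    show "\<bar>X (\<gamma> s' - \<gamma> s) - (s' - s)\<bar> \<le> \<kappa>/2 * \<bar>s' - s\<bar>"
      using XC[of "\<gamma> s' - \<gamma> s - (s' - s) *\<^sub>R u"] * by (simp add: lin X1)
    show "\<bar>Y (\<gamma> s' - \<gamma> s)\<bar> \<le> \<kappa>/2 * \<bar>s' - s\<bar>"
      using YC[of "\<gamma> s' - \<gamma> s - (s' - s) *\<^sub>R u"] * by (simp add: lin X1)
  qed
  have k4: "\<kappa>/2 * \<bar>r\<bar> \<le> \<bar>r\<bar> / 4" for r :: real
    using mult_right_mono[OF \<kappa>(2), of "\<bar>r\<bar>"] by simp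
  have aux: "\<bar>d\<bar> \<le> 2 * \<bar>A\<bar>" if "\<bar>A - d\<bar> \<le> \<bar>d\<bar> / 4" for A d :: real
    using that by (auto simp: abs_if split: if_splits)
  \<comment> \<open>The first coordinate moves at least at half unit speed, which turns the speed
    bound \<kappa>/2 of the second into the slope bound \<kappa>.\<close>
  have dXY: "\<bar>Y (\<gamma> s' - \<gamma> s)\<bar> \<le> \<kappa> * \<bar>X (\<gamma> s' - \<gamma> s)\<bar>" if "\<bar>s\<bar> \<le> \<eta>" "\<bar>s'\<bar> \<le> \<eta>" for s s'
  proof -
    have "\<bar>s' - s\<bar> \<le> 2 * \<bar>X (\<gamma> s' - \<gamma> s)\<bar>"
      by (rule aux) (rule order_trans[OF dX[OF that] k4])
    then have "\<kappa>/2 * \<bar>s' - s\<bar> \<le> \<kappa>/2 * (2 * \<bar>X (\<gamma> s' - \<gamma> s)\<bar>)"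
      using \<kappa> by (intro mult_left_mono) auto
    then show ?thesis using dY[OF that] by simp
  qed
  have mono: "X (\<gamma> s) < X (\<gamma> s')" if "\<bar>s\<bar> \<le> \<eta>" "\<bar>s'\<bar> \<le> \<eta>" "s < s'" for s s'
  proof -
    have "\<bar>(s' - s) - X (\<gamma> s' - \<gamma> s)\<bar> \<le> \<bar>s' - s\<bar> / 4"
      using order_trans[OF dX[OF that(1,2)] k4] by (simp only: abs_minus_commute)
    then have "(s' - s) - X (\<gamma> s' - \<gamma> s) \<le> (s' - s) / 4"
      using that(3) by (simp only: abs_le_iff) simp
    then show ?thesis using that(3) by (simp add: lin(2))
  qed
  define x where "x s = X (\<gamma> s - \<gamma> 0)" for s
  \<comment> \<open>By \<open>dX\<close> the first coordinate at the ends of the interval is at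
    least three quarters of \<eta> in absolute value, so the intermediate value theorem reaches
    everything up to \<eta>/2.\<close>
  define \<delta> where "\<delta> = \<eta> / 2"
  have contx: "continuous_on {-\<eta>..\<eta>} x"
    unfolding x_def X_def using der
    by (intro continuous_intros continuous_at_imp_continuous_on) (blast intro: has_vector_derivative_continuous)
  have "\<bar>x t - t\<bar> \<le> \<bar>t\<bar> / 4" if "\<bar>t\<bar> \<le> \<eta>" for t
    using order_trans[OF dX[of 0 t] k4] that \<eta>(1) by (simp add: x_def)
  from this[of \<eta>] this[of "-\<eta>"] have x_end: "x \<eta> \<ge> \<delta>" "x (-\<eta>) \<le> -\<delta>"
    using \<eta>(1) unfolding \<delta>_def abs_le_iff by simp_all
  have onto: "\<exists>s. \<bar>s\<bar> \<le> \<eta> \<and> x s = t" if "\<bar>t\<bar> \<le> \<delta>" for t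
  proof -
    have "\<exists>s\<ge>-\<eta>. s \<le> \<eta> \<and> x s = t"
      using x_end that \<eta>(1) contx by (intro IVT') (simp_all add: abs_le_iff)
    then show ?thesis by (auto simp: abs_le_iff)
  qed
  define \<sigma> where "\<sigma> t = (SOME s. \<bar>s\<bar> \<le> \<eta> \<and> x s = t)" for t
  have \<sigma>: "\<bar>\<sigma> t\<bar> \<le> \<eta>" "x (\<sigma> t) = t" if "\<bar>t\<bar> \<le> \<delta>" for t
    using someI_ex[OF onto[OF that]] by (auto simp: \<sigma>_def)
  define \<phi> where "\<phi> t = Y (\<gamma> (\<sigma> t) - \<gamma> 0)" for t
  have inj: "s = s'" if "\<bar>s\<bar> \<le> \<eta>" "\<bar>s'\<bar> \<le> \<eta>" "x s = x s'" for s s'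
    using mono[of s s'] mono[of s' s] that by (cases s s' rule: linorder_cases) (simp_all add: x_def lin)
  have \<phi>x: "Y (\<gamma> s - \<gamma> 0) = \<phi> (x s)" if "\<bar>s\<bar> \<le> \<eta>" "\<bar>x s\<bar> \<le> \<delta>" for s
    using inj[of s "\<sigma> (x s)"] \<sigma>[of "x s"] that by (simp add: \<phi>_def)
  have lip: "\<bar>\<phi> t - \<phi> t'\<bar> \<le> \<kappa> * \<bar>t - t'\<bar>" if "\<bar>t\<bar> \<le> \<delta>" "\<bar>t'\<bar> \<le> \<delta>" for t t'
  proof -
    have "X (\<gamma> (\<sigma> t) - \<gamma> (\<sigma> t')) = t - t'"
      using \<sigma>[OF that(1)] \<sigma>[OF that(2)] by (simp add: x_def lin)
    then show ?thesis using dXY[of "\<sigma> t'" "\<sigma> t"] \<sigma>[OF that(1)] \<sigma>[OF that(2)]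
      by (simp add: \<phi>_def lin)
  qed
  have side: "0 < h * sgn d * (Y (\<gamma> s + h *\<^sub>R (\<i> * \<gamma>' s) - \<gamma> 0)
        - \<phi> (X (\<gamma> s + h *\<^sub>R (\<i> * \<gamma>' s) - \<gamma> 0)))"
    if s: "\<bar>s\<bar> \<le> \<eta>" and h: "h \<noteq> 0" and xs: "\<bar>x s\<bar> \<le> \<delta>"
      and xh: "\<bar>X (\<gamma> s + h *\<^sub>R (\<i> * \<gamma>' s) - \<gamma> 0)\<bar> \<le> \<delta>" for s h
  proof -
    define a where "a = X (\<i> * \<gamma>' s)"
    define c where "c = Y (\<i> * \<gamma>' s)"
    have ac: "\<kappa> * \<bar>a\<bar> < sgn d * c" using near[of s] s \<eta> by (auto simp: a_def c_def)
    have eq: "X (\<gamma> s + h *\<^sub>R (\<i> * \<gamma>' s) - \<gamma> 0) = x s + h * a"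
      by (simp add: x_def lin a_def)
    have "Y (\<gamma> s + h *\<^sub>R (\<i> * \<gamma>' s) - \<gamma> 0) = Y (\<gamma> s - \<gamma> 0) + h * c"
      by (simp add: lin c_def)
    also have "\<dots> = \<phi> (x s) + h * c" using \<phi>x[OF s xs] by simp
    finally have "Y (\<gamma> s + h *\<^sub>R (\<i> * \<gamma>' s) - \<gamma> 0) - \<phi> (X (\<gamma> s + h *\<^sub>R (\<i> * \<gamma>' s) - \<gamma> 0))
       = h * c - (\<phi> (x s + h * a) - \<phi> (x s))" unfolding eq by simp
    \<comment> \<open>The displacement along the normal gains \<open>h * c\<close> in height, while
      the graph over the displaced point changes by at most \<open>\<kappa> * |h * a|\<close>, which
      is less by \<open>ac\<close>.\<close>
    moreover have "0 < h * sgn d * (h * c - (\<phi> (x s + h * a) - \<phi> (x s)))"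
    proof -
      have "\<bar>\<phi> (x s + h * a) - \<phi> (x s)\<bar> \<le> \<kappa> * \<bar>h * a\<bar>"
        using lip[of "x s + h * a" "x s"] xs xh eq by simp
      then have "\<bar>h * sgn d * (\<phi> (x s + h * a) - \<phi> (x s))\<bar> \<le> \<bar>h\<bar> * (\<kappa> * \<bar>h * a\<bar>)"
        using d by (simp add: abs_mult mult_left_mono)
      also have "\<dots> = h\<^sup>2 * (\<kappa> * \<bar>a\<bar>)"
        by (simp add: abs_mult power2_eq_square)
      also have "\<dots> < h\<^sup>2 * (sgn d * c)" using ac h by simp
      also have "\<dots> = h * sgn d * (h * c)" by (simp add: power2_eq_square)
      finally show ?thesis by (simp add: right_diff_distrib)
    qed
    ultimately show ?thesis by simp
  qed
  \<comment> \<open>The curve determines \<phi> only on \<open>{-\<delta>..\<delta>}\<close>.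
    Clamping the argument extends it to a Lipschitz function on the whole line, as
    \<open>local_graph\<close> demands.\<close>
  define cl where "cl t = max (- \<delta>) (min \<delta> t)" for t
  have cl: "\<bar>cl t\<bar> \<le> \<delta>" "\<bar>cl t - cl t'\<bar> \<le> \<bar>t - t'\<bar>" for t t'
    using \<eta>(1) by (auto simp: cl_def \<delta>_def)
  have cl_id: "cl t = t" if "\<bar>t\<bar> \<le> \<delta>" for t using that by (auto simp: cl_def)
  have "local_graph \<gamma> \<gamma>' u v \<eta> \<delta> (\<lambda>t. \<phi> (cl t))"
    unfolding local_graph_def
  proof (intro conjI allI impI)
    have "x 0 = 0" by (simp add: x_def lin)
    then show "\<phi> (cl 0) = 0" using \<phi>x[of 0] \<eta>(1) by (simp add: \<delta>_def lin cl_id)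
    show "\<bar>\<phi> (cl t) - \<phi> (cl t')\<bar> \<le> \<bar>t - t'\<bar> / 2" for t t'
      using lip[OF cl(1) cl(1), of t t'] mult_mono[OF \<kappa>(2) cl(2)[of t t']] by simp
    show "\<And>s. \<bar>s\<bar> \<le> \<eta> \<Longrightarrow> \<bar>coord u v (\<gamma> s - \<gamma> 0)\<bar> \<le> \<delta> \<Longrightarrow>
      coord v u (\<gamma> s - \<gamma> 0) = \<phi> (cl (coord u v (\<gamma> s - \<gamma> 0)))"
      using \<phi>x by (simp add: x_def X_def Y_def cl_id)
    show "\<And>t. \<bar>t\<bar> \<le> \<delta> \<Longrightarrow> \<exists>s. \<bar>s\<bar> \<le> \<eta> \<and> coord u v (\<gamma> s - \<gamma> 0) = t"
      using onto by (simp add: x_def X_def)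
    show "0 < h * sgn (Im (cnj u * v)) * (coord v u (\<gamma> s + h *\<^sub>R (\<i> * \<gamma>' s) - \<gamma> 0)
        - \<phi> (cl (coord u v (\<gamma> s + h *\<^sub>R (\<i> * \<gamma>' s) - \<gamma> 0))))"
      if "\<bar>s\<bar> \<le> \<eta>" "h \<noteq> 0" "\<bar>coord u v (\<gamma> s - \<gamma> 0)\<bar> \<le> \<delta>"
        "\<bar>coord u v (\<gamma> s + h *\<^sub>R (\<i> * \<gamma>' s) - \<gamma> 0)\<bar> \<le> \<delta>" for s h
      using side[of s h] that cl_id[OF that(4)] unfolding x_def X_def Y_def d_def by simp
  qed (use \<eta> mono in \<open>auto simp: \<delta>_def X_def\<close>)
  then show thesis using that \<eta>(2) by blast
qed

text \<open>Both slopes are below 1, so a point of the set stays in it when moved in the direction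
  (1, 1). It is moved until it hits the right or the upper edge of the square of radius
  \<open>m = max |x| |y|\<close>, and then slides along this edge to the corner (m, m). The corners
  lie on the diagonal, whose part with positive coordinates below \<delta> is contained in the
  set.\<close>

lemma quadrant_connected:
  fixes \<phi> \<psi> :: "real \<Rightarrow> real"
  assumes \<phi>: "\<phi> 0 = 0" "\<And>x x'. \<bar>\<phi> x - \<phi> x'\<bar> \<le> \<bar>x - x'\<bar> / 2"
    and \<psi>: "\<psi> 0 = 0" "\<And>x x'. \<bar>\<psi> x - \<psi> x'\<bar> \<le> \<bar>x - x'\<bar> / 2"
  shows "connected {(x, y). \<bar>x\<bar> < \<delta> \<and> \<bar>y\<bar> < \<delta> \<and> \<phi> x < y \<and> \<psi> y < x}" (is "connected ?Q")
proof (cases "\<delta> > 0")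
  case \<delta>: True
  have \<phi>h: "\<bar>\<phi> x\<bar> \<le> \<bar>x\<bar> / 2" if "\<bar>x\<bar> < \<delta>" for x
    using \<phi>(2)[of x 0] \<phi>(1) that by auto
  have \<psi>h: "\<bar>\<psi> x\<bar> \<le> \<bar>x\<bar> / 2" if "\<bar>x\<bar> < \<delta>" for x
    using \<psi>(2)[of x 0] \<psi>(1) that by auto
  have diag: "closed_segment (m, m) (m', m') \<subseteq> ?Q" if "0 < m" "m < \<delta>" "0 < m'" "m' < \<delta>" for m m'
  proof
    fix p assume "p \<in> closed_segment (m, m) (m', m')"
    then obtain t where t: "0 \<le> t" "t \<le> 1" "p = ((1 - t) * m + t * m', (1 - t) * m + t * m')"
      by (auto simp: closed_segment_def)
    define k where "k = (1 - t) * m + t * m'"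
    have "k \<in> closed_segment m m'" unfolding k_def closed_segment_def using t by auto
    then have "0 < k" "k < \<delta>" using that by (auto simp: closed_segment_eq_real_ivl split: if_splits)
    then show "p \<in> ?Q" using \<phi>h[of k] \<psi>h[of k] t(3) by (auto simp: k_def[symmetric])
  qed
  have to_diag: "connected_component ?Q (x, y) (max \<bar>x\<bar> \<bar>y\<bar>, max \<bar>x\<bar> \<bar>y\<bar>)
      \<and> 0 < max \<bar>x\<bar> \<bar>y\<bar> \<and> max \<bar>x\<bar> \<bar>y\<bar> < \<delta>" if Q: "(x, y) \<in> ?Q" for x y
  proof -
    define m where "m = max \<bar>x\<bar> \<bar>y\<bar>"
    define r where "r = min (m - x) (m - y)"
    have xy: "\<bar>x\<bar> < \<delta>" "\<bar>y\<bar> < \<delta>" "\<phi> x < y" "\<psi> y < x" using Q by auto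
    have "x \<noteq> 0 \<or> y \<noteq> 0" using xy \<phi>(1) by auto
    then have m: "0 < m" "m < \<delta>" "\<bar>x\<bar> \<le> m" "\<bar>y\<bar> \<le> m" using xy by (auto simp: m_def)
    have r: "0 \<le> r" "r \<le> m - x" "r \<le> m - y" "r = m - x \<or> r = m - y" using m by (auto simp: r_def)
    have 1: "closed_segment (x, y) (x + r, y + r) \<subseteq> ?Q"
    proof
      fix p assume "p \<in> closed_segment (x, y) (x + r, y + r)"
      then obtain t where t: "0 \<le> t" "t \<le> 1" "p = ((1 - t) * x + t * (x + r), (1 - t) * y + t * (y + r))"
        by (auto simp: closed_segment_def)
      define k where "k = t * r"
      have p: "p = (x + k, y + k)" using t(3) by (simp add: k_def algebra_simps)
      have "0 \<le> k" "k \<le> r" using t r mult_left_le_one_le[of r t] by (auto simp: k_def)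
      then have k: "0 \<le> k" "k \<le> r" by blast+
      have b: "\<bar>x + k\<bar> < \<delta>" "\<bar>y + k\<bar> < \<delta>" using k m r by linarith+
      have "\<phi> (x + k) < y + k" "\<psi> (y + k) < x + k"
        using order_trans[OF abs_ge_self \<phi>(2)[of "x + k" x]]
          order_trans[OF abs_ge_self \<psi>(2)[of "y + k" y]] xy(3,4) k(1) by simp_all
      then show "p \<in> ?Q" using p b by simp
    qed
    have 2: "closed_segment (x + r, y + r) (m, m) \<subseteq> ?Q"
    proof
      fix p assume p: "p \<in> closed_segment (x + r, y + r) (m, m)"
      obtain a b where ab: "p = (a, b)" by force
      from p obtain t where t: "0 \<le> t" "t \<le> 1" "a = (1 - t) * (x + r) + t * m" "b = (1 - t) * (y + r) + t * m"
        by (auto simp: closed_segment_def ab)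
      have "a \<in> closed_segment (x + r) m" "b \<in> closed_segment (y + r) m"
        unfolding closed_segment_def using t by auto
      then have a: "x + r \<le> a" "a \<le> m" and b: "y + r \<le> b" "b \<le> m"
        using r(2,3) by (simp_all add: closed_segment_eq_real_ivl)
      have ab2: "\<bar>a\<bar> < \<delta>" "\<bar>b\<bar> < \<delta>" "\<bar>a\<bar> \<le> m" "\<bar>b\<bar> \<le> m" using a b m r(1) by linarith+
      have xr: "(x + r, y + r) \<in> ?Q" using 1 by auto
      from r(4) have "\<phi> a < b \<and> \<psi> b < a"
      proof
        assume *: "r = m - x"
        then have "a = m" using a by linarith
        moreover have "\<phi> m < b" using xr * b(1) by auto
        ultimately show ?thesis using \<psi>h[of b] ab2 m by auto
      next
        assume *: "r = m - y"
        then have "b = m" using b by linarith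
        moreover have "\<psi> m < a" using xr * a(1) by auto
        ultimately show ?thesis using \<phi>h[of a] ab2 m by auto
      qed
      then show "p \<in> ?Q" using ab ab2 by auto
    qed
    have "connected_component ?Q (x, y) (x + r, y + r)" "connected_component ?Q (x + r, y + r) (m, m)"
      unfolding connected_component_def using 1 2 by (meson connected_segment ends_in_segment)+
    then show ?thesis using m(1,2) connected_component_trans unfolding m_def by blast
  qed
  show ?thesis
    unfolding connected_iff_connected_component
  proof (intro ballI)
    fix p q assume pq: "p \<in> ?Q" "q \<in> ?Q"
    obtain x y x' y' where p: "p = (x, y)" "q = (x', y')" by force
    let ?m = "max \<bar>x\<bar> \<bar>y\<bar>" and ?m' = "max \<bar>x'\<bar> \<bar>y'\<bar>"
    have 1: "connected_component ?Q (x, y) (?m, ?m)" "connected_component ?Q (x', y') (?m', ?m')"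
      "0 < ?m" "?m < \<delta>" "0 < ?m'" "?m' < \<delta>"
      using to_diag[of x y] to_diag[of x' y'] pq p by blast+
    have "connected_component ?Q (?m, ?m) (?m', ?m')"
      unfolding connected_component_def
      using diag[OF 1(3-6)] by (meson connected_segment ends_in_segment)
    then show "connected_component ?Q p q"
      using 1(1,2) unfolding p by (meson connected_component_trans connected_component_sym)
  qed
next
  case False
  then have e: "?Q = {}" by (auto simp: not_less dest!: order_le_less_trans[OF abs_ge_zero])
  show ?thesis unfolding e by simp
qed

text \<open>Straight up to a height \<open>m\<close> and then sideways to (0, m): at a height that
  dominates |x| the graph is not in the way, as it stays below |x|/2. One \<open>m\<close> serves
  for both points to be joined.\<close>

lemma above_graph_connected:
  fixes \<phi> :: "real \<Rightarrow> real"
  assumes "\<phi> 0 = 0" "\<And>x x'. \<bar>\<phi> x - \<phi> x'\<bar> \<le> \<bar>x - x'\<bar> / 2"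
  shows "connected {(x, y). \<bar>x\<bar> < \<delta> \<and> \<bar>y\<bar> < \<delta> \<and> \<phi> x < y}" (is "connected ?Q")
proof (cases "\<delta> > 0")
  case \<delta>: True
  have \<phi>h: "\<bar>\<phi> x\<bar> \<le> \<bar>x\<bar> / 2" if "\<bar>x\<bar> < \<delta>" for x
    using assms(2)[of x 0] assms(1) that by auto
  have up: "connected_component ?Q (x, y) (0, m)" if Q: "(x, y) \<in> ?Q" and m: "\<bar>x\<bar> \<le> m" "\<bar>y\<bar> \<le> m" "0 < m" "m < \<delta>" for x y m
  proof -
    have 1: "closed_segment (x, y) (x, m) \<subseteq> ?Q"
    proof
      fix p assume p: "p \<in> closed_segment (x, y) (x, m)"
      obtain a b where ab: "p = (a, b)" by force
      from p obtain t where t: "0 \<le> t" "t \<le> 1" "a = (1 - t) * x + t * x" "b = (1 - t) * y + t * m"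
        by (auto simp: closed_segment_def ab)
      have "b \<in> closed_segment y m" unfolding closed_segment_def using t by auto
      then have "y \<le> b" "b \<le> m" using m by (auto simp: closed_segment_eq_real_ivl split: if_splits)
      moreover have "a = x" using t by (simp add: algebra_simps)
      ultimately show "p \<in> ?Q" using Q m ab by auto
    qed
    have 2: "closed_segment (x, m) (0, m) \<subseteq> ?Q"
    proof
      fix p assume p: "p \<in> closed_segment (x, m) (0, m)"
      obtain a b where ab: "p = (a, b)" by force
      from p obtain t where t: "0 \<le> t" "t \<le> 1" "a = (1 - t) * x" "b = (1 - t) * m + t * m"
        by (auto simp: closed_segment_def ab)
      have b: "b = m" using t by (simp add: algebra_simps)
      have "\<bar>a\<bar> \<le> \<bar>x\<bar>" using t mult_left_le_one_le[of "\<bar>x\<bar>" "1 - t"] by (auto simp: abs_mult)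
      then show "p \<in> ?Q" using \<phi>h[of a] m ab b by auto
    qed
    have "connected_component ?Q (x, y) (x, m)" "connected_component ?Q (x, m) (0, m)"
      unfolding connected_component_def using 1 2 by (meson connected_segment ends_in_segment)+
    then show ?thesis using connected_component_trans by blast
  qed
  show ?thesis
    unfolding connected_iff_connected_component
  proof (intro ballI)
    fix p q assume pq: "p \<in> ?Q" "q \<in> ?Q"
    obtain x y x' y' where p: "p = (x, y)" "q = (x', y')" by force
    define m where "m = max (\<delta>/2) (max (max \<bar>x\<bar> \<bar>y\<bar>) (max \<bar>x'\<bar> \<bar>y'\<bar>))"
    have m: "0 < m" "m < \<delta>" "\<bar>x\<bar> \<le> m" "\<bar>y\<bar> \<le> m" "\<bar>x'\<bar> \<le> m" "\<bar>y'\<bar> \<le> m"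
      unfolding m_def using pq \<delta> p by (simp_all add: less_max_iff_disj le_max_iff_disj)
    show "connected_component ?Q p q"
      using up[OF pq(1)[unfolded p] m(3,4,1,2)] up[OF pq(2)[unfolded p] m(5,6,1,2)] unfolding p
      by (meson connected_component_trans connected_component_sym)
  qed
next
  case False
  then have e: "?Q = {}" by (auto simp: not_less dest!: order_le_less_trans[OF abs_ge_zero])
  show ?thesis unfolding e by simp
qed

section \<open>Strands\<close>

definition link :: "diagram \<Rightarrow> complex set" where
  "link D = (\<Union>i<num_curves D. curve D i ` sphere 0 1)"

definition strand :: "diagram \<Rightarrow> nat \<times> complex \<Rightarrow> bool" where
  "strand D s \<longleftrightarrow> fst s < num_curves D \<and> snd s \<in> sphere 0 1"

definition point :: "diagram \<Rightarrow> nat \<times> complex \<Rightarrow> complex" where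
  "point D s = curve D (fst s) (snd s)"

definition shift :: "nat \<times> complex \<Rightarrow> real \<Rightarrow> nat \<times> complex" where
  "shift s t = (fst s, snd s * cis t)"

definition left_normal :: "diagram \<Rightarrow> nat \<times> complex \<Rightarrow> complex" where
  "left_normal D s = \<i> * tangent D s"

text \<open>The normal points to the left of the strand, so \<open>A\<close> is the left side for \<open>\<sigma> = 1\<close> and the right
  side for \<open>\<sigma> = -1\<close>.\<close>

definition sides :: "diagram \<Rightarrow> nat \<times> complex \<Rightarrow> real \<Rightarrow> complex set \<Rightarrow> complex set \<Rightarrow> bool" where
  "sides D s \<sigma> A B \<longleftrightarrow> (\<forall>\<^sub>F t in at_right 0.
    point D s + (\<sigma> * t) *\<^sub>R left_normal D s \<in> A \<and> point D s - (\<sigma> * t) *\<^sub>R left_normal D s \<in> B)"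

lemma mem_strands_iff: "s \<in> strands D p \<longleftrightarrow> strand D s \<and> point D s = p"
  by (cases s) (auto simp: strands_def strand_def point_def)

lemma shift_0 [simp]: "shift s 0 = s"
  by (simp add: shift_def)

lemma shift_shift [simp]: "shift (shift s a) b = shift s (a + b)"
  by (simp add: shift_def cis_mult mult.assoc)

lemma strand_shift [simp]: "strand D (shift s t) \<longleftrightarrow> strand D s"
  by (simp add: strand_def shift_def norm_mult)

lemma point_mem_link: "strand D s \<Longrightarrow> point D s \<in> link D"
  unfolding strand_def point_def link_def by blast

lemma link_iff: "p \<in> link D \<longleftrightarrow> (\<exists>s. strand D s \<and> point D s = p)"
proof
  assume "p \<in> link D"
  then obtain i z where "i < num_curves D" "z \<in> sphere 0 1" "p = curve D i z"
    by (auto simp: link_def)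
  then show "\<exists>s. strand D s \<and> point D s = p"
    by (intro exI[of _ "(i, z)"]) (simp add: strand_def point_def)
qed (use point_mem_link in blast)

lemma regions_eq: "regions D = components (- link D)"
  by (simp add: regions_def link_def)

lemma sphere_cis: "z \<in> sphere 0 1 \<Longrightarrow> \<exists>t\<in>{-pi..pi}. z = cis t"
  using cis_Arg[of z] Arg_bounded[of z]
  by (intro bexI[of _ "Arg z"]) (cases "z = 0", auto simp: sgn_div_norm)

text \<open>Uniform in \<open>z\<close>, since division by \<open>z\<close> moves the question to
  the point 1, where \<open>Arg\<close> is continuous.\<close>

lemma near_cis:
  assumes "0 < \<eta>"
  obtains e where "0 < e"
    "\<And>z z'. z \<in> sphere 0 1 \<Longrightarrow> z' \<in> sphere 0 1 \<Longrightarrow> dist z' z < e \<Longrightarrow> \<exists>t. \<bar>t\<bar> < \<eta> \<and> z' = z * cis t"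
proof -
  have "continuous (at 1) Arg" by (rule continuous_at_Arg) simp
  then have "\<forall>\<^sub>F w in nhds 1. \<bar>Arg w\<bar> < \<eta>"
    unfolding continuous_at tendsto_at_iff_tendsto_nhds[of Arg] using assms
    by (auto simp: dist_real_def tendsto_iff)
  then obtain e where e: "e > 0" "\<And>w. dist w 1 < e \<Longrightarrow> \<bar>Arg w\<bar> < \<eta>"
    unfolding eventually_nhds_metric by auto
  show thesis
  proof (rule that[OF e(1)])
    fix z z' :: complex assume z: "z \<in> sphere 0 1" "z' \<in> sphere 0 1" "dist z' z < e"
    have z0: "z \<noteq> 0" "z' \<noteq> 0" using z by auto
    have "z' / z - 1 = (z' - z) / z" using z0 by (simp add: diff_divide_distrib)
    then have "norm (z' / z - 1) < e" using z by (simp add: dist_norm norm_divide)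
    then have "\<bar>Arg (z' / z)\<bar> < \<eta>" using e(2) by (simp add: dist_norm)
    moreover have "cis (Arg (z' / z)) = z' / z"
      using cis_Arg[of "z' / z"] z z0 by (simp add: sgn_div_norm norm_divide)
    ultimately show "\<exists>t. \<bar>t\<bar> < \<eta> \<and> z' = z * cis t"
      using z0 by (intro exI[of _ "Arg (z' / z)"]) simp
  qed
qed

lemma small_box:
  assumes uv: "Im (cnj u * v) \<noteq> 0" and U: "open U" "p \<in> U"
  obtains \<delta> where "0 < \<delta>" "\<And>q. \<bar>coord u v (q - p)\<bar> < \<delta> \<Longrightarrow> \<bar>coord v u (q - p)\<bar> < \<delta> \<Longrightarrow> q \<in> U"
proof -
  obtain e where e: "0 < e" "ball p e \<subseteq> U" using U open_contains_ball by blast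
  define C where "C = norm u + norm v"
  have C: "0 < C" using uv unfolding C_def by (intro add_pos_nonneg) auto
  show thesis
  proof (rule that[of "e / C"])
    show "0 < e / C" using e C by simp
    fix q assume q: "\<bar>coord u v (q - p)\<bar> < e / C" "\<bar>coord v u (q - p)\<bar> < e / C"
    have "norm (q - p) \<le> \<bar>coord u v (q - p)\<bar> * norm u + \<bar>coord v u (q - p)\<bar> * norm v"
      by (subst coord_expand[OF uv, of "q - p"]) (metis norm_scaleR norm_triangle_ineq)
    also have "\<dots> < e / C * norm u + e / C * norm v"
      using q uv by (intro add_strict_mono mult_strict_right_mono) auto
    also have "\<dots> = e / C * C" by (simp only: C_def distrib_left)
    also have "\<dots> = e" using C by simp
    finally show "q \<in> U" using e(2) by (auto simp: dist_norm norm_minus_commute)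
  qed
qed

section \<open>Smoothness of the strands and compactness of the link\<close>

context
  fixes D assumes D: "link_diagram D"
begin

lemma tangent_nz: "strand D s \<Longrightarrow> tangent D s \<noteq> 0"
  using D by (cases s) (auto simp: link_diagram_def strand_def)

text \<open>\<open>link_diagram\<close> provides derivatives at angle 0 only, but for every strand;
  taking \<open>shift s t\<close> as the new origin gives the derivative at
  \<open>t\<close>.\<close>

lemma has_tangent:
  assumes "strand D s"
  shows "((\<lambda>t. point D (shift s t)) has_vector_derivative tangent D (shift s t)) (at t)"
proof -
  obtain i z where s: "s = (i, z)" by force
  have 0: "((\<lambda>h. curve D i (z * cis t * cis h)) has_vector_derivative tangent D (i, z * cis t)) (at 0)"
    using D assms unfolding s link_diagram_def strand_def tangent_def
    by (simp add: norm_mult vector_derivative_works)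
  have "((\<lambda>h. curve D i (z * cis t * cis h)) \<circ> (\<lambda>x. x - t) has_vector_derivative
      (1::real) *\<^sub>R tangent D (i, z * cis t)) (at t)"
    by (rule vector_diff_chain_at) (use 0 in \<open>auto intro!: derivative_eq_intros\<close>)
  moreover have "(\<lambda>h. curve D i (z * cis t * cis h)) \<circ> (\<lambda>x. x - t) = (\<lambda>t. point D (shift s t))"
    by (simp add: fun_eq_iff point_def shift_def s mult.assoc cis_mult)
  ultimately show ?thesis by (simp add: s shift_def)
qed

lemma continuous_point_shift: "strand D s \<Longrightarrow> continuous_on S (\<lambda>t. point D (shift s t))"
  by (intro continuous_at_imp_continuous_on ballI has_vector_derivative_continuous[OF has_tangent])

lemma continuous_tangent_shift:
  assumes "strand D s"
  shows "continuous_on S (\<lambda>t. tangent D (shift s t))"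
proof -
  obtain i z where s: "s = (i, z)" by force
  have "continuous_on (sphere 0 1) (\<lambda>z. tangent D (i, z))"
    using D assms by (auto simp: link_diagram_def strand_def s)
  then have "continuous_on S (\<lambda>t. tangent D (i, z * cis t))"
    by (rule continuous_on_compose2)
      (use assms in \<open>auto simp: strand_def s norm_mult cis_conv_exp intro!: continuous_intros\<close>)
  then show ?thesis by (simp add: shift_def s)
qed

lemma link_eq: "link D = (\<Union>i<num_curves D. (\<lambda>t. point D (shift (i, 1) t)) ` {-pi..pi})"
proof -
  have "sphere 0 1 = cis ` {-pi..pi}"
  proof
    show "sphere 0 1 \<subseteq> cis ` {-pi..pi}" using sphere_cis by blast
  qed auto
  then have "curve D i ` sphere 0 1 = (\<lambda>t. curve D i (cis t)) ` {-pi..pi}" for i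
    by (simp add: image_image)
  then show ?thesis by (simp add: link_def shift_def point_def)
qed

lemma compact_link: "compact (link D)"
  unfolding link_eq
  by (intro compact_UN compact_continuous_image continuous_point_shift) (auto simp: strand_def)

lemma open_minus_link: "open (- link D)"
  using compact_link compact_imp_closed by blast

lemma finite_strands: "finite (strands D p)" and card_strands: "card (strands D p) \<le> 2"
  using D by (auto simp: link_diagram_def)

text \<open>Compactness keeps the rest of the link away from \<open>p\<close>: the parameters not
  close to a strand through \<open>p\<close> form a compact set, whose image misses \<open>p\<close>
  and so has positive distance from it. This is why a chart at \<open>p\<close> can be built from
  the local graphs of the strands through \<open>p\<close> alone.\<close>

lemma near_strands:
  assumes "0 < \<eta>"
  obtains \<rho> where "0 < \<rho>" "\<And>s. strand D s \<Longrightarrow> dist (point D s) p < \<rho> \<Longrightarrow>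
    \<exists>s0 t. s0 \<in> strands D p \<and> \<bar>t\<bar> < \<eta> \<and> s = shift s0 t"
proof -
  obtain e where e: "0 < e"
    "\<And>z z'. z \<in> sphere 0 1 \<Longrightarrow> z' \<in> sphere 0 1 \<Longrightarrow> dist z' z < e \<Longrightarrow> \<exists>t. \<bar>t\<bar> < \<eta> \<and> z' = z * cis t"
    using near_cis[OF assms] by metis
  define far where "far i = {-pi..pi} \<inter>
    (\<Inter>s\<in>{s\<in>strands D p. fst s = i}. {t. e \<le> dist (cis t) (snd s)})" for i
  have "compact (far i)" for i
    unfolding far_def
    by (intro compact_Int_closed closed_INT ballI closed_Collect_le)
      (auto simp: cis_conv_exp intro!: continuous_intros)
  then have cpt: "compact (\<Union>i<num_curves D. (\<lambda>t. point D (shift (i, 1) t)) ` far i)" (is "compact ?F")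
    by (intro compact_UN compact_continuous_image continuous_point_shift) (auto simp: strand_def)
  have "p \<notin> ?F"
  proof
    assume "p \<in> ?F"
    then obtain i t where it: "i < num_curves D" "t \<in> far i" "p = point D (shift (i, 1) t)" by auto
    then have "shift (i, 1) t \<in> strands D p" by (auto simp: mem_strands_iff strand_def shift_def)
    then show False using it(2) e(1) by (auto simp: far_def shift_def)
  qed
  then have "\<exists>\<rho>>0. \<forall>x\<in>?F. \<rho> \<le> dist p x"
    by (rule separate_point_closed[OF compact_imp_closed[OF cpt]])
  then obtain \<rho> where \<rho>: "0 < \<rho>" "\<forall>x\<in>?F. \<rho> \<le> dist p x" by blast
  show thesis
  proof (rule that[OF \<rho>(1)])
    fix s assume s: "strand D s" "dist (point D s) p < \<rho>"
    obtain t where t: "t \<in> {-pi..pi}" "snd s = cis t"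
      using sphere_cis[of "snd s"] s(1) unfolding strand_def by blast
    have "point D s = point D (shift (fst s, 1) t)" by (simp add: point_def shift_def t)
    then have "point D s \<in> ?F" if "t \<in> far (fst s)"
      using that s(1) unfolding strand_def by blast
    moreover have "point D s \<notin> ?F"
    proof
      assume "point D s \<in> ?F"
      then have "\<rho> \<le> dist p (point D s)" by (rule bspec[OF \<rho>(2)])
      then show False using s(2) by (simp add: dist_commute)
    qed
    ultimately have "t \<notin> far (fst s)" by blast
    then obtain s0 where s0: "s0 \<in> strands D p" "fst s0 = fst s" "dist (snd s) (snd s0) < e"
      using t by (auto simp: far_def not_le)
    then obtain t' where "\<bar>t'\<bar> < \<eta>" "snd s = snd s0 * cis t'"
      using e(2)[of "snd s0" "snd s"] s by (auto simp: mem_strands_iff strand_def)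
    then show "\<exists>s0 t. s0 \<in> strands D p \<and> \<bar>t\<bar> < \<eta> \<and> s = shift s0 t"
      using s0 by (intro exI[of _ s0] exI[of _ t']) (auto simp: shift_def prod_eq_iff)
  qed
qed

end

section \<open>Charts of a diagram\<close>

text \<open>The overpasser \<open>a\<close> is drawn pointing up, and the underpasser \<open>b\<close> pointing to the right if \<open>\<sigma> = 1\<close>
  and to the left if \<open>\<sigma> = -1\<close>; then \<open>V\<close>, \<open>W\<close>, \<open>Y\<close>, \<open>X\<close> are the quadrants of the informal statement.\<close>

definition crossing_chart :: "diagram \<Rightarrow> nat \<times> complex \<Rightarrow> nat \<times> complex \<Rightarrow> real \<Rightarrow> real \<Rightarrow> complex set \<Rightarrow>
    complex set \<Rightarrow> complex set \<Rightarrow> complex set \<Rightarrow> complex set \<Rightarrow> bool" where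
  "crossing_chart D a b \<sigma> \<eta> N V W Y X \<longleftrightarrow>
    open N \<and> point D a \<in> N \<and>
    open V \<and> open W \<and> open Y \<and> open X \<and> connected V \<and> connected W \<and> connected Y \<and> connected X \<and>
    V \<inter> W = {} \<and> V \<inter> Y = {} \<and> V \<inter> X = {} \<and> W \<inter> Y = {} \<and> W \<inter> X = {} \<and> Y \<inter> X = {} \<and>
    N - link D = V \<union> W \<union> Y \<union> X \<and>
    (\<forall>t. 0 < t \<and> t < \<eta> \<longrightarrow>
      (point D (shift a t) \<in> N \<longrightarrow> point D (shift a t) \<notin> crossings D \<and> sides D (shift a t) 1 V W) \<and>
      (point D (shift a (- t)) \<in> N \<longrightarrow> point D (shift a (- t)) \<notin> crossings D \<and> sides D (shift a (- t)) 1 Y X) \<and>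
      (point D (shift b (\<sigma> * t)) \<in> N \<longrightarrow> point D (shift b (\<sigma> * t)) \<notin> crossings D \<and> sides D (shift b (\<sigma> * t)) \<sigma> W X) \<and>
      (point D (shift b (- (\<sigma> * t))) \<in> N \<longrightarrow> point D (shift b (- (\<sigma> * t))) \<notin> crossings D \<and>
        sides D (shift b (- (\<sigma> * t))) \<sigma> V Y)) \<and>
    (\<forall>s'. strand D s' \<longrightarrow> point D s' \<in> N \<longrightarrow> s' = a \<or> s' = b \<or>
      (\<exists>t. 0 < t \<and> t < \<eta> \<and>
        (s' = shift a t \<or> s' = shift a (- t) \<or> s' = shift b (\<sigma> * t) \<or> s' = shift b (- (\<sigma> * t))))) \<and>
    (\<forall>\<^sub>F h in at_right 0.
      point D a + h *\<^sub>R (tangent D a - \<sigma> *\<^sub>R tangent D b) \<in> V \<and>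
      point D a + h *\<^sub>R (tangent D a + \<sigma> *\<^sub>R tangent D b) \<in> W \<and>
      point D a + h *\<^sub>R (- tangent D a - \<sigma> *\<^sub>R tangent D b) \<in> Y \<and>
      point D a + h *\<^sub>R (- tangent D a + \<sigma> *\<^sub>R tangent D b) \<in> X)"

definition branch :: "diagram \<Rightarrow> complex set \<Rightarrow> nat \<times> complex \<Rightarrow> real \<Rightarrow> complex set \<Rightarrow> complex set \<Rightarrow> bool" where
  "branch D N s \<sigma> A B \<longleftrightarrow> point D s \<in> N \<and> point D s \<notin> crossings D \<and> sides D s \<sigma> A B"

text \<open>For positive \<open>t\<close>, \<open>shift b (\<sigma> * t)\<close> runs along the
  right half of the underpasser, whichever way it is parametrized. Its left normal points up just
  for \<sigma> = 1, hence the sign \<sigma> in the sides.\<close>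

definition chart_branches :: "diagram \<Rightarrow> nat \<times> complex \<Rightarrow> nat \<times> complex \<Rightarrow> real \<Rightarrow> complex set \<Rightarrow>
    complex set \<Rightarrow> complex set \<Rightarrow> complex set \<Rightarrow> complex set \<Rightarrow> real \<Rightarrow> bool" where
  "chart_branches D a b \<sigma> N V W Y X t \<longleftrightarrow>
    branch D N (shift a t) 1 V W \<and> branch D N (shift a (- t)) 1 Y X \<and>
    branch D N (shift b (\<sigma> * t)) \<sigma> W X \<and> branch D N (shift b (- (\<sigma> * t))) \<sigma> V Y"

context
  fixes D assumes D: "link_diagram D"
begin

text \<open>Only one strand passes through the point, so by \<open>near_strands\<close> a small box
  contains a single local graph of the link, and \<open>L\<close> and \<open>R\<close> are the parts
  of the box above and below it. The conclusion covers every strand in the box, because sides are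
  needed along the strand and not just at the centre.\<close>

lemma regular_chart:
  assumes s: "strand D s" "point D s \<notin> crossings D" and U: "open U" "point D s \<in> U" and \<eta>0: "0 < \<eta>0"
  obtains N L R where "open N" "point D s \<in> N" "N \<subseteq> U" "open L" "connected L" "open R" "connected R"
    "L \<inter> R = {}" "N - link D = L \<union> R"
    "\<And>s'. strand D s' \<Longrightarrow> point D s' \<in> N \<Longrightarrow>
      (\<exists>t. \<bar>t\<bar> < \<eta>0 \<and> s' = shift s t) \<and> point D s' \<notin> crossings D \<and> sides D s' 1 L R"
proof -
  define p where "p = point D s"
  define u where "u = tangent D s"
  \<comment> \<open>With the left normal as second direction \<open>(u, v)\<close> is positively
    oriented, so the left side lies above the graph.\<close>
  define v where "v = \<i> * u"
  have u0: "u \<noteq> 0" using tangent_nz[OF D s(1)] by (simp add: u_def)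
  have "Im (cnj u * v) = (norm u)\<^sup>2"
    unfolding cmod_power2 by (simp add: v_def power2_eq_square)
  then have uv: "Im (cnj u * v) > 0" using u0 by simp
  have strands: "strands D p = {s}"
  proof -
    have "s \<in> strands D p" using s by (simp add: mem_strands_iff p_def)
    moreover have "card (strands D p) \<noteq> 2" using s by (simp add: crossings_def p_def)
    ultimately have "card (strands D p) = 1"
      using card_strands[OF D, of p] finite_strands[OF D, of p]
      by (metis One_nat_def Suc_1 card_gt_0_iff empty_iff le_SucE le_zero_eq less_numeral_extra(3))
    then show ?thesis using \<open>s \<in> strands D p\<close> by (metis card_1_singletonE singletonD)
  qed
  define \<gamma> where "\<gamma> t = point D (shift s t)" for t
  define \<gamma>' where "\<gamma>' t = tangent D (shift s t)" for t
  have der: "(\<gamma> has_vector_derivative \<gamma>' t) (at t)" for t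
    unfolding \<gamma>_def \<gamma>'_def by (rule has_tangent[OF D s(1)])
  have cont: "isCont \<gamma>' 0"
    using continuous_tangent_shift[OF D s(1), of UNIV] unfolding \<gamma>'_def
    by (simp add: continuous_on_eq_continuous_at)
  have \<gamma>0: "\<gamma> 0 = p" "\<gamma>' 0 = u" by (simp_all add: \<gamma>_def \<gamma>'_def p_def u_def)
  have "Im (cnj u * v) \<noteq> 0" "0 < \<eta>0 / 2" using uv \<eta>0 by auto
  then obtain \<eta> \<delta> \<phi> where \<eta>_le: "\<eta> \<le> \<eta>0 / 2" and loc: "local_graph \<gamma> \<gamma>' u v \<eta> \<delta> \<phi>"
    using local_graph_exists[OF der cont \<gamma>0(2)[symmetric]] by blast
  have \<eta>: "0 < \<eta>" and \<delta>: "0 < \<delta>" and \<phi>0: "\<phi> 0 = 0"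
    and lip: "\<And>x x'. \<bar>\<phi> x - \<phi> x'\<bar> \<le> \<bar>x - x'\<bar> / 2"
    and graph: "\<And>t. \<bar>t\<bar> \<le> \<eta> \<Longrightarrow> \<bar>coord u v (\<gamma> t - p)\<bar> \<le> \<delta> \<Longrightarrow>
      coord v u (\<gamma> t - p) = \<phi> (coord u v (\<gamma> t - p))"
    and onto: "\<And>x. \<bar>x\<bar> \<le> \<delta> \<Longrightarrow> \<exists>t. \<bar>t\<bar> \<le> \<eta> \<and> coord u v (\<gamma> t - p) = x"
    and mono: "\<And>t t'. \<bar>t\<bar> \<le> \<eta> \<Longrightarrow> \<bar>t'\<bar> \<le> \<eta> \<Longrightarrow> t < t' \<Longrightarrow> coord u v (\<gamma> t) < coord u v (\<gamma> t')"
    and side: "\<And>t h. \<bar>t\<bar> \<le> \<eta> \<Longrightarrow> h \<noteq> 0 \<Longrightarrow>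
      \<bar>coord u v (\<gamma> t - p)\<bar> \<le> \<delta> \<Longrightarrow> \<bar>coord u v (\<gamma> t + h *\<^sub>R (\<i> * \<gamma>' t) - p)\<bar> \<le> \<delta> \<Longrightarrow>
      0 < h * sgn (Im (cnj u * v)) * (coord v u (\<gamma> t + h *\<^sub>R (\<i> * \<gamma>' t) - p)
        - \<phi> (coord u v (\<gamma> t + h *\<^sub>R (\<i> * \<gamma>' t) - p)))"
    using loc unfolding local_graph_def \<gamma>0 by (elim conjE; blast)+
  obtain \<rho> where \<rho>: "0 < \<rho>" "\<And>s'. strand D s' \<Longrightarrow> dist (point D s') p < \<rho> \<Longrightarrow>
      \<exists>s0 t. s0 \<in> strands D p \<and> \<bar>t\<bar> < \<eta> \<and> s' = shift s0 t"
    using near_strands[OF D \<eta>, of p] by metis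
  have Up: "open (U \<inter> ball p \<rho>)" "p \<in> U \<inter> ball p \<rho>" using U \<rho>(1) by (auto simp: p_def)
  obtain \<delta>1 where \<delta>1: "0 < \<delta>1"
    "\<And>q. \<bar>coord u v (q - p)\<bar> < \<delta>1 \<Longrightarrow> \<bar>coord v u (q - p)\<bar> < \<delta>1 \<Longrightarrow> q \<in> U \<inter> ball p \<rho>"
    using small_box[OF \<open>Im (cnj u * v) \<noteq> 0\<close> Up] by blast
  define \<delta>2 where "\<delta>2 = min \<delta> \<delta>1"
  have \<delta>2: "0 < \<delta>2" "\<delta>2 \<le> \<delta>" "\<delta>2 \<le> \<delta>1" using \<delta> \<delta>1(1) by (auto simp: \<delta>2_def)
  define X where "X q = coord u v (q - p)" for q
  define Y where "Y q = coord v u (q - p)" for q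
  have XYp: "X (p + (x *\<^sub>R u + y *\<^sub>R v)) = x" "Y (p + (x *\<^sub>R u + y *\<^sub>R v)) = y" for x y
    using coord_combine[of u v] uv by (simp_all add: X_def Y_def)
  have XYinv: "p + (X q *\<^sub>R u + Y q *\<^sub>R v) = q" for q
    using coord_expand[of u v "q - p"] uv by (simp add: X_def Y_def)
  have contX: "continuous_on S X" and contY: "continuous_on S Y" for S
    unfolding X_def Y_def by (intro continuous_intros)+
  have cont\<phi>: "continuous_on S \<phi>" for S
  proof (rule continuous_on_subset)
    have "(1/2)-lipschitz_on UNIV \<phi>" by (rule lipschitz_onI) (use lip in \<open>auto simp: dist_real_def\<close>)
    then show "continuous_on UNIV \<phi>" by (rule lipschitz_on_continuous_on)
  qed simp
  define N where "N = {q. \<bar>X q\<bar> < \<delta>2 \<and> \<bar>Y q\<bar> < \<delta>2}"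
  define H where "H a = {q. \<bar>X q\<bar> < \<delta>2 \<and> \<bar>Y q\<bar> < \<delta>2 \<and> 0 < a * (Y q - \<phi> (X q))}" for a :: real
  have NU: "q \<in> U" "dist q p < \<rho>" if "q \<in> N" for q
    using \<delta>1(2)[of q] that \<delta>2 by (auto simp: N_def X_def Y_def dist_commute)
  have openN: "open N" unfolding N_def
    by (intro open_Collect_conj open_Collect_less continuous_intros contX contY)
  have openH: "open (H a)" for a unfolding H_def
    by (intro open_Collect_conj open_Collect_less continuous_intros contX contY
        continuous_on_compose2[OF cont\<phi> contX]) auto
  have connH: "connected (H a)" if a: "a = 1 \<or> a = -1" for a
  proof -
    \<comment> \<open>The factor \<open>a\<close> reflects the lower half onto an upper one, so that
      \<open>above_graph_connected\<close> applies to both.\<close>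
    let ?Q = "{(x, y). \<bar>x\<bar> < \<delta>2 \<and> \<bar>y\<bar> < \<delta>2 \<and> a * \<phi> x < y}"
    have "connected ?Q" using lip a \<phi>0 by (intro above_graph_connected) (auto simp: abs_minus_commute)
    then have "connected ((\<lambda>(x, y). p + (x *\<^sub>R u + (a * y) *\<^sub>R v)) ` ?Q)"
      by (rule connected_continuous_image[rotated])
        (auto simp: case_prod_unfold intro!: continuous_intros)
    moreover have "(\<lambda>(x, y). p + (x *\<^sub>R u + (a * y) *\<^sub>R v)) ` ?Q = H a"
    proof (intro equalityI subsetI)
      fix q assume "q \<in> H a"
      then have "(X q, a * Y q) \<in> ?Q" "q = (\<lambda>(x, y). p + (x *\<^sub>R u + (a * y) *\<^sub>R v)) (X q, a * Y q)"
        using a XYinv[of q] by (auto simp: H_def)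
      then show "q \<in> (\<lambda>(x, y). p + (x *\<^sub>R u + (a * y) *\<^sub>R v)) ` ?Q" by blast
    qed (use a XYp[of _ "- _", simplified] in \<open>auto simp: H_def XYp\<close>)
    ultimately show ?thesis by simp
  qed
  have in_graph: "\<exists>t. \<bar>t\<bar> < \<eta> \<and> s' = shift s t \<and> Y (point D s') = \<phi> (X (point D s'))"
    if s': "strand D s'" "point D s' \<in> N" for s'
  proof -
    obtain t where t: "\<bar>t\<bar> < \<eta>" "s' = shift s t"
      using \<rho>(2)[OF s'(1)] NU(2)[OF s'(2)] strands by auto
    have "Y (\<gamma> t) = \<phi> (X (\<gamma> t))"
      using graph[of t] t s'(2) \<delta>2 unfolding X_def Y_def by (simp add: N_def \<gamma>_def X_def)
    then show ?thesis using t by (auto simp: \<gamma>_def)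
  qed
  have link_graph: "q \<in> link D \<longleftrightarrow> Y q = \<phi> (X q)" if q: "q \<in> N" for q
  proof
    assume "q \<in> link D" then show "Y q = \<phi> (X q)" using in_graph q by (auto simp: link_iff)
  next
    assume Yq: "Y q = \<phi> (X q)"
    obtain t where t: "\<bar>t\<bar> \<le> \<eta>" "X (\<gamma> t) = X q"
      using onto[of "X q"] q \<delta>2 by (auto simp: N_def X_def)
    have "Y (\<gamma> t) = \<phi> (X (\<gamma> t))"
      using graph[of t] t q \<delta>2 unfolding X_def[symmetric] Y_def[symmetric] by (simp add: N_def)
    then have "\<gamma> t = q" using XYinv[of q] XYinv[of "\<gamma> t"] t Yq by simp
    then show "q \<in> link D" using point_mem_link[of D "shift s t"] s by (simp add: \<gamma>_def)
  qed
  show thesis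
  proof (rule that[of N "H 1" "H (-1)"])
    show "point D s \<in> N" using \<delta>2 by (simp add: N_def X_def Y_def p_def coord_zero)
    show "H 1 \<inter> H (-1) = {}" by (auto simp: H_def)
    show "N - link D = H 1 \<union> H (-1)"
    proof (intro equalityI subsetI)
      fix q assume q: "q \<in> N - link D"
      then have "Y q \<noteq> \<phi> (X q)" using link_graph by auto
      then show "q \<in> H 1 \<union> H (-1)" using q by (auto simp: H_def N_def)
    next
      fix q assume q: "q \<in> H 1 \<union> H (-1)"
      then have "q \<in> N" "Y q \<noteq> \<phi> (X q)" by (auto simp: H_def N_def)
      then show "q \<in> N - link D" using link_graph by auto
    qed
    fix s' assume s': "strand D s'" "point D s' \<in> N"
    obtain t where t: "\<bar>t\<bar> < \<eta>" "s' = shift s t" using in_graph[OF s'] by blast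
    have pt: "point D s' = \<gamma> t" "left_normal D s' = \<i> * \<gamma>' t" using t by (simp_all add: \<gamma>_def \<gamma>'_def left_normal_def)
    \<comment> \<open>Strands at the same point have the same first coordinate, which is strictly
      monotone along the curve.\<close>
    have "strands D (point D s') \<subseteq> {s'}"
    proof
      fix s'' assume "s'' \<in> strands D (point D s')"
      then have s'': "strand D s''" "point D s'' = point D s'" by (auto simp: mem_strands_iff)
      obtain t' where t': "\<bar>t'\<bar> < \<eta>" "s'' = shift s t'" using in_graph[of s''] s'' s' by auto
      have "coord u v (\<gamma> t') = coord u v (\<gamma> t)" using s'' t' t by (simp add: \<gamma>_def)
      then have "t' = t" using mono[of t t'] mono[of t' t] t t' by (cases t t' rule: linorder_cases) auto
      then show "s'' \<in> {s'}" using t t' by simp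
    qed
    then have "card (strands D (point D s')) \<le> 1" using card_mono[of "{s'}"] by fastforce
    then have "point D s' \<notin> crossings D" by (simp add: crossings_def)
    moreover have "sides D s' 1 (H 1) (H (-1))"
    proof -
      have ev: "\<forall>\<^sub>F h in at_right 0. \<gamma> t + (c * h) *\<^sub>R (\<i> * \<gamma>' t) \<in> N" for c :: real
      proof -
        have "((\<lambda>h. \<gamma> t + (c * h) *\<^sub>R (\<i> * \<gamma>' t)) \<longlongrightarrow> \<gamma> t + (c * 0) *\<^sub>R (\<i> * \<gamma>' t)) (at_right 0)"
          by (intro tendsto_intros)
        then show ?thesis using topological_tendstoD[OF _ openN] s'(2) pt by simp
      qed
      have "\<forall>\<^sub>F h in at_right 0. \<gamma> t + h *\<^sub>R (\<i> * \<gamma>' t) \<in> H 1 \<and> \<gamma> t - h *\<^sub>R (\<i> * \<gamma>' t) \<in> H (-1)"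
        using ev[of 1] ev[of "-1"] eventually_at_right_less[of 0]
      proof eventually_elim
        case (elim h)
        have *: "0 < h * (Y (\<gamma> t + h *\<^sub>R (\<i> * \<gamma>' t)) - \<phi> (X (\<gamma> t + h *\<^sub>R (\<i> * \<gamma>' t))))"
          "0 < (- h) * (Y (\<gamma> t + (- h) *\<^sub>R (\<i> * \<gamma>' t)) - \<phi> (X (\<gamma> t + (- h) *\<^sub>R (\<i> * \<gamma>' t))))"
          using side[of t h] side[of t "-h"] t elim \<delta>2 uv s'(2) pt
          unfolding N_def X_def[symmetric] Y_def[symmetric] by (simp_all add: sgn_if)
        have "0 < Y (\<gamma> t + h *\<^sub>R (\<i> * \<gamma>' t)) - \<phi> (X (\<gamma> t + h *\<^sub>R (\<i> * \<gamma>' t)))"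
          using *(1) elim(3) by (simp add: zero_less_mult_iff)
        moreover have "0 > Y (\<gamma> t + (-h) *\<^sub>R (\<i> * \<gamma>' t)) - \<phi> (X (\<gamma> t + (-h) *\<^sub>R (\<i> * \<gamma>' t)))"
          using *(2) elim(3) by (simp add: zero_less_mult_iff mult_less_0_iff)
        ultimately show ?case using elim by (auto simp: H_def N_def)
      qed
      then show ?thesis by (simp add: sides_def pt)
    qed
    ultimately show "(\<exists>t. \<bar>t\<bar> < \<eta>0 \<and> s' = shift s t) \<and> point D s' \<notin> crossings D \<and> sides D s' 1 (H 1) (H (-1))"
      using t \<eta> \<eta>_le \<eta>0 by (auto intro!: exI[of _ t])
  qed (use openN openH connH NU in auto)
qed

text \<open>The overpasser is a graph \<psi> over the direction \<open>u\<close> and the underpasser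
  a graph \<phi> over the direction \<open>v\<close>, both of slope at most 1/2. So they meet only
  in \<open>c\<close>, and the signs of \<open>Y q - \<phi> (X q)\<close> and
  \<open>X q - \<psi> (Y q)\<close> single out the four quadrants.\<close>

lemma crossing_chart_exists:
  assumes c: "point D a = c" and ab: "strands D c = {a, b}" and U: "open U" "c \<in> U" and \<eta>0: "0 < \<eta>0"
    and \<sigma>: "\<sigma> = 1 \<or> \<sigma> = -1" and pos: "0 < Im (cnj (\<sigma> *\<^sub>R tangent D b) * tangent D a)"
  obtains \<eta> N V W Y X where "0 < \<eta>" "\<eta> \<le> \<eta>0" "N \<subseteq> U" "crossing_chart D a b \<sigma> \<eta> N V W Y X"
proof -
  define u where "u = tangent D a"
  define v where "v = \<sigma> *\<^sub>R tangent D b"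
  have vu: "Im (cnj v * u) > 0" using pos by (simp add: u_def v_def)
  have uv: "Im (cnj u * v) < 0" using vu by (simp add: mult.commute)
  have \<sigma>2: "\<sigma> * (\<sigma> * r) = r" for r using \<sigma> by auto
  have sa: "strand D a" and sb: "strand D b" "point D b = c"
    using ab mem_strands_iff[of a D c] mem_strands_iff[of b D c] by simp_all
  define \<gamma>1 where "\<gamma>1 t = point D (shift a t)" for t
  define \<gamma>1' where "\<gamma>1' t = tangent D (shift a t)" for t
  \<comment> \<open>The underpasser traversed from left to right: with the factor \<sigma> its
    velocity at 0 is \<open>v\<close>.\<close>
  define \<gamma>2 where "\<gamma>2 t = point D (shift b (\<sigma> * t))" for t
  define \<gamma>2' where "\<gamma>2' t = \<sigma> *\<^sub>R tangent D (shift b (\<sigma> * t))" for t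
  have der1: "(\<gamma>1 has_vector_derivative \<gamma>1' t) (at t)" for t
    unfolding \<gamma>1_def \<gamma>1'_def by (rule has_tangent[OF D sa])
  have der2: "(\<gamma>2 has_vector_derivative \<gamma>2' t) (at t)" for t
  proof -
    have "((\<lambda>t. point D (shift b t)) \<circ> (\<lambda>t. \<sigma> * t) has_vector_derivative
        \<sigma> *\<^sub>R tangent D (shift b (\<sigma> * t))) (at t)"
      by (rule vector_diff_chain_at[OF _ has_tangent[OF D sb(1)]])
        (auto intro!: derivative_eq_intros)
    moreover have "(\<lambda>t. point D (shift b t)) \<circ> (\<lambda>t. \<sigma> * t) = \<gamma>2" by (simp add: fun_eq_iff \<gamma>2_def)
    ultimately show ?thesis by (simp add: \<gamma>2'_def)
  qed
  have cont1: "isCont \<gamma>1' 0"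
    using continuous_tangent_shift[OF D sa, of UNIV] unfolding \<gamma>1'_def
    by (simp add: continuous_on_eq_continuous_at)
  have cont2: "isCont \<gamma>2' 0"
  proof -
    have "continuous_on UNIV (\<lambda>t. tangent D (shift b (\<sigma> * t)))"
      by (rule continuous_on_compose2[OF continuous_tangent_shift[OF D sb(1), of UNIV]])
        (auto intro!: continuous_intros)
    then have "continuous_on UNIV \<gamma>2'" unfolding \<gamma>2'_def by (intro continuous_intros)
    then show ?thesis by (simp add: continuous_on_eq_continuous_at)
  qed
  have \<gamma>0: "\<gamma>1 0 = c" "\<gamma>1' 0 = u" "\<gamma>2 0 = c" "\<gamma>2' 0 = v"
    using c sb by (simp_all add: \<gamma>1_def \<gamma>1'_def \<gamma>2_def \<gamma>2'_def u_def v_def)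
  have "Im (cnj u * v) \<noteq> 0" "Im (cnj v * u) \<noteq> 0" "0 < \<eta>0 / 2" using uv vu \<eta>0 by auto
  then obtain \<eta>1 \<delta>1 \<psi> \<eta>2 \<delta>2 \<phi> where \<eta>_le: "\<eta>1 \<le> \<eta>0 / 2" "\<eta>2 \<le> \<eta>0 / 2"
    and loc1: "local_graph \<gamma>1 \<gamma>1' u v \<eta>1 \<delta>1 \<psi>" and loc2: "local_graph \<gamma>2 \<gamma>2' v u \<eta>2 \<delta>2 \<phi>"
    using local_graph_exists[OF der1 cont1 \<gamma>0(2)[symmetric]]
      local_graph_exists[OF der2 cont2 \<gamma>0(4)[symmetric]] by metis
  define X where "X q = coord v u (q - c)" for q
  define Y where "Y q = coord u v (q - c)" for q
  have \<eta>1: "0 < \<eta>1" and \<delta>1: "0 < \<delta>1" and \<psi>0: "\<psi> 0 = 0"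
    and lip1: "\<And>x x'. \<bar>\<psi> x - \<psi> x'\<bar> \<le> \<bar>x - x'\<bar> / 2"
    and graph1: "\<And>t. \<bar>t\<bar> \<le> \<eta>1 \<Longrightarrow> \<bar>Y (\<gamma>1 t)\<bar> \<le> \<delta>1 \<Longrightarrow> X (\<gamma>1 t) = \<psi> (Y (\<gamma>1 t))"
    and onto1: "\<And>x. \<bar>x\<bar> \<le> \<delta>1 \<Longrightarrow> \<exists>t. \<bar>t\<bar> \<le> \<eta>1 \<and> Y (\<gamma>1 t) = x"
    and mono1': "\<And>t t'. \<bar>t\<bar> \<le> \<eta>1 \<Longrightarrow> \<bar>t'\<bar> \<le> \<eta>1 \<Longrightarrow> t < t' \<Longrightarrow> coord u v (\<gamma>1 t) < coord u v (\<gamma>1 t')"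
    and side1: "\<And>t h. \<bar>t\<bar> \<le> \<eta>1 \<Longrightarrow> h \<noteq> 0 \<Longrightarrow>
      \<bar>Y (\<gamma>1 t)\<bar> \<le> \<delta>1 \<Longrightarrow> \<bar>Y (\<gamma>1 t + h *\<^sub>R (\<i> * \<gamma>1' t))\<bar> \<le> \<delta>1 \<Longrightarrow>
      0 < h * sgn (Im (cnj u * v)) * (X (\<gamma>1 t + h *\<^sub>R (\<i> * \<gamma>1' t))
        - \<psi> (Y (\<gamma>1 t + h *\<^sub>R (\<i> * \<gamma>1' t))))"
    using loc1 unfolding local_graph_def \<gamma>0 X_def Y_def by (elim conjE; blast)+
  have \<eta>2: "0 < \<eta>2" and \<delta>2: "0 < \<delta>2" and \<phi>0: "\<phi> 0 = 0"
    and lip2: "\<And>x x'. \<bar>\<phi> x - \<phi> x'\<bar> \<le> \<bar>x - x'\<bar> / 2"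
    and graph2: "\<And>t. \<bar>t\<bar> \<le> \<eta>2 \<Longrightarrow> \<bar>X (\<gamma>2 t)\<bar> \<le> \<delta>2 \<Longrightarrow> Y (\<gamma>2 t) = \<phi> (X (\<gamma>2 t))"
    and onto2: "\<And>x. \<bar>x\<bar> \<le> \<delta>2 \<Longrightarrow> \<exists>t. \<bar>t\<bar> \<le> \<eta>2 \<and> X (\<gamma>2 t) = x"
    and mono2': "\<And>t t'. \<bar>t\<bar> \<le> \<eta>2 \<Longrightarrow> \<bar>t'\<bar> \<le> \<eta>2 \<Longrightarrow> t < t' \<Longrightarrow> coord v u (\<gamma>2 t) < coord v u (\<gamma>2 t')"
    and side2: "\<And>t h. \<bar>t\<bar> \<le> \<eta>2 \<Longrightarrow> h \<noteq> 0 \<Longrightarrow>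
      \<bar>X (\<gamma>2 t)\<bar> \<le> \<delta>2 \<Longrightarrow> \<bar>X (\<gamma>2 t + h *\<^sub>R (\<i> * \<gamma>2' t))\<bar> \<le> \<delta>2 \<Longrightarrow>
      0 < h * sgn (Im (cnj v * u)) * (Y (\<gamma>2 t + h *\<^sub>R (\<i> * \<gamma>2' t))
        - \<phi> (X (\<gamma>2 t + h *\<^sub>R (\<i> * \<gamma>2' t))))"
    using loc2 unfolding local_graph_def \<gamma>0 X_def Y_def by (elim conjE; blast)+
  have mono1: "Y (\<gamma>1 t) < Y (\<gamma>1 t')" if "\<bar>t\<bar> \<le> \<eta>1" "\<bar>t'\<bar> \<le> \<eta>1" "t < t'" for t t'
    using mono1'[OF that] by (simp add: Y_def coord_diff)
  have mono2: "X (\<gamma>2 t) < X (\<gamma>2 t')" if "\<bar>t\<bar> \<le> \<eta>2" "\<bar>t'\<bar> \<le> \<eta>2" "t < t'" for t t'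
    using mono2'[OF that] by (simp add: X_def coord_diff)
  have XYc: "X c = 0" "Y c = 0" by (simp_all add: X_def Y_def coord_zero)
  have inj1: "t = t'" if "\<bar>t\<bar> \<le> \<eta>1" "\<bar>t'\<bar> \<le> \<eta>1" "Y (\<gamma>1 t) = Y (\<gamma>1 t')" for t t'
    using mono1[of t t'] mono1[of t' t] that by (cases t t' rule: linorder_cases) simp_all
  have inj2: "t = t'" if "\<bar>t\<bar> \<le> \<eta>2" "\<bar>t'\<bar> \<le> \<eta>2" "X (\<gamma>2 t) = X (\<gamma>2 t')" for t t'
    using mono2[of t t'] mono2[of t' t] that by (cases t t' rule: linorder_cases) simp_all
  define \<eta> where "\<eta> = min \<eta>1 \<eta>2"
  have \<eta>: "0 < \<eta>" "\<eta> \<le> \<eta>1" "\<eta> \<le> \<eta>2" "\<eta> < \<eta>0" using \<eta>1 \<eta>2 \<eta>_le \<eta>0 by (auto simp: \<eta>_def)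
  obtain \<rho> where \<rho>: "0 < \<rho>" "\<And>s'. strand D s' \<Longrightarrow> dist (point D s') c < \<rho> \<Longrightarrow>
      \<exists>s0 t. s0 \<in> strands D c \<and> \<bar>t\<bar> < \<eta> \<and> s' = shift s0 t"
    using near_strands[OF D \<eta>(1), of c] by metis
  have Uc: "open (U \<inter> ball c \<rho>)" "c \<in> U \<inter> ball c \<rho>" using U \<rho>(1) by auto
  obtain \<delta>3 where \<delta>3: "0 < \<delta>3"
    "\<And>q. \<bar>coord v u (q - c)\<bar> < \<delta>3 \<Longrightarrow> \<bar>coord u v (q - c)\<bar> < \<delta>3 \<Longrightarrow> q \<in> U \<inter> ball c \<rho>"
    using small_box[OF \<open>Im (cnj v * u) \<noteq> 0\<close> Uc] by blast
  define \<delta> where "\<delta> = min \<delta>3 (min \<delta>1 \<delta>2)"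
  have \<delta>: "0 < \<delta>" "\<delta> \<le> \<delta>1" "\<delta> \<le> \<delta>2" "\<delta> \<le> \<delta>3" using \<delta>1 \<delta>2 \<delta>3(1) by (auto simp: \<delta>_def)
  have XYp: "X (c + (x *\<^sub>R v + y *\<^sub>R u)) = x" "Y (c + (x *\<^sub>R v + y *\<^sub>R u)) = y" for x y
    using coord_combine[of v u] vu by (simp_all add: X_def Y_def)
  have XYinv: "c + (X q *\<^sub>R v + Y q *\<^sub>R u) = q" for q
    using coord_expand[of v u "q - c"] vu by (simp add: X_def Y_def)
  have contX: "continuous_on S X" and contY: "continuous_on S Y" for S
    unfolding X_def Y_def by (intro continuous_intros)+
  have cont_lip: "continuous_on S f" if "\<And>x x'. \<bar>f x - f x'\<bar> \<le> \<bar>x - x'\<bar> / 2" for f :: "real \<Rightarrow> real" and S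
  proof (rule continuous_on_subset)
    have "(1/2)-lipschitz_on UNIV f" by (rule lipschitz_onI) (use that in \<open>auto simp: dist_real_def\<close>)
    then show "continuous_on UNIV f" by (rule lipschitz_on_continuous_on)
  qed simp
  note cont\<phi> = cont_lip[of \<phi>, OF lip2] and cont\<psi> = cont_lip[of \<psi>, OF lip1]
  define N where "N = {q. \<bar>X q\<bar> < \<delta> \<and> \<bar>Y q\<bar> < \<delta>}"
  define P1 where "P1 e = {q. 0 < e * (Y q - \<phi> (X q))}" for e :: real
  define P2 where "P2 e = {q. 0 < e * (X q - \<psi> (Y q))}" for e :: real
  \<comment> \<open>\<open>e\<close> means above or below the underpasser, \<open>e'\<close> right
    or left of the overpasser. Thus \<open>Q 1 (-1)\<close>, \<open>Q 1 1\<close>,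
    \<open>Q (-1) (-1)\<close> and \<open>Q (-1) 1\<close> are the quadrants V, W, Y and X.\<close>
  define Q where "Q e e' = N \<inter> P1 e \<inter> P2 e'" for e e'
  have NU: "q \<in> U" "dist q c < \<rho>" if "q \<in> N" for q
    using \<delta>3(2)[of q] that \<delta> by (auto simp: N_def X_def Y_def dist_commute)
  have openN: "open N" unfolding N_def
    by (intro open_Collect_conj open_Collect_less continuous_intros contX contY)
  have c\<phi>: "continuous_on UNIV (\<lambda>q. \<phi> (X q))" and c\<psi>: "continuous_on UNIV (\<lambda>q. \<psi> (Y q))"
    by (rule continuous_on_compose2[OF cont\<phi> contX subset_UNIV],
        rule continuous_on_compose2[OF cont\<psi> contY subset_UNIV])
  have openP: "open (P1 e)" "open (P2 e)" for e unfolding P1_def P2_def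
    by (intro open_Collect_less continuous_intros contX contY c\<phi> c\<psi>)+
  have openQ: "open (Q e e')" for e e' unfolding Q_def using openN openP by auto
  have connQ: "connected (Q e e')" if e: "e = 1 \<or> e = -1" "e' = 1 \<or> e' = -1" for e e'
  proof -
    let ?Q = "{(x, y). \<bar>x\<bar> < \<delta> \<and> \<bar>y\<bar> < \<delta> \<and> e * \<phi> (e' * x) < y \<and> e' * \<psi> (e * y) < x}"
    have l: "\<bar>e * \<phi> (e' * x) - e * \<phi> (e' * x')\<bar> \<le> \<bar>x - x'\<bar> / 2"
      "\<bar>e' * \<psi> (e * x) - e' * \<psi> (e * x')\<bar> \<le> \<bar>x - x'\<bar> / 2" for x x'
      using e lip2[of x x'] lip2[of "- x" "- x'"] lip1[of x x'] lip1[of "- x" "- x'"]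
      by (auto simp: abs_minus_commute)
    have "connected ?Q" using \<phi>0 \<psi>0 l by (intro quadrant_connected) auto
    then have "connected ((\<lambda>(x, y). c + ((e' * x) *\<^sub>R v + (e * y) *\<^sub>R u)) ` ?Q)"
      by (rule connected_continuous_image[rotated])
        (auto simp: case_prod_unfold intro!: continuous_intros)
    moreover have "(\<lambda>(x, y). c + ((e' * x) *\<^sub>R v + (e * y) *\<^sub>R u)) ` ?Q = Q e e'"
    proof (intro equalityI subsetI)
      fix q assume "q \<in> Q e e'"
      then have "(e' * X q, e * Y q) \<in> ?Q"
        "q = (\<lambda>(x, y). c + ((e' * x) *\<^sub>R v + (e * y) *\<^sub>R u)) (e' * X q, e * Y q)"
        using e XYinv[of q] by (auto simp: Q_def N_def P1_def P2_def)
      then show "q \<in> (\<lambda>(x, y). c + ((e' * x) *\<^sub>R v + (e * y) *\<^sub>R u)) ` ?Q" by blast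
    next
      fix q assume "q \<in> (\<lambda>(x, y). c + ((e' * x) *\<^sub>R v + (e * y) *\<^sub>R u)) ` ?Q"
      then obtain x y where xy: "(x, y) \<in> ?Q" "q = c + ((e' * x) *\<^sub>R v + (e * y) *\<^sub>R u)" by auto
      then have "X q = e' * x" "Y q = e * y" by (simp_all only: XYp)
      then show "q \<in> Q e e'" using e xy(1) by (auto simp: Q_def N_def P1_def P2_def)
    qed
    ultimately show ?thesis by simp
  qed
  have half1: "\<bar>\<psi> y\<bar> \<le> \<bar>y\<bar> / 2" and half2: "\<bar>\<phi> y\<bar> \<le> \<bar>y\<bar> / 2" for y
    using lip1[of y 0] lip2[of y 0] \<psi>0 \<phi>0 by simp_all
  have in_graph: "\<exists>t. \<bar>t\<bar> < \<eta> \<and> (s' = shift a t \<and> point D s' = \<gamma>1 t \<and> X (\<gamma>1 t) = \<psi> (Y (\<gamma>1 t)) \<or>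
      s' = shift b (\<sigma> * t) \<and> point D s' = \<gamma>2 t \<and> Y (\<gamma>2 t) = \<phi> (X (\<gamma>2 t)))"
    if s': "strand D s'" "point D s' \<in> N" for s'
  proof -
    obtain s0 t where t: "s0 \<in> strands D c" "\<bar>t\<bar> < \<eta>" "s' = shift s0 t"
      using \<rho>(2)[OF s'(1)] NU(2)[OF s'(2)] by blast
    from t(1) ab consider "s0 = a" | "s0 = b" by auto
    then show ?thesis
    proof cases
      case 1
      then have "point D s' = \<gamma>1 t" using t by (simp add: \<gamma>1_def)
      moreover have "X (\<gamma>1 t) = \<psi> (Y (\<gamma>1 t))"
        using graph1[of t] t(2) s'(2) \<eta> \<delta> \<open>point D s' = \<gamma>1 t\<close> by (simp add: N_def)
      ultimately show ?thesis using 1 t by blast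
    next
      case 2
      have s't: "s' = shift b (\<sigma> * (\<sigma> * t))" using 2 t by (simp only: \<sigma>2)
      have \<sigma>t: "\<bar>\<sigma> * t\<bar> < \<eta>" using t(2) \<sigma> by auto
      have pt: "point D s' = \<gamma>2 (\<sigma> * t)" using s't by (simp add: \<gamma>2_def)
      moreover have "Y (\<gamma>2 (\<sigma> * t)) = \<phi> (X (\<gamma>2 (\<sigma> * t)))"
        using graph2[of "\<sigma> * t"] \<sigma>t s'(2) \<eta> \<delta> pt by (simp add: N_def)
      ultimately show ?thesis using s't \<sigma>t by blast
    qed
  qed
  have link_graph: "q \<in> link D \<longleftrightarrow> X q = \<psi> (Y q) \<or> Y q = \<phi> (X q)" if q: "q \<in> N" for q
  proof
    assume "q \<in> link D"
    then obtain s' where s': "strand D s'" "point D s' = q" by (auto simp: link_iff)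
    then show "X q = \<psi> (Y q) \<or> Y q = \<phi> (X q)" using in_graph[of s'] q by auto
  next
    assume "X q = \<psi> (Y q) \<or> Y q = \<phi> (X q)"
    then show "q \<in> link D"
    proof
      assume Xq: "X q = \<psi> (Y q)"
      obtain t where t: "\<bar>t\<bar> \<le> \<eta>1" "Y (\<gamma>1 t) = Y q"
        using onto1[of "Y q"] q \<delta> by (auto simp: N_def)
      have "X (\<gamma>1 t) = \<psi> (Y (\<gamma>1 t))"
        using graph1[of t] t q \<delta> by (simp add: N_def)
      then have "\<gamma>1 t = q" using XYinv[of q] XYinv[of "\<gamma>1 t"] t Xq by simp
      then show "q \<in> link D" using point_mem_link[of D "shift a t"] sa by (simp add: \<gamma>1_def)
    next
      assume Yq: "Y q = \<phi> (X q)"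
      obtain t where t: "\<bar>t\<bar> \<le> \<eta>2" "X (\<gamma>2 t) = X q"
        using onto2[of "X q"] q \<delta> by (auto simp: N_def)
      have "Y (\<gamma>2 t) = \<phi> (X (\<gamma>2 t))"
        using graph2[of t] t q \<delta> by (simp add: N_def)
      then have "\<gamma>2 t = q" using XYinv[of q] XYinv[of "\<gamma>2 t"] t Yq by simp
      then show "q \<in> link D" using point_mem_link[of D "shift b (\<sigma> * t)"] sb by (simp add: \<gamma>2_def)
    qed
  qed
  \<comment> \<open>Each coordinate is at most half of the other in absolute value, so both vanish:
    the graphs meet only in \<open>c\<close>.\<close>
  have both: "X q = 0 \<and> Y q = 0" if "X q = \<psi> (Y q)" "Y q = \<phi> (X q)" for q
  proof -
    have "\<bar>X q\<bar> \<le> \<bar>Y q\<bar> / 2" by (subst that(1)) (rule half1)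
    moreover have "\<bar>Y q\<bar> \<le> \<bar>X q\<bar> / 2" by (subst that(2)) (rule half2)
    ultimately show ?thesis by linarith
  qed
  have ev: "\<forall>\<^sub>F h in at_right 0. q + (r * h) *\<^sub>R d \<in> S" if "open S" "q \<in> S"
    for q d :: complex and r S
  proof -
    have "((\<lambda>h. q + (r * h) *\<^sub>R d) \<longlongrightarrow> q + (r * 0) *\<^sub>R d) (at_right 0)"
      by (intro tendsto_intros)
    then show ?thesis using topological_tendstoD[OF _ that(1)] that(2) by simp
  qed
  have over: "point D (shift a t) \<notin> crossings D \<and> sides D (shift a t) 1 (Q (sgn t) (-1)) (Q (sgn t) 1)"
    if t: "t \<noteq> 0" "\<bar>t\<bar> < \<eta>" and N: "point D (shift a t) \<in> N" for t
  proof
    have pt: "point D (shift a t) = \<gamma>1 t" "left_normal D (shift a t) = \<i> * \<gamma>1' t"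
      by (simp_all add: \<gamma>1_def \<gamma>1'_def left_normal_def)
    have Xt: "X (\<gamma>1 t) = \<psi> (Y (\<gamma>1 t))" using graph1[of t] t N \<eta> \<delta> by (simp add: N_def pt)
    have sgnY: "0 < sgn t * Y (\<gamma>1 t)"
      using mono1[of 0 t] mono1[of t 0] t \<eta> \<gamma>0 XYc by (cases "t > 0") (auto simp: sgn_if)
    have "strands D (point D (shift a t)) \<subseteq> {shift a t}"
    proof
      fix s'' assume "s'' \<in> strands D (point D (shift a t))"
      then have s'': "strand D s''" "point D s'' = \<gamma>1 t" by (auto simp: mem_strands_iff pt)
      from in_graph[of s''] s'' N pt obtain t' where t': "\<bar>t'\<bar> < \<eta>"
        "s'' = shift a t' \<and> \<gamma>1 t = \<gamma>1 t' \<or> Y (\<gamma>1 t) = \<phi> (X (\<gamma>1 t))" by auto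
      from t'(2) show "s'' \<in> {shift a t}"
      proof
        assume "s'' = shift a t' \<and> \<gamma>1 t = \<gamma>1 t'"
        then show ?thesis using inj1[of t t'] t t'(1) \<eta> by simp
      next
        assume "Y (\<gamma>1 t) = \<phi> (X (\<gamma>1 t))"
        then have "Y (\<gamma>1 t) = 0" using both[OF Xt] by blast
        then show ?thesis using sgnY by simp
      qed
    qed
    then have "card (strands D (point D (shift a t))) \<le> 1" using card_mono[of "{shift a t}"] by fastforce
    then show "point D (shift a t) \<notin> crossings D" by (simp add: crossings_def)
    \<comment> \<open>Off the crossing the overpasser is strictly on one side of the underpasser,
      since |\<phi> X| is at most |X|/2 and |X| at most |Y|/2. Small moves along the normal preserve
      this open condition, so the two sides of the overpasser differ only in the sign belonging to
      \<open>P2\<close>.\<close>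
    have g: "\<gamma>1 t \<in> P1 (sgn t)"
    proof -
      have "\<bar>\<phi> (X (\<gamma>1 t))\<bar> < \<bar>Y (\<gamma>1 t)\<bar>"
      proof -
        have "0 < \<bar>Y (\<gamma>1 t)\<bar>" using sgnY by auto
        then show ?thesis using half2[of "X (\<gamma>1 t)"] half1[of "Y (\<gamma>1 t)", folded Xt] by linarith
      qed
      then show ?thesis using sgnY by (auto simp: P1_def sgn_if split: if_splits)
    qed
    have "\<forall>\<^sub>F h in at_right 0. \<gamma>1 t + h *\<^sub>R (\<i> * \<gamma>1' t) \<in> Q (sgn t) (-1) \<and>
        \<gamma>1 t - h *\<^sub>R (\<i> * \<gamma>1' t) \<in> Q (sgn t) 1"
      using ev[OF openN N[unfolded pt(1)], of 1 "\<i> * \<gamma>1' t"] ev[OF openN N[unfolded pt(1)], of "-1" "\<i> * \<gamma>1' t"]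
        ev[OF openP(1) g, of 1 "\<i> * \<gamma>1' t"] ev[OF openP(1) g, of "-1" "\<i> * \<gamma>1' t"]
        eventually_at_right_less[of 0]
    proof eventually_elim
      case (elim h)
      have Nt: "\<bar>Y (\<gamma>1 t)\<bar> \<le> \<delta>1" "\<bar>t\<bar> \<le> \<eta>1" using N \<delta> t \<eta> by (simp_all add: pt N_def)
      have Yh: "\<bar>Y (\<gamma>1 t + h *\<^sub>R (\<i> * \<gamma>1' t))\<bar> \<le> \<delta>1" "\<bar>Y (\<gamma>1 t + (- h) *\<^sub>R (\<i> * \<gamma>1' t))\<bar> \<le> \<delta>1"
        using elim \<delta> by (simp_all add: N_def)
      have h: "h \<noteq> 0" "- h \<noteq> 0" using elim by auto
      \<comment> \<open>\<open>v\<close> points to the right of the overpasser, so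
        \<open>(u, v)\<close> is negatively oriented and the left normal leads to smaller
        \<open>X\<close>.\<close>
      have sg: "sgn (Im (cnj u * v)) = -1" using uv by (simp only: sgn_if) simp
      have "X (\<gamma>1 t + h *\<^sub>R (\<i> * \<gamma>1' t)) - \<psi> (Y (\<gamma>1 t + h *\<^sub>R (\<i> * \<gamma>1' t))) < 0"
        using side1[OF Nt(2) h(1) Nt(1) Yh(1)] elim unfolding sg by (simp add: mult_less_0_iff)
      moreover have "0 < X (\<gamma>1 t + (-h) *\<^sub>R (\<i> * \<gamma>1' t)) - \<psi> (Y (\<gamma>1 t + (-h) *\<^sub>R (\<i> * \<gamma>1' t)))"
        using side1[OF Nt(2) h(2) Nt(1) Yh(2)] elim unfolding sg by (simp add: zero_less_mult_iff)
      ultimately show ?case using elim by (simp add: Q_def P2_def)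
    qed
    then show "sides D (shift a t) 1 (Q (sgn t) (-1)) (Q (sgn t) 1)" by (simp add: sides_def pt)
  qed
  have under: "point D (shift b (\<sigma> * t)) \<notin> crossings D \<and> sides D (shift b (\<sigma> * t)) \<sigma> (Q 1 (sgn t)) (Q (-1) (sgn t))"
    if t: "t \<noteq> 0" "\<bar>t\<bar> < \<eta>" and N: "point D (shift b (\<sigma> * t)) \<in> N" for t
  proof
    have pt: "point D (shift b (\<sigma> * t)) = \<gamma>2 t" "\<sigma> *\<^sub>R left_normal D (shift b (\<sigma> * t)) = \<i> * \<gamma>2' t"
      by (simp_all add: \<gamma>2_def \<gamma>2'_def left_normal_def)
    have Yt: "Y (\<gamma>2 t) = \<phi> (X (\<gamma>2 t))" using graph2[of t] t N \<eta> \<delta> by (simp add: N_def pt)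
    have sgnX: "0 < sgn t * X (\<gamma>2 t)"
      using mono2[of 0 t] mono2[of t 0] t \<eta> \<gamma>0 XYc by (cases "t > 0") (auto simp: sgn_if)
    have "strands D (point D (shift b (\<sigma> * t))) \<subseteq> {shift b (\<sigma> * t)}"
    proof
      fix s'' assume "s'' \<in> strands D (point D (shift b (\<sigma> * t)))"
      then have s'': "strand D s''" "point D s'' = \<gamma>2 t" by (auto simp: mem_strands_iff pt)
      from in_graph[of s''] s'' N pt obtain t' where t': "\<bar>t'\<bar> < \<eta>"
        "s'' = shift b (\<sigma> * t') \<and> \<gamma>2 t = \<gamma>2 t' \<or> X (\<gamma>2 t) = \<psi> (Y (\<gamma>2 t))" by auto
      from t'(2) show "s'' \<in> {shift b (\<sigma> * t)}"
      proof
        assume "s'' = shift b (\<sigma> * t') \<and> \<gamma>2 t = \<gamma>2 t'"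
        then show ?thesis using inj2[of t t'] t t'(1) \<eta> by simp
      next
        assume "X (\<gamma>2 t) = \<psi> (Y (\<gamma>2 t))"
        then have "X (\<gamma>2 t) = 0" using both[OF _ Yt] by blast
        then show ?thesis using sgnX by simp
      qed
    qed
    then have "card (strands D (point D (shift b (\<sigma> * t)))) \<le> 1"
      using card_mono[of "{shift b (\<sigma> * t)}"] by fastforce
    then show "point D (shift b (\<sigma> * t)) \<notin> crossings D" by (simp add: crossings_def)
    have g: "\<gamma>2 t \<in> P2 (sgn t)"
    proof -
      have "\<bar>\<psi> (Y (\<gamma>2 t))\<bar> < \<bar>X (\<gamma>2 t)\<bar>"
      proof -
        have "0 < \<bar>X (\<gamma>2 t)\<bar>" using sgnX by auto
        then show ?thesis using half1[of "Y (\<gamma>2 t)"] half2[of "X (\<gamma>2 t)", folded Yt] by linarith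
      qed
      then show ?thesis using sgnX by (auto simp: P2_def sgn_if split: if_splits)
    qed
    have "\<forall>\<^sub>F h in at_right 0. \<gamma>2 t + h *\<^sub>R (\<i> * \<gamma>2' t) \<in> Q 1 (sgn t) \<and>
        \<gamma>2 t - h *\<^sub>R (\<i> * \<gamma>2' t) \<in> Q (-1) (sgn t)"
      using ev[OF openN N[unfolded pt(1)], of 1 "\<i> * \<gamma>2' t"] ev[OF openN N[unfolded pt(1)], of "-1" "\<i> * \<gamma>2' t"]
        ev[OF openP(2) g, of 1 "\<i> * \<gamma>2' t"] ev[OF openP(2) g, of "-1" "\<i> * \<gamma>2' t"]
        eventually_at_right_less[of 0]
    proof eventually_elim
      case (elim h)
      have Nt: "\<bar>X (\<gamma>2 t)\<bar> \<le> \<delta>2" "\<bar>t\<bar> \<le> \<eta>2" using N \<delta> t \<eta> by (simp_all add: pt N_def)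
      have Xh: "\<bar>X (\<gamma>2 t + h *\<^sub>R (\<i> * \<gamma>2' t))\<bar> \<le> \<delta>2" "\<bar>X (\<gamma>2 t + (- h) *\<^sub>R (\<i> * \<gamma>2' t))\<bar> \<le> \<delta>2"
        using elim \<delta> by (simp_all add: N_def)
      have h: "h \<noteq> 0" "- h \<noteq> 0" using elim by auto
      have sg: "sgn (Im (cnj v * u)) = 1" using vu by (simp only: sgn_if) simp
      have "0 < Y (\<gamma>2 t + h *\<^sub>R (\<i> * \<gamma>2' t)) - \<phi> (X (\<gamma>2 t + h *\<^sub>R (\<i> * \<gamma>2' t)))"
        using side2[OF Nt(2) h(1) Nt(1) Xh(1)] elim unfolding sg by (simp add: zero_less_mult_iff)
      moreover have "Y (\<gamma>2 t + (-h) *\<^sub>R (\<i> * \<gamma>2' t)) - \<phi> (X (\<gamma>2 t + (-h) *\<^sub>R (\<i> * \<gamma>2' t))) < 0"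
        using side2[OF Nt(2) h(2) Nt(1) Xh(2)] elim unfolding sg by (simp add: mult_less_0_iff)
      ultimately show ?case using elim by (simp add: Q_def P1_def)
    qed
    moreover have "(\<sigma> * h) *\<^sub>R left_normal D (shift b (\<sigma> * t)) = h *\<^sub>R (\<i> * \<gamma>2' t)" for h
      unfolding pt(2)[symmetric] by (simp add: mult.commute)
    ultimately show "sides D (shift b (\<sigma> * t)) \<sigma> (Q 1 (sgn t)) (Q (-1) (sgn t))"
      by (simp add: sides_def pt(1))
  qed
  have dir: "\<forall>\<^sub>F h in at_right 0. c + h *\<^sub>R (e *\<^sub>R u + e' *\<^sub>R v) \<in> Q e e'"
    if e: "e = 1 \<or> e = -1" "e' = 1 \<or> e' = -1" for e e'
  proof -
    have "\<forall>\<^sub>F h in at_right 0. c + (1 * h) *\<^sub>R (e *\<^sub>R u + e' *\<^sub>R v) \<in> N"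
      using \<delta>(1) XYc by (intro ev openN) (simp add: N_def)
    then show ?thesis using eventually_at_right_less[of 0]
    proof eventually_elim
      case (elim h)
      define q where "q = c + ((e' * h) *\<^sub>R v + (e * h) *\<^sub>R u)"
      have q: "c + h *\<^sub>R (e *\<^sub>R u + e' *\<^sub>R v) = q"
        by (simp add: q_def algebra_simps)
      have XY: "X q = e' * h" "Y q = e * h" unfolding q_def by (simp_all only: XYp)
      have "\<bar>\<phi> (X q)\<bar> < h" "\<bar>\<psi> (Y q)\<bar> < h"
        using half2[of "X q"] half1[of "Y q"] elim(2) e unfolding XY by auto
      then have "q \<in> P1 e" "q \<in> P2 e'" using e XY by (auto simp: P1_def P2_def)
      then show ?case using elim q by (simp add: Q_def)
    qed
  qed
  have eq: "N - link D = Q 1 (-1) \<union> Q 1 1 \<union> Q (-1) (-1) \<union> Q (-1) 1"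
  proof (intro equalityI subsetI)
    fix q assume "q \<in> N - link D"
    then have "q \<in> N" "Y q \<noteq> \<phi> (X q)" "X q \<noteq> \<psi> (Y q)" using link_graph by auto
    then show "q \<in> Q 1 (-1) \<union> Q 1 1 \<union> Q (-1) (-1) \<union> Q (-1) 1"
      by (auto simp: Q_def P1_def P2_def)
  next
    fix q assume "q \<in> Q 1 (-1) \<union> Q 1 1 \<union> Q (-1) (-1) \<union> Q (-1) 1"
    then have "q \<in> N" "Y q \<noteq> \<phi> (X q)" "X q \<noteq> \<psi> (Y q)" by (auto simp: Q_def P1_def P2_def)
    then show "q \<in> N - link D" using link_graph by auto
  qed
  have strands: "s' = a \<or> s' = b \<or> (\<exists>t. 0 < t \<and> t < \<eta> \<and>
        (s' = shift a t \<or> s' = shift a (- t) \<or> s' = shift b (\<sigma> * t) \<or> s' = shift b (- (\<sigma> * t))))"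
    if s': "strand D s'" "point D s' \<in> N" for s'
  proof -
    obtain t where t: "\<bar>t\<bar> < \<eta>" "s' = shift a t \<or> s' = shift b (\<sigma> * t)" using in_graph[OF s'] by blast
    consider "t = 0" | "0 < t" | "t < 0" by linarith
    then show ?thesis
    proof cases
      case 1 then show ?thesis using t by auto
    next
      case 2 then show ?thesis using t \<eta> by (intro disjI2 exI[of _ t]) auto
    next
      case 3 then show ?thesis using t \<eta> by (intro disjI2 exI[of _ "- t"]) auto
    qed
  qed
  have dirs: "\<forall>\<^sub>F h in at_right 0.
        c + h *\<^sub>R (tangent D a - \<sigma> *\<^sub>R tangent D b) \<in> Q 1 (-1) \<and>
        c + h *\<^sub>R (tangent D a + \<sigma> *\<^sub>R tangent D b) \<in> Q 1 1 \<and>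
        c + h *\<^sub>R (- tangent D a - \<sigma> *\<^sub>R tangent D b) \<in> Q (-1) (-1) \<and>
        c + h *\<^sub>R (- tangent D a + \<sigma> *\<^sub>R tangent D b) \<in> Q (-1) 1"
    using dir[of 1 "-1"] dir[of 1 1] dir[of "-1" "-1"] dir[of "-1" 1]
    unfolding u_def v_def by (simp add: eventually_conj_iff)
  have disj: "Q e e' \<inter> Q f f' = {}" if "e = - f \<and> f \<noteq> 0 \<or> e' = - f' \<and> f' \<noteq> 0" for e e' f f'
    using that by (auto simp: Q_def P1_def P2_def zero_less_mult_iff mult_less_0_iff)
  have branches: "(point D (shift a t) \<in> N \<longrightarrow> point D (shift a t) \<notin> crossings D \<and> sides D (shift a t) 1 (Q 1 (-1)) (Q 1 1)) \<and>
      (point D (shift a (- t)) \<in> N \<longrightarrow> point D (shift a (- t)) \<notin> crossings D \<and> sides D (shift a (- t)) 1 (Q (-1) (-1)) (Q (-1) 1)) \<and>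
      (point D (shift b (\<sigma> * t)) \<in> N \<longrightarrow> point D (shift b (\<sigma> * t)) \<notin> crossings D \<and> sides D (shift b (\<sigma> * t)) \<sigma> (Q 1 1) (Q (-1) 1)) \<and>
      (point D (shift b (- (\<sigma> * t))) \<in> N \<longrightarrow> point D (shift b (- (\<sigma> * t))) \<notin> crossings D \<and>
        sides D (shift b (- (\<sigma> * t))) \<sigma> (Q 1 (-1)) (Q (-1) (-1)))" if "0 < t \<and> t < \<eta>" for t
    using over[of t] over[of "- t"] under[of t] under[of "- t"] that by simp
  show thesis
  proof (rule that[of \<eta> N "Q 1 (-1)" "Q 1 1" "Q (-1) (-1)" "Q (-1) 1"])
    show "N \<subseteq> U" using NU by blast
    have "c \<in> N" using XYc \<delta> by (simp add: N_def)
    then show "crossing_chart D a b \<sigma> \<eta> N (Q 1 (-1)) (Q 1 1) (Q (-1) (-1)) (Q (-1) 1)"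
      unfolding crossing_chart_def c
    proof (intro conjI openN openQ eq dirs)
      show "\<forall>t. 0 < t \<and> t < \<eta> \<longrightarrow>
        (point D (shift a t) \<in> N \<longrightarrow> point D (shift a t) \<notin> crossings D \<and> sides D (shift a t) 1 (Q 1 (-1)) (Q 1 1)) \<and>
        (point D (shift a (- t)) \<in> N \<longrightarrow> point D (shift a (- t)) \<notin> crossings D \<and> sides D (shift a (- t)) 1 (Q (-1) (-1)) (Q (-1) 1)) \<and>
        (point D (shift b (\<sigma> * t)) \<in> N \<longrightarrow> point D (shift b (\<sigma> * t)) \<notin> crossings D \<and> sides D (shift b (\<sigma> * t)) \<sigma> (Q 1 1) (Q (-1) 1)) \<and>
        (point D (shift b (- (\<sigma> * t))) \<in> N \<longrightarrow> point D (shift b (- (\<sigma> * t))) \<notin> crossings D \<and>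
          sides D (shift b (- (\<sigma> * t))) \<sigma> (Q 1 (-1)) (Q (-1) (-1)))"
        by (intro allI impI branches)
      show "\<forall>s'. strand D s' \<longrightarrow> point D s' \<in> N \<longrightarrow> s' = a \<or> s' = b \<or> (\<exists>t. 0 < t \<and> t < \<eta> \<and>
        (s' = shift a t \<or> s' = shift a (- t) \<or> s' = shift b (\<sigma> * t) \<or> s' = shift b (- (\<sigma> * t))))"
        by (intro allI impI strands)
    qed (use connQ in \<open>auto intro!: disj\<close>)
  qed (use \<eta> in auto)
qed

end

section \<open>Functions with prescribed jumps across the diagram\<close>

text \<open>The value on a coloured side of the strand \<open>s\<close> is \<open>g s\<close> times the value on the other side. In this
  form no orientation of the strand is needed: both sides are tested by \<open>\<sigma> = 1\<close> and \<open>\<sigma> = -1\<close>.\<close>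

definition solution :: "diagram \<Rightarrow> ('g, 'm) monoid_scheme \<Rightarrow> (complex \<Rightarrow> bool) \<Rightarrow>
    (nat \<times> complex \<Rightarrow> 'g) \<Rightarrow> complex set \<Rightarrow> (complex \<Rightarrow> 'g) \<Rightarrow> bool" where
  "solution D G col g U f \<longleftrightarrow>
    (\<forall>p\<in>U - link D. f p \<in> carrier G \<and> (\<forall>\<^sub>F q in nhds p. f q = f p)) \<and>
    (\<forall>s. strand D s \<longrightarrow> point D s \<in> U \<longrightarrow> point D s \<notin> crossings D \<longrightarrow> (\<forall>\<sigma>\<in>{1, -1}.
      \<forall>\<^sub>F t in at_right 0. col (point D s + (\<sigma> * t) *\<^sub>R left_normal D s) \<longrightarrow>
        f (point D s + (\<sigma> * t) *\<^sub>R left_normal D s) = g s \<otimes>\<^bsub>G\<^esub> f (point D s - (\<sigma> * t) *\<^sub>R left_normal D s)))"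

lemma solution_mono: "solution D G col g U f \<Longrightarrow> U' \<subseteq> U \<Longrightarrow> solution D G col g U' f"
  unfolding solution_def by blast

lemma solution_Un: "solution D G col g U f \<Longrightarrow> solution D G col g U' f \<Longrightarrow> solution D G col g (U \<union> U') f"
  unfolding solution_def by blast

lemma sides_minus: "sides D s (- \<sigma>) A B \<longleftrightarrow> sides D s \<sigma> B A"
  unfolding sides_def by (simp add: conj_commute)

lemma connected_locally_constant:
  assumes "connected S" "\<And>p. p \<in> S \<Longrightarrow> \<forall>\<^sub>F q in nhds p. f q = f p" "x \<in> S" "y \<in> S"
  shows "f x = f y"
proof (rule connected_local_const[OF assms(1,3,4)], rule ballI)
  fix a assume "a \<in> S"
  then have "\<forall>\<^sub>F q in nhds a. f a = f q" by (rule eventually_mono[OF assms(2)]) simp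
  then show "\<forall>\<^sub>F q in at a within S. f a = f q"
    unfolding eventually_at_filter by (rule eventually_mono) simp
qed

text \<open>Induction along the interval in steps of \<epsilon>/2, so that each new piece overlaps
  the part already covered. It serves twice: for a row made of small boxes and for the square made
  of rows.\<close>

lemma interval_gluing:
  fixes P :: "real \<Rightarrow> real \<Rightarrow> bool"
  assumes mono: "\<And>a b a' b'. P a b \<Longrightarrow> a \<le> a' \<Longrightarrow> b' \<le> b \<Longrightarrow> P a' b'"
    and glue: "\<And>a b c d. P a b \<Longrightarrow> P c d \<Longrightarrow> a \<le> c \<Longrightarrow> c < b \<Longrightarrow> b \<le> d \<Longrightarrow> P a d"
    and \<epsilon>: "0 < \<epsilon>" and loc: "\<And>x. A \<le> x \<Longrightarrow> x \<le> B \<Longrightarrow> P (x - \<epsilon>) (x + \<epsilon>)" and AB: "A \<le> B"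
  shows "P A B"
proof -
  have step: "A + real n * (\<epsilon>/2) \<le> B \<Longrightarrow> P A (A + real n * (\<epsilon>/2) + \<epsilon>)" for n
  proof (induction n)
    case 0
    then show ?case using loc[of A] mono[of "A - \<epsilon>" "A + \<epsilon>" A "A + \<epsilon>"] \<epsilon> AB by simp
  next
    case (Suc n)
    define x where "x = A + real (Suc n) * (\<epsilon>/2)"
    have x: "x = A + real n * (\<epsilon>/2) + \<epsilon>/2" by (simp add: x_def field_simps)
    have "0 \<le> real n * (\<epsilon>/2)" using \<epsilon> by simp
    then have xA: "A \<le> x" "x \<le> B" using x Suc.prems \<epsilon> unfolding x_def[symmetric] by linarith+
    have "A + real n * (\<epsilon>/2) \<le> B" "A + real n * (\<epsilon>/2) + \<epsilon> = x + \<epsilon>/2" using x xA \<epsilon> by auto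
    then have 1: "P A (x + \<epsilon>/2)" using Suc.IH by simp
    have 2: "P x (x + \<epsilon>)" using loc[OF xA] mono \<epsilon> by simp
    show ?case unfolding x_def[symmetric] by (rule glue[OF 1 2]) (use xA \<epsilon> in auto)
  qed
  \<comment> \<open>The last step that still starts in \<open>{A..B}\<close>; the interval reached
    from it extends to \<open>B\<close> or beyond.\<close>
  define n where "n = nat \<lfloor>(B - A) / (\<epsilon>/2)\<rfloor>"
  have nn: "real n = of_int \<lfloor>(B - A) / (\<epsilon>/2)\<rfloor>" using AB \<epsilon> by (simp add: n_def)
  have "real n \<le> (B - A) / (\<epsilon>/2)" "(B - A) / (\<epsilon>/2) < real n + 1" unfolding nn by linarith+
  then have "real n * (\<epsilon>/2) \<le> B - A" "B - A < (real n + 1) * (\<epsilon>/2)"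
    using \<epsilon> by (simp_all only: pos_le_divide_eq pos_divide_less_eq half_gt_zero)
  then have "A + real n * (\<epsilon>/2) \<le> B" "B \<le> A + real n * (\<epsilon>/2) + \<epsilon>"
    using \<epsilon> by (simp_all add: distrib_right)
  then show ?thesis using step mono by blast
qed

text \<open>The filter \<open>at_right 0\<close> is proper, so an eventual statement about the
  normal yields actual points on both sides. With a trivially true predicate it shows that both
  sides are inhabited.\<close>

lemma sides_witness:
  assumes "sides D s \<sigma> A B" "\<forall>\<^sub>F t in at_right 0. P (point D s + (\<sigma> * t) *\<^sub>R left_normal D s) (point D s - (\<sigma> * t) *\<^sub>R left_normal D s)"
  shows "\<exists>x\<in>A. \<exists>y\<in>B. P x y"
proof -
  have "\<forall>\<^sub>F t in at_right (0::real). \<exists>x\<in>A. \<exists>y\<in>B. P x y"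
    using assms unfolding sides_def by eventually_elim blast
  then show ?thesis by (simp add: eventually_const_iff trivial_limit_at_right_real)
qed

section \<open>Local structure of the link, and uniqueness of solutions up to constants\<close>

context
  fixes D assumes D: "link_diagram D"
begin

lemma crossing_over_under:
  assumes "c \<in> crossings D"
  obtains a b where "over_strand D c a" "under_strand D c b"
proof -
  have "card (strands D c) = 2" "card (strands D c \<inter> overpass D) = 1"
    using assms D by (auto simp: crossings_def link_diagram_def)
  then have "\<exists>a. a \<in> strands D c \<inter> overpass D" "\<not> strands D c \<subseteq> overpass D"
    by (auto simp: card_1_singleton_iff Int_absorb2)
  then show thesis using assms that by (auto simp: over_strand_def under_strand_def)
qed

lemma over_under_strands:
  assumes "over_strand D c a" "under_strand D c b"
  shows "strands D c = {a, b}" "a \<noteq> b" "strand D a" "strand D b" "point D a = c" "point D b = c"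
proof -
  have ab: "a \<in> strands D c" "b \<in> strands D c" "a \<noteq> b" and "card (strands D c) = 2"
    using assms by (auto simp: over_strand_def under_strand_def crossings_def)
  then show "strands D c = {a, b}"
    using card_subset_eq[of "strands D c" "{a, b}"] finite_strands[OF D] by auto
  show "a \<noteq> b" "strand D a" "strand D b" "point D a = c" "point D b = c"
    using ab by (auto simp: mem_strands_iff)
qed

text \<open>Otherwise both tangent vectors lie on the real line through \<open>tangent D b\<close>,
  which is too small for their span to be the plane.\<close>

lemma crossing_transverse:
  assumes "over_strand D c a" "under_strand D c b"
  shows "Im (cnj (tangent D b) * tangent D a) \<noteq> 0"
proof
  define u v where "u = tangent D a" and "v = tangent D b"
  assume "Im (cnj (tangent D b) * tangent D a) = 0"
  then have 0: "Im (cnj v * u) = 0" by (simp only: u_def v_def)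
  have v0: "v \<noteq> 0" using tangent_nz[OF D] over_under_strands[OF assms] by (auto simp: v_def)
  have span: "span {u, v} = UNIV"
    using D over_under_strands[OF assms] unfolding link_diagram_def u_def v_def by blast
  have sub: "subspace {w. Im (cnj v * w) = 0}"
    by (auto simp: subspace_def algebra_simps)
  have "span {u, v} \<subseteq> {w. Im (cnj v * w) = 0}"
    by (rule span_minimal[OF _ sub]) (use 0 in auto)
  then have "\<i> * v \<in> {w. Im (cnj v * w) = 0}" unfolding span by blast
  then have "Re v * Re v + Im v * Im v = 0" by simp
  then show False using v0 by (simp add: sum_squares_eq_zero_iff complex_eq_iff)
qed

lemma crossing_has_chart:
  assumes ab: "over_strand D c a" "under_strand D c b" and U: "open U" "c \<in> U" and \<eta>0: "0 < \<eta>0"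
  obtains \<sigma> \<eta> N V W Y X where "\<sigma> = 1 \<or> \<sigma> = -1" "0 < Im (cnj (\<sigma> *\<^sub>R tangent D b) * tangent D a)"
    "0 < \<eta>" "\<eta> \<le> \<eta>0" "N \<subseteq> U" "crossing_chart D a b \<sigma> \<eta> N V W Y X"
proof -
  \<comment> \<open>\<sigma> records whether the underpasser is parametrized from left to right when
    the overpasser points up.\<close>
  define \<sigma> where "\<sigma> = sgn (Im (cnj (tangent D b) * tangent D a))"
  have \<sigma>: "\<sigma> = 1 \<or> \<sigma> = -1" using crossing_transverse[OF ab] by (simp only: \<sigma>_def sgn_if) simp
  have "Im (cnj (\<sigma> *\<^sub>R tangent D b) * tangent D a) = \<bar>Im (cnj (tangent D b) * tangent D a)\<bar>"
    unfolding \<sigma>_def by (simp add: abs_sgn algebra_simps)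
  then have pos: "0 < Im (cnj (\<sigma> *\<^sub>R tangent D b) * tangent D a)"
    using crossing_transverse[OF ab] by linarith
  show thesis
    by (rule crossing_chart_exists[OF D over_under_strands(5,1)[OF ab] U \<eta>0 \<sigma> pos])
      (rule that[OF \<sigma> pos])
qed

lemma stays_in_open:
  assumes "strand D s" "open N" "point D s \<in> N"
  obtains e where "0 < e" "\<And>t. \<bar>t\<bar> < e \<Longrightarrow> point D (shift s t) \<in> N"
proof -
  have "isCont (\<lambda>t. point D (shift s t)) 0"
    by (rule has_vector_derivative_continuous[OF has_tangent[OF D assms(1)]])
  then have "((\<lambda>t. point D (shift s t)) \<longlongrightarrow> point D (shift s 0)) (nhds 0)"
    unfolding continuous_at tendsto_at_iff_tendsto_nhds[of "\<lambda>t. point D (shift s t)"] .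
  then have "\<forall>\<^sub>F t in nhds 0. point D (shift s t) \<in> N"
    using assms by (intro topological_tendstoD) auto
  then show thesis using that unfolding eventually_nhds_metric by (auto simp: dist_real_def)
qed

lemma regular_shift:
  assumes "strand D s" "point D s \<notin> crossings D"
  obtains e where "0 < e" "\<And>t. \<bar>t\<bar> < e \<Longrightarrow> point D (shift s t) \<notin> crossings D"
proof (rule regular_chart[OF D assms open_UNIV UNIV_I zero_less_one])
  fix N L R assume N: "open N" "point D s \<in> N" and *: "\<And>s'. strand D s' \<Longrightarrow> point D s' \<in> N \<Longrightarrow>
      (\<exists>t. \<bar>t\<bar> < 1 \<and> s' = shift s t) \<and> point D s' \<notin> crossings D \<and> sides D s' 1 L R"
  obtain e where e: "0 < e" "\<And>t. \<bar>t\<bar> < e \<Longrightarrow> point D (shift s t) \<in> N"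
    using stays_in_open[OF assms(1) N] by blast
  show thesis using assms(1) * e by (intro that[of e]) auto
qed

lemma crossing_chart_branches:
  assumes ch: "crossing_chart D a b \<sigma> \<eta> N V W Y X" and ab: "over_strand D c a" "under_strand D c b"
    and \<sigma>: "\<sigma> = 1 \<or> \<sigma> = -1" and \<eta>: "0 < \<eta>"
  obtains e where "0 < e" "\<And>t. 0 < t \<Longrightarrow> t < e \<Longrightarrow> chart_branches D a b \<sigma> N V W Y X t"
proof -
  note os = over_under_strands[OF ab]
  have N: "open N" "point D a \<in> N" "point D b \<in> N" using ch os by (auto simp: crossing_chart_def)
  obtain e1 where e1: "0 < e1" "\<And>t. \<bar>t\<bar> < e1 \<Longrightarrow> point D (shift a t) \<in> N"
    using stays_in_open[OF os(3) N(1,2)] by blast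
  obtain e2 where e2: "0 < e2" "\<And>t. \<bar>t\<bar> < e2 \<Longrightarrow> point D (shift b t) \<in> N"
    using stays_in_open[OF os(4) N(1,3)] by blast
  show thesis
  proof (rule that[of "min \<eta> (min e1 e2)"])
    fix t assume t: "0 < t" "t < min \<eta> (min e1 e2)"
    have b: "\<bar>t\<bar> < e1" "\<bar>- t\<bar> < e1" "\<bar>\<sigma> * t\<bar> < e2" "\<bar>- (\<sigma> * t)\<bar> < e2" using t \<sigma> by auto
    have "0 < t \<and> t < \<eta>" using t by simp
    then have "(point D (shift a t) \<in> N \<longrightarrow> point D (shift a t) \<notin> crossings D \<and> sides D (shift a t) 1 V W) \<and>
      (point D (shift a (- t)) \<in> N \<longrightarrow> point D (shift a (- t)) \<notin> crossings D \<and> sides D (shift a (- t)) 1 Y X) \<and>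
      (point D (shift b (\<sigma> * t)) \<in> N \<longrightarrow> point D (shift b (\<sigma> * t)) \<notin> crossings D \<and> sides D (shift b (\<sigma> * t)) \<sigma> W X) \<and>
      (point D (shift b (- (\<sigma> * t))) \<in> N \<longrightarrow> point D (shift b (- (\<sigma> * t))) \<notin> crossings D \<and>
        sides D (shift b (- (\<sigma> * t))) \<sigma> V Y)"
      using ch unfolding crossing_chart_def by meson
    then show "chart_branches D a b \<sigma> N V W Y X t"
      using e1(2)[OF b(1)] e1(2)[OF b(2)] e2(2)[OF b(3)] e2(2)[OF b(4)]
      by (simp add: chart_branches_def branch_def)
  qed (use e1 e2 \<eta> in auto)
qed

lemma crossing_shift:
  assumes ab: "over_strand D c a" "under_strand D c b"
  obtains e where "0 < e" "\<And>t. t \<noteq> 0 \<Longrightarrow> \<bar>t\<bar> < e \<Longrightarrow>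
    point D (shift a t) \<notin> crossings D \<and> point D (shift b t) \<notin> crossings D"
proof (rule crossing_has_chart[OF ab open_UNIV UNIV_I zero_less_one])
  fix \<sigma> \<eta> N V W Y X assume \<sigma>: "\<sigma> = 1 \<or> \<sigma> = -1" and \<eta>: "0 < \<eta>" and ch: "crossing_chart D a b \<sigma> \<eta> N V W Y X"
  obtain e where e: "0 < e" "\<And>t. 0 < t \<Longrightarrow> t < e \<Longrightarrow> chart_branches D a b \<sigma> N V W Y X t"
    using crossing_chart_branches[OF ch ab \<sigma> \<eta>] by blast
  show thesis
  proof (rule that[OF e(1)])
    fix t :: real assume t: "t \<noteq> 0" "\<bar>t\<bar> < e"
    then consider "0 < t" "t < e" | "0 < - t" "- t < e" by linarith
    then show "point D (shift a t) \<notin> crossings D \<and> point D (shift b t) \<notin> crossings D"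
      using e(2)[of t] e(2)[of "- t"] \<sigma> by cases (auto simp: chart_branches_def branch_def)
  qed
qed

text \<open>Crossings are isolated along each strand, because the chart of a crossing contains no
  other crossing.\<close>

lemma punctured_regular:
  assumes "strand D s"
  obtains e where "0 < e" "\<And>t. t \<noteq> 0 \<Longrightarrow> \<bar>t\<bar> < e \<Longrightarrow> point D (shift s t) \<notin> crossings D"
proof (cases "point D s \<in> crossings D")
  case True
  then obtain a b where ab: "over_strand D (point D s) a" "under_strand D (point D s) b"
    using crossing_over_under by blast
  have "s \<in> strands D (point D s)" using assms by (simp add: mem_strands_iff)
  then have s: "s = a \<or> s = b" using over_under_strands(1)[OF ab] by auto
  obtain e where "0 < e" "\<And>t. t \<noteq> 0 \<Longrightarrow> \<bar>t\<bar> < e \<Longrightarrow>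
      point D (shift a t) \<notin> crossings D \<and> point D (shift b t) \<notin> crossings D"
    using crossing_shift[OF ab] by blast
  then show thesis using that s by blast
next
  case False
  show thesis by (rule regular_shift[OF assms False]) (rule that, auto)
qed

lemma sides_exist:
  assumes "strand D s" "point D s \<notin> crossings D" "open U" "point D s \<in> U"
  obtains A B where "sides D s 1 A B" "A \<subseteq> U - link D" "B \<subseteq> U - link D"
proof (rule regular_chart[OF D assms zero_less_one])
  fix N L R assume N: "N \<subseteq> U" "point D s \<in> N" "N - link D = L \<union> R" and *: "\<And>s'. strand D s' \<Longrightarrow> point D s' \<in> N \<Longrightarrow>
      (\<exists>t. \<bar>t\<bar> < 1 \<and> s' = shift s t) \<and> point D s' \<notin> crossings D \<and> sides D s' 1 L R"
  show thesis using *[OF assms(1) N(2)] N by (intro that[of L R]) auto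
qed

text \<open>A point of the link is left in two moves: along its strand off the crossings, and then
  along the normal off the link.\<close>

lemma dense_minus_link:
  assumes "open U" "p \<in> U"
  shows "\<exists>q\<in>U. q \<notin> link D"
proof (cases "p \<in> link D")
  case True
  then obtain s where s: "strand D s" "point D s = p" by (auto simp: link_iff)
  obtain e where e: "0 < e" "\<And>t. t \<noteq> 0 \<Longrightarrow> \<bar>t\<bar> < e \<Longrightarrow> point D (shift s t) \<notin> crossings D"
    using punctured_regular[OF s(1)] by blast
  obtain e' where e': "0 < e'" "\<And>t. \<bar>t\<bar> < e' \<Longrightarrow> point D (shift s t) \<in> U"
    using stays_in_open[OF s(1) assms(1)] assms(2) s by blast
  define t where "t = min e e' / 2"
  have "t \<noteq> 0" "\<bar>t\<bar> < e" "\<bar>t\<bar> < e'" using e(1) e'(1) by (auto simp: t_def)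
  then obtain A B where AB: "sides D (shift s t) 1 A B" "A \<subseteq> U - link D" "B \<subseteq> U - link D"
    using sides_exist[of "shift s t" U] e e' s assms by auto
  have "\<exists>x\<in>A. \<exists>y\<in>B. True" by (rule sides_witness[OF AB(1)]) simp
  then show ?thesis using AB by blast
qed (use assms in auto)

text \<open>Across a regular point of the link this is the hypothesis \<open>jump\<close>. At a
  crossing, where nothing is assumed, the half strands between V and W, Y and X, and W and X already
  connect the four quadrants. So \<kappa> takes one value off the link near each point of
  \<open>U\<close>, and connectedness of \<open>U\<close> does the rest.\<close>

lemma constant_across_link:
  assumes U: "open U" "connected U"
    and lc: "\<And>p. p \<in> U \<Longrightarrow> p \<notin> link D \<Longrightarrow> \<forall>\<^sub>F q in nhds p. \<kappa> q = \<kappa> p"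
    and jump: "\<And>s. strand D s \<Longrightarrow> point D s \<in> U \<Longrightarrow> point D s \<notin> crossings D \<Longrightarrow>
      \<forall>\<^sub>F t in at_right 0. \<kappa> (point D s + t *\<^sub>R left_normal D s) = \<kappa> (point D s - t *\<^sub>R left_normal D s)"
    and pq: "p \<in> U" "p \<notin> link D" "q \<in> U" "q \<notin> link D"
  shows "\<kappa> p = \<kappa> q"
proof (rule connected_equivalence_relation_gen[OF U(2), where P = "\<lambda>p. p \<notin> link D" and R = "\<lambda>x y. \<kappa> x = \<kappa> y"])
  \<comment> \<open>The rule handles a relation known only on some points of a connected set,
    provided that these points are dense.\<close>
  show "\<exists>z. z \<in> T \<and> z \<notin> link D" if "openin (top_of_set U) T" "a \<in> T" for T a
    using dense_minus_link[of T a] that U(1) by (auto simp: openin_open_eq)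
  have lcS: "\<kappa> x = \<kappa> y" if "connected S" "S \<subseteq> U - link D" "x \<in> S" "y \<in> S" for S x y
    using connected_locally_constant[of S \<kappa> x y] lc that by blast
  have via: "\<kappa> x = \<kappa> y" if s: "strand D s" "point D s \<in> U" "point D s \<notin> crossings D"
    and sd: "sides D s \<sigma> A B" "\<sigma> = 1 \<or> \<sigma> = -1" and AB: "connected A" "connected B" "A \<subseteq> U - link D" "B \<subseteq> U - link D"
    and xy: "x \<in> A" "y \<in> B" for s \<sigma> A B x y
  proof -
    have "\<exists>x\<in>A. \<exists>y\<in>B. \<kappa> x = \<kappa> y"
      by (rule sides_witness[OF sd(1)]) (use jump[OF s] sd(2) in \<open>auto elim: eventually_mono\<close>)
    then show ?thesis using lcS[OF AB(1,3)] lcS[OF AB(2,4)] xy by metis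
  qed
  fix x assume x: "x \<in> U"
  have "\<exists>T. open T \<and> T \<subseteq> U \<and> x \<in> T \<and> (\<forall>y\<in>T - link D. \<forall>z\<in>T - link D. \<kappa> y = \<kappa> z)"
  proof (cases "x \<in> link D")
    case False
    have "\<forall>\<^sub>F y in nhds x. \<kappa> y = \<kappa> x \<and> y \<in> U"
      using eventually_conj[OF lc[OF x False] eventually_nhds_in_open[OF U(1) x]] .
    then obtain T where T: "open T" "x \<in> T" "\<forall>y\<in>T. \<kappa> y = \<kappa> x \<and> y \<in> U"
      unfolding eventually_nhds by blast
    have "\<forall>y\<in>T - link D. \<forall>z\<in>T - link D. \<kappa> y = \<kappa> z" using T(3) by (metis DiffD1)
    then show ?thesis using T by blast
  next
    case True
    then obtain s where s: "strand D s" "point D s = x" unfolding link_iff by blast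
    show ?thesis
    proof (cases "x \<in> crossings D")
      case False
      show ?thesis
      proof (rule regular_chart[OF D s(1) _ U(1) _ zero_less_one])
        show "point D s \<notin> crossings D" "point D s \<in> U" using s False x by auto
        fix N L R assume N: "open N" "N \<subseteq> U" "point D s \<in> N" "N - link D = L \<union> R"
          and LR: "connected L" "connected R" and *: "\<And>s'. strand D s' \<Longrightarrow> point D s' \<in> N \<Longrightarrow>
            (\<exists>t. \<bar>t\<bar> < 1 \<and> s' = shift s t) \<and> point D s' \<notin> crossings D \<and> sides D s' 1 L R"
        have sub: "L \<subseteq> U - link D" "R \<subseteq> U - link D" using N by auto
        have LR': "\<kappa> y = \<kappa> z" if "y \<in> L" "z \<in> R" for y z
        proof (rule via[OF s(1) _ _ _ _ LR sub that])
          show "sides D s 1 L R" "point D s \<notin> crossings D" using *[OF s(1) N(3)] by auto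
          show "point D s \<in> U" "(1::real) = 1 \<or> (1::real) = -1" using N by auto
        qed
        have "\<exists>y\<in>L. \<exists>z\<in>R. True" using *[OF s(1) N(3)] by (intro sides_witness[of D s 1]) auto
        then obtain l r where lr: "l \<in> L" "r \<in> R" by blast
        have "\<kappa> y = \<kappa> l" if "y \<in> L \<union> R" for y
          using that LR'[OF lr(1)] LR'[OF _ lr(2)] lr by (metis Un_iff)
        then have "\<kappa> y = \<kappa> z" if "y \<in> L \<union> R" "z \<in> L \<union> R" for y z using that by metis
        then show ?thesis using N s unfolding N(4)[symmetric] by blast
      qed
    next
      case True
      obtain a b where ab: "over_strand D x a" "under_strand D x b" using crossing_over_under[OF True] by blast
      note os = over_under_strands[OF ab]
      obtain \<sigma> \<eta> N V W Y X where \<sigma>: "\<sigma> = 1 \<or> \<sigma> = -1" and \<eta>: "0 < \<eta>" and NU: "N \<subseteq> U"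
        and ch: "crossing_chart D a b \<sigma> \<eta> N V W Y X"
        using crossing_has_chart[OF ab U(1) x zero_less_one] by metis
      have N: "open N" "x \<in> N" "N - link D = V \<union> W \<union> Y \<union> X"
        and conn: "connected V" "connected W" "connected Y" "connected X"
        using ch os unfolding crossing_chart_def by simp_all
      have sub: "V \<subseteq> U - link D" "W \<subseteq> U - link D" "Y \<subseteq> U - link D" "X \<subseteq> U - link D"
        using N NU by auto
      obtain e where e: "0 < e" "\<And>t. 0 < t \<Longrightarrow> t < e \<Longrightarrow> chart_branches D a b \<sigma> N V W Y X t"
        using crossing_chart_branches[OF ch ab \<sigma> \<eta>] by blast
      define t where "t = e / 2"
      have "chart_branches D a b \<sigma> N V W Y X t" using e by (simp add: t_def)
      then have br: "point D (shift a t) \<notin> crossings D" "sides D (shift a t) 1 V W"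
        "point D (shift a (- t)) \<notin> crossings D" "sides D (shift a (- t)) 1 Y X"
        "point D (shift b (\<sigma> * t)) \<notin> crossings D" "sides D (shift b (\<sigma> * t)) \<sigma> W X"
        and U3: "point D (shift a t) \<in> U" "point D (shift a (- t)) \<in> U" "point D (shift b (\<sigma> * t)) \<in> U"
        using NU by (auto simp: chart_branches_def branch_def)
      have VW: "\<kappa> y = \<kappa> z" if "y \<in> V" "z \<in> W" for y z
        by (rule via[OF _ _ br(1,2) _ conn(1,2) sub(1,2) that]) (use os U3 in auto)
      have YX: "\<kappa> y = \<kappa> z" if "y \<in> Y" "z \<in> X" for y z
        by (rule via[OF _ _ br(3,4) _ conn(3,4) sub(3,4) that]) (use os U3 in auto)
      have WX: "\<kappa> y = \<kappa> z" if "y \<in> W" "z \<in> X" for y z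
        by (rule via[OF _ _ br(5,6) \<sigma> conn(2,4) sub(2,4) that]) (use os U3 in auto)
      obtain w x0 where wx: "w \<in> W" "x0 \<in> X"
        using sides_witness[OF br(6), of "\<lambda>_ _. True"] by auto
      have "\<kappa> y = \<kappa> w" if "y \<in> V \<union> W \<union> Y \<union> X" for y
      proof -
        from that consider "y \<in> V" | "y \<in> W" | "y \<in> Y" | "y \<in> X" by blast
        then show ?thesis
          using VW[of y w] WX[of w y] WX[of y x0] WX[of w x0] YX[of y x0] wx by cases simp_all
      qed
      then have "\<forall>y\<in>N - link D. \<forall>z\<in>N - link D. \<kappa> y = \<kappa> z" unfolding N(3) by metis
      then show ?thesis using N NU by blast
    qed
  qed
  then obtain T where T: "open T" "T \<subseteq> U" "x \<in> T" "\<forall>y\<in>T - link D. \<forall>z\<in>T - link D. \<kappa> y = \<kappa> z" by blast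
  then show "\<exists>T. openin (top_of_set U) T \<and> x \<in> T \<and>
      (\<forall>y\<in>T. \<forall>z\<in>T. y \<notin> link D \<and> z \<notin> link D \<longrightarrow> \<kappa> y = \<kappa> z)"
    using U(1) by (intro exI[of _ T]) (auto simp: openin_open_eq)
qed (use pq in auto)

text \<open>Values on the link itself are immaterial. Openness of \<open>U\<close> keeps small
  neighbourhoods and short normals inside \<open>U\<close>, where the two functions agree.\<close>

lemma solution_cong:
  assumes f: "solution D G col g U f" and U: "open U" and eq: "\<And>p. p \<in> U \<Longrightarrow> p \<notin> link D \<Longrightarrow> f' p = f p"
  shows "solution D G col g U f'"
  unfolding solution_def
proof (intro conjI ballI allI impI)
  fix p assume p: "p \<in> U - link D"
  then show "f' p \<in> carrier G" using f eq by (simp add: solution_def)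
  have "open (U - link D)" using U open_minus_link[OF D] by (simp add: Diff_eq open_Int)
  then have "\<forall>\<^sub>F q in nhds p. q \<in> U - link D" using p by (rule eventually_nhds_in_open)
  moreover have "\<forall>\<^sub>F q in nhds p. f q = f p" using f p by (simp add: solution_def)
  ultimately show "\<forall>\<^sub>F q in nhds p. f' q = f' p"
    by eventually_elim (use eq p in auto)
next
  fix s \<sigma> assume s: "strand D s" "point D s \<in> U" "point D s \<notin> crossings D" and \<sigma>: "\<sigma> \<in> {1, -1::real}"
  obtain A B where AB: "sides D s 1 A B" "A \<subseteq> U - link D" "B \<subseteq> U - link D"
    using sides_exist[OF s(1,3) U s(2)] by blast
  have "\<forall>\<^sub>F t in at_right 0. col (point D s + (\<sigma> * t) *\<^sub>R left_normal D s) \<longrightarrow>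
        f (point D s + (\<sigma> * t) *\<^sub>R left_normal D s) = g s \<otimes>\<^bsub>G\<^esub> f (point D s - (\<sigma> * t) *\<^sub>R left_normal D s)"
    using f s \<sigma> unfolding solution_def by blast
  moreover have "\<forall>\<^sub>F t in at_right 0. point D s + t *\<^sub>R left_normal D s \<in> U - link D \<and>
      point D s - t *\<^sub>R left_normal D s \<in> U - link D"
    using AB(1) unfolding sides_def by (rule eventually_mono) (use AB in auto)
  ultimately show "\<forall>\<^sub>F t in at_right 0. col (point D s + (\<sigma> * t) *\<^sub>R left_normal D s) \<longrightarrow>
        f' (point D s + (\<sigma> * t) *\<^sub>R left_normal D s) = g s \<otimes>\<^bsub>G\<^esub> f' (point D s - (\<sigma> * t) *\<^sub>R left_normal D s)"
    by eventually_elim (use \<sigma> eq in auto)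
qed

lemma eventually_normal_minus_link:
  assumes "strand D s" "point D s \<notin> crossings D" "point D s \<in> U" "open U"
  shows "\<forall>\<^sub>F t in at_right 0. point D s + t *\<^sub>R left_normal D s \<in> U - link D \<and>
      point D s - t *\<^sub>R left_normal D s \<in> U - link D"
proof -
  obtain A B where AB: "sides D s 1 A B" "A \<subseteq> U - link D" "B \<subseteq> U - link D"
    using sides_exist[OF assms(1,2,4,3)] by blast
  then show ?thesis unfolding sides_def by (elim eventually_mono) auto
qed

text \<open>Jumps multiply from the left and therefore commute with a multiplication from the
  right.\<close>

lemma solution_mult:
  assumes G: "group G" and f: "solution D G col g U f" and k: "k \<in> carrier G" and U: "open U"
    and g: "\<And>s. strand D s \<Longrightarrow> point D s \<in> U \<Longrightarrow> point D s \<notin> crossings D \<Longrightarrow> g s \<in> carrier G"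
  shows "solution D G col g U (\<lambda>p. f p \<otimes>\<^bsub>G\<^esub> k)"
  unfolding solution_def
proof (intro conjI ballI allI impI)
  interpret group G by fact
  {
    fix p assume p: "p \<in> U - link D"
    then show "f p \<otimes>\<^bsub>G\<^esub> k \<in> carrier G" using f k by (simp add: solution_def)
    have "\<forall>\<^sub>F q in nhds p. f q = f p" using f p by (simp add: solution_def)
    then show "\<forall>\<^sub>F q in nhds p. f q \<otimes>\<^bsub>G\<^esub> k = f p \<otimes>\<^bsub>G\<^esub> k" by (rule eventually_mono) simp
  next
    fix s \<sigma> assume s: "strand D s" "point D s \<in> U" "point D s \<notin> crossings D" and \<sigma>: "\<sigma> \<in> {1, -1::real}"
    have "\<forall>\<^sub>F t in at_right 0. col (point D s + (\<sigma> * t) *\<^sub>R left_normal D s) \<longrightarrow>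
        f (point D s + (\<sigma> * t) *\<^sub>R left_normal D s) = g s \<otimes>\<^bsub>G\<^esub> f (point D s - (\<sigma> * t) *\<^sub>R left_normal D s)"
      using f s \<sigma> unfolding solution_def by blast
    with eventually_normal_minus_link[OF s(1,3,2) U]
    show "\<forall>\<^sub>F t in at_right 0. col (point D s + (\<sigma> * t) *\<^sub>R left_normal D s) \<longrightarrow>
        f (point D s + (\<sigma> * t) *\<^sub>R left_normal D s) \<otimes>\<^bsub>G\<^esub> k =
        g s \<otimes>\<^bsub>G\<^esub> (f (point D s - (\<sigma> * t) *\<^sub>R left_normal D s) \<otimes>\<^bsub>G\<^esub> k)"
    proof eventually_elim
      case (elim t)
      then have "f (point D s - (\<sigma> * t) *\<^sub>R left_normal D s) \<in> carrier G"
        using f \<sigma> by (auto simp: solution_def)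
      then show ?case using elim(2) g[OF s] k by (simp add: m_assoc)
    qed
  }
qed

text \<open>The quotient \<kappa> of \<open>f2\<close> by \<open>f1\<close> does not see the jumps:
  whichever side is coloured, the same factor \<open>g s\<close> enters both functions from the left
  and cancels. So \<kappa> is constant by \<open>constant_across_link\<close>.\<close>

lemma solution_unique:
  assumes G: "group G" and U: "open U" "connected U"
    and f1: "solution D G col g U f1" and f2: "solution D G col g U f2"
    and g: "\<And>s. strand D s \<Longrightarrow> point D s \<in> U \<Longrightarrow> point D s \<notin> crossings D \<Longrightarrow> g s \<in> carrier G"
    and col: "\<And>s. strand D s \<Longrightarrow> point D s \<in> U \<Longrightarrow> point D s \<notin> crossings D \<Longrightarrow>
      \<forall>\<^sub>F t in at_right 0. col (point D s + t *\<^sub>R left_normal D s) \<or> col (point D s - t *\<^sub>R left_normal D s)"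
  shows "\<exists>k\<in>carrier G. \<forall>p\<in>U - link D. f2 p = f1 p \<otimes>\<^bsub>G\<^esub> k"
proof (cases "U = {}")
  interpret group G by fact
  case False
  define \<kappa> where "\<kappa> p = inv\<^bsub>G\<^esub> f1 p \<otimes>\<^bsub>G\<^esub> f2 p" for p
  have car: "f1 p \<in> carrier G" "f2 p \<in> carrier G" if "p \<in> U - link D" for p
    using f1 f2 that by (auto simp: solution_def)
  have cancel: "inv\<^bsub>G\<^esub> (a \<otimes>\<^bsub>G\<^esub> x) \<otimes>\<^bsub>G\<^esub> (a \<otimes>\<^bsub>G\<^esub> y) = inv\<^bsub>G\<^esub> x \<otimes>\<^bsub>G\<^esub> y"
    if "a \<in> carrier G" "x \<in> carrier G" "y \<in> carrier G" for a x y
  proof -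
    have "inv\<^bsub>G\<^esub> a \<otimes>\<^bsub>G\<^esub> (a \<otimes>\<^bsub>G\<^esub> y) = y" using that by (simp add: m_assoc[symmetric])
    then show ?thesis using that by (simp add: inv_mult_group m_assoc)
  qed
  have const: "\<kappa> p = \<kappa> q" if "p \<in> U" "p \<notin> link D" "q \<in> U" "q \<notin> link D" for p q
  proof (rule constant_across_link[OF U _ _ that])
    fix p assume "p \<in> U" "p \<notin> link D"
    then have "\<forall>\<^sub>F q in nhds p. f1 q = f1 p" "\<forall>\<^sub>F q in nhds p. f2 q = f2 p"
      using f1 f2 by (auto simp: solution_def)
    then show "\<forall>\<^sub>F q in nhds p. \<kappa> q = \<kappa> p" by eventually_elim (simp add: \<kappa>_def)
  next
    fix s assume s: "strand D s" "point D s \<in> U" "point D s \<notin> crossings D"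
    have j: "\<forall>\<^sub>F t in at_right 0. col (point D s + (\<sigma> * t) *\<^sub>R left_normal D s) \<longrightarrow>
        f (point D s + (\<sigma> * t) *\<^sub>R left_normal D s) = g s \<otimes>\<^bsub>G\<^esub> f (point D s - (\<sigma> * t) *\<^sub>R left_normal D s)"
      if "solution D G col g U f" "\<sigma> \<in> {1, -1}" for f \<sigma>
      using that s unfolding solution_def by blast
    show "\<forall>\<^sub>F t in at_right 0. \<kappa> (point D s + t *\<^sub>R left_normal D s) = \<kappa> (point D s - t *\<^sub>R left_normal D s)"
      using eventually_normal_minus_link[OF s(1,3,2) U(1)] col[OF s]
        j[OF f1 insertI1] j[OF f1 insertI2[OF singletonI]] j[OF f2 insertI1] j[OF f2 insertI2[OF singletonI]]
    proof eventually_elim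
      case (elim t)
      define x y where "x = point D s + t *\<^sub>R left_normal D s" and "y = point D s - t *\<^sub>R left_normal D s"
      have xy: "x \<in> U - link D" "y \<in> U - link D" using elim(1) by (auto simp: x_def y_def)
      have "f1 x = g s \<otimes>\<^bsub>G\<^esub> f1 y \<and> f2 x = g s \<otimes>\<^bsub>G\<^esub> f2 y \<or> f1 y = g s \<otimes>\<^bsub>G\<^esub> f1 x \<and> f2 y = g s \<otimes>\<^bsub>G\<^esub> f2 x"
        using elim(2-) by (auto simp: x_def y_def)
      then have "\<kappa> x = \<kappa> y"
        using car[OF xy(1)] car[OF xy(2)] g[OF s] unfolding \<kappa>_def by (elim disjE conjE) (simp_all only: cancel)
      then show ?case by (simp add: x_def y_def)
    qed
  qed
  obtain p0 where p0: "p0 \<in> U" "p0 \<notin> link D" using dense_minus_link U(1) False by blast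
  show ?thesis
  proof (intro bexI ballI)
    show "\<kappa> p0 \<in> carrier G" using car p0 by (simp add: \<kappa>_def)
    fix p assume p: "p \<in> U - link D"
    then have "\<kappa> p0 = \<kappa> p" by (intro const p0) auto
    then have "f1 p \<otimes>\<^bsub>G\<^esub> \<kappa> p0 = f1 p \<otimes>\<^bsub>G\<^esub> \<kappa> p" by simp
    also have "\<dots> = f2 p" using car[OF p] by (simp add: \<kappa>_def m_assoc[symmetric])
    finally show "f2 p = f1 p \<otimes>\<^bsub>G\<^esub> \<kappa> p0" ..
  qed
next
  case True
  interpret group G by fact
  show ?thesis using True by auto
qed

section \<open>Existence of solutions by gluing\<close>

lemma solution_glue:
  assumes G: "group G" and U1: "open U1" and U2: "open U2" and conn: "connected (U1 \<inter> U2)"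
    and f1: "solution D G col g U1 f1" and f2: "solution D G col g U2 f2"
    and g: "\<And>s. strand D s \<Longrightarrow> point D s \<notin> crossings D \<Longrightarrow> g s \<in> carrier G"
    and col: "\<And>s. strand D s \<Longrightarrow> point D s \<notin> crossings D \<Longrightarrow>
      \<forall>\<^sub>F t in at_right 0. col (point D s + t *\<^sub>R left_normal D s) \<or> col (point D s - t *\<^sub>R left_normal D s)"
  shows "\<exists>f. solution D G col g (U1 \<union> U2) f"
proof -
  obtain k where k: "k \<in> carrier G" "\<And>p. p \<in> U1 \<inter> U2 - link D \<Longrightarrow> f1 p = f2 p \<otimes>\<^bsub>G\<^esub> k"
    using solution_unique[OF G open_Int[OF U1 U2] conn solution_mono[OF f2] solution_mono[OF f1]] g col by blast
  define f where "f p = (if p \<in> U1 then f1 p else f2 p \<otimes>\<^bsub>G\<^esub> k)" for p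
  have "solution D G col g U1 f" by (rule solution_cong[OF f1 U1]) (simp add: f_def)
  moreover have "solution D G col g U2 f"
    by (rule solution_cong[OF solution_mult[OF G f2 k(1) U2] U2]) (use g k(2) in \<open>auto simp: f_def\<close>)
  ultimately show ?thesis using solution_Un by blast
qed

text \<open>Pieces are added one at a time, each meeting the part already covered in a connected
  set. So a single constant corrects the new piece, and no compatibility on triple overlaps arises.
  The common size of the boxes is a Lebesgue number for the cover by local solutions.\<close>

lemma solution_exists:
  assumes G: "group G"
    and loc: "\<And>p. p \<in> link D \<Longrightarrow> \<exists>N f. open N \<and> p \<in> N \<and> solution D G col g N f"
    and g: "\<And>s. strand D s \<Longrightarrow> point D s \<notin> crossings D \<Longrightarrow> g s \<in> carrier G"
    and col: "\<And>s. strand D s \<Longrightarrow> point D s \<notin> crossings D \<Longrightarrow>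
      \<forall>\<^sub>F t in at_right 0. col (point D s + t *\<^sub>R left_normal D s) \<or> col (point D s - t *\<^sub>R left_normal D s)"
  shows "\<exists>f. solution D G col g UNIV f"
proof -
  interpret group G by fact
  define S where "S U \<longleftrightarrow> (\<exists>f. solution D G col g U f)" for U
  have S_mono: "S U \<Longrightarrow> U' \<subseteq> U \<Longrightarrow> S U'" for U U' unfolding S_def using solution_mono by blast
  have S_glue: "S (U1 \<union> U2)" if U: "open U1" "open U2" "connected (U1 \<inter> U2)" and S12: "S U1" "S U2" for U1 U2
  proof -
    obtain f1 f2 where f: "solution D G col g U1 f1" "solution D G col g U2 f2"
      using S12 unfolding S_def by blast
    show ?thesis unfolding S_def by (rule solution_glue[OF G U f]) (use g col in auto)
  qed
  have const: "solution D G col g U (\<lambda>_. k)" if "U \<inter> link D = {}" "k \<in> carrier G" for U k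
    using that point_mem_link[of D] by (auto simp: solution_def)
  have locally: "\<exists>N. open N \<and> p \<in> N \<and> S N" for p
  proof (cases "p \<in> link D")
    case False
    then show ?thesis using const[of "- link D" "\<one>\<^bsub>G\<^esub>"] open_minus_link[OF D] unfolding S_def by blast
  qed (use loc S_def in blast)
  define box where "box a b c d = {z. a < Re z \<and> Re z < b \<and> c < Im z \<and> Im z < d}" for a b c d
  have box_open: "open (box a b c d)" for a b c d
    unfolding box_def by (intro open_Collect_conj open_Collect_less continuous_intros)
  have box_conn: "connected (box a b c d)" for a b c d
  proof (rule convex_connected)
    have "box a b c d = {z. a < Re z} \<inter> {z. Re z < b} \<inter> {z. c < Im z} \<inter> {z. Im z < d}"
      by (auto simp: box_def)
    then show "convex (box a b c d)"
      by (simp only:) (intro convex_Int convex_halfspace_Re_gt convex_halfspace_Re_lt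
          convex_halfspace_Im_gt convex_halfspace_Im_lt)
  qed
  \<comment> \<open>Local solutions glue to a solution on a square around the disc of radius \<open>r\<close>. It is constant on
    an annulus outside of this disc and extends to the plane by this constant.\<close>
  obtain r where r: "0 < r" "link D \<subseteq> ball 0 r"
    using compact_imp_bounded[OF compact_link[OF D]] bounded_subset_ballD by blast
  define M where "M = r + 1"
  obtain e where e: "0 < e" "\<And>p. p \<in> cbox (Complex (-M) (-M)) (Complex M M) \<Longrightarrow> \<exists>N\<in>{N. open N \<and> S N}. ball p e \<subseteq> N"
  proof (rule Heine_Borel_lemma[of "cbox (Complex (-M) (-M)) (Complex M M)" "{N. open N \<and> S N}"])
    show "cbox (Complex (-M) (-M)) (Complex M M) \<subseteq> \<Union>{N. open N \<and> S N}" using locally by blast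
  qed (use that in auto)
  \<comment> \<open>The modulus is at most the sum of the absolute values of real and imaginary
    part, so a box of half width \<open>e / 2\<close> fits into the disc of radius
    \<open>e\<close>.\<close>
  define \<epsilon> where "\<epsilon> = e / 2"
  have \<epsilon>: "0 < \<epsilon>" using e by (simp add: \<epsilon>_def)
  have small: "S (box (x - \<epsilon>) (x + \<epsilon>) (y - \<epsilon>) (y + \<epsilon>))" if "-M \<le> x" "x \<le> M" "-M \<le> y" "y \<le> M" for x y
  proof -
    have "Complex x y \<in> cbox (Complex (-M) (-M)) (Complex M M)" using that by (simp add: in_cbox_complex_iff)
    then obtain N where N: "S N" "ball (Complex x y) e \<subseteq> N" using e(2) by blast
    have "box (x - \<epsilon>) (x + \<epsilon>) (y - \<epsilon>) (y + \<epsilon>) \<subseteq> ball (Complex x y) e"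
    proof
      fix z assume "z \<in> box (x - \<epsilon>) (x + \<epsilon>) (y - \<epsilon>) (y + \<epsilon>)"
      then have "\<bar>Re (z - Complex x y)\<bar> < \<epsilon>" "\<bar>Im (z - Complex x y)\<bar> < \<epsilon>" by (auto simp: box_def)
      then have "cmod (z - Complex x y) < e" using cmod_le[of "z - Complex x y"] by (simp add: \<epsilon>_def)
      then show "z \<in> ball (Complex x y) e" by (simp add: dist_norm norm_minus_commute)
    qed
    then show ?thesis using N S_mono by blast
  qed
  have M0: "-M \<le> M" using r by (simp add: M_def)
  have rows: "S (box (-M) M (y - \<epsilon>) (y + \<epsilon>))" if y: "-M \<le> y" "y \<le> M" for y
  proof (rule interval_gluing[where P = "\<lambda>a b. S (box a b (y - \<epsilon>) (y + \<epsilon>))", OF _ _ \<epsilon> _ M0])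
    show "S (box a' b' (y - \<epsilon>) (y + \<epsilon>))" if "S (box a b (y - \<epsilon>) (y + \<epsilon>))" "a \<le> a'" "b' \<le> b" for a b a' b'
      by (rule S_mono[OF that(1)]) (use that in \<open>auto simp: box_def\<close>)
    show "S (box a d (y - \<epsilon>) (y + \<epsilon>))"
      if "S (box a b (y - \<epsilon>) (y + \<epsilon>))" "S (box c d (y - \<epsilon>) (y + \<epsilon>))" "a \<le> c" "c < b" "b \<le> d" for a b c d
    proof (rule S_mono[OF S_glue[OF box_open box_open _ that(1,2)]])
      have "box a b (y - \<epsilon>) (y + \<epsilon>) \<inter> box c d (y - \<epsilon>) (y + \<epsilon>) = box c b (y - \<epsilon>) (y + \<epsilon>)"
        using that by (auto simp: box_def)
      then show "connected (box a b (y - \<epsilon>) (y + \<epsilon>) \<inter> box c d (y - \<epsilon>) (y + \<epsilon>))" using box_conn by simp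
    qed (use that in \<open>auto simp: box_def\<close>)
  qed (use small y in auto)
  have "S (box (-M) M (-M) M)"
  proof (rule interval_gluing[where P = "\<lambda>a b. S (box (-M) M a b)", OF _ _ \<epsilon> _ M0])
    show "S (box (-M) M a' b')" if "S (box (-M) M a b)" "a \<le> a'" "b' \<le> b" for a b a' b'
      by (rule S_mono[OF that(1)]) (use that in \<open>auto simp: box_def\<close>)
    show "S (box (-M) M a d)"
      if "S (box (-M) M a b)" "S (box (-M) M c d)" "a \<le> c" "c < b" "b \<le> d" for a b c d
    proof (rule S_mono[OF S_glue[OF box_open box_open _ that(1,2)]])
      have "box (-M) M a b \<inter> box (-M) M c d = box (-M) M c b" using that by (auto simp: box_def)
      then show "connected (box (-M) M a b \<inter> box (-M) M c d)" using box_conn by simp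
    qed (use that in \<open>auto simp: box_def\<close>)
  qed (use rows in auto)
  moreover have "ball 0 M \<subseteq> box (-M) M (-M) M"
  proof
    fix z :: complex assume "z \<in> ball 0 M"
    then show "z \<in> box (-M) M (-M) M"
      using abs_Re_le_cmod[of z] abs_Im_le_cmod[of z] by (auto simp: box_def)
  qed
  ultimately obtain f where f: "solution D G col g (ball 0 M) f"
    using S_mono S_def by blast
  have out: "z \<notin> link D" if "r \<le> norm z" for z using r that by (auto simp: subset_iff)
  let ?A = "{z. r < norm (z - 0) \<and> norm (z - 0) < M}"
  define z0 where "z0 = complex_of_real ((r + M) / 2)"
  have "norm z0 = (r + M) / 2" using r by (simp only: z0_def norm_of_real) (simp add: M_def)
  then have z0: "z0 \<in> ?A" by (simp add: M_def)
  have fA: "f z = f z0" if "z \<in> ?A" for z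
  proof (rule connected_locally_constant[OF connected_annulus(1) _ that z0])
    show "\<forall>\<^sub>F q in nhds p. f q = f p" if "p \<in> ?A" for p using f that out[of p] by (auto simp: solution_def)
  qed simp
  define f' where "f' z = (if norm z < M then f z else f z0)" for z
  have k: "f z0 \<in> carrier G" using f z0 out[of z0] by (auto simp: solution_def)
  have o: "open {z::complex. r < norm z}" by (intro open_Collect_less continuous_intros)
  have "solution D G col g (ball 0 M) f'" by (rule solution_cong[OF f]) (auto simp: f'_def)
  moreover have "solution D G col g {z. r < norm z} f'"
  proof (rule solution_cong[OF const[OF _ k] o])
    show "{z. r < cmod z} \<inter> link D = {}" using out by force
    show "f' p = f z0" if "p \<in> {z. r < cmod z}" for p
      using that fA[of p] by (simp add: f'_def)
  qed
  moreover have "ball 0 M \<union> {z. r < norm z} = UNIV" by (auto simp: M_def)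
  ultimately show ?thesis using solution_Un by metis
qed

end

section \<open>Colourings and arcs\<close>

text \<open>The jump condition between sides on which a function is constant. For a proper colouring
  and inhabited sides exactly one clause is active; if all points count as coloured, both
  are.\<close>

definition compatible :: "('g, 'm) monoid_scheme \<Rightarrow> (complex \<Rightarrow> bool) \<Rightarrow> 'g \<Rightarrow> complex set \<Rightarrow> complex set \<Rightarrow> 'g \<Rightarrow> 'g \<Rightarrow> bool" where
  "compatible G col h A B x y \<longleftrightarrow>
    ((\<exists>p\<in>A. col p) \<longrightarrow> x = h \<otimes>\<^bsub>G\<^esub> y) \<and> ((\<exists>p\<in>B. col p) \<longrightarrow> y = h \<otimes>\<^bsub>G\<^esub> x)"

text \<open>The sides of each strand need to be known for one sign \<sigma> only: the opposite sign
  exchanges \<open>A\<close> and \<open>B\<close>, and \<open>compatible\<close> is symmetric under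
  this exchange.\<close>

lemma solution_piecewise:
  assumes lc: "\<And>p. p \<in> N - link D \<Longrightarrow> f p \<in> carrier G \<and> (\<exists>S. open S \<and> p \<in> S \<and> (\<forall>q\<in>S. f q = f p))"
    and jump: "\<And>s. strand D s \<Longrightarrow> point D s \<in> N \<Longrightarrow> point D s \<notin> crossings D \<Longrightarrow>
      \<exists>\<sigma> A B x y. (\<sigma> = 1 \<or> \<sigma> = -1) \<and> sides D s \<sigma> A B \<and> (\<forall>p\<in>A. f p = x) \<and> (\<forall>p\<in>B. f p = y) \<and>
        compatible G col (g s) A B x y"
  shows "solution D G col g N f"
  unfolding solution_def
proof (intro conjI ballI allI impI)
  fix p assume "p \<in> N - link D"
  then show "f p \<in> carrier G" "\<forall>\<^sub>F q in nhds p. f q = f p"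
    using lc unfolding eventually_nhds by blast+
next
  fix s \<tau> assume s: "strand D s" "point D s \<in> N" "point D s \<notin> crossings D" and \<tau>: "\<tau> \<in> {1, -1::real}"
  obtain \<sigma> A B x y where \<sigma>: "\<sigma> = 1 \<or> \<sigma> = -1" and sd: "sides D s \<sigma> A B"
    and f: "\<forall>p\<in>A. f p = x" "\<forall>p\<in>B. f p = y" and c: "compatible G col (g s) A B x y"
    using jump[OF s] by blast
  have "\<tau> = \<sigma> \<or> \<tau> = - \<sigma>" using \<tau> \<sigma> by auto
  then show "\<forall>\<^sub>F t in at_right 0. col (point D s + (\<tau> * t) *\<^sub>R left_normal D s) \<longrightarrow>
      f (point D s + (\<tau> * t) *\<^sub>R left_normal D s) = g s \<otimes>\<^bsub>G\<^esub> f (point D s - (\<tau> * t) *\<^sub>R left_normal D s)"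
  proof
    assume "\<tau> = \<sigma>"
    then show ?thesis using sd unfolding sides_def
      by (elim eventually_mono) (use f c in \<open>auto simp: compatible_def\<close>)
  next
    assume "\<tau> = - \<sigma>"
    then have "sides D s \<tau> B A" using sd sides_minus[of D s \<sigma> B A] by simp
    then show ?thesis unfolding sides_def
      by (elim eventually_mono) (use f c in \<open>auto simp: compatible_def\<close>)
  qed
qed

lemma solution_at_regular:
  assumes N: "open L" "open R" "L \<inter> R = {}" "N - link D = L \<union> R"
    and car: "x \<in> carrier G" "y \<in> carrier G"
    and *: "\<And>s. strand D s \<Longrightarrow> point D s \<in> N \<Longrightarrow> sides D s 1 L R \<and> compatible G col (g s) L R x y"
  shows "\<exists>f. solution D G col g N f"
proof -
  define f where "f p = (if p \<in> L then x else y)" for p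
  have f: "\<forall>p\<in>L. f p = x" "\<forall>p\<in>R. f p = y" using N by (auto simp: f_def)
  have "solution D G col g N f"
  proof (rule solution_piecewise)
    fix p assume "p \<in> N - link D"
    then show "f p \<in> carrier G \<and> (\<exists>S. open S \<and> p \<in> S \<and> (\<forall>q\<in>S. f q = f p))"
      unfolding N using f N(1,2) car by (metis UnE)
  next
    fix s assume s: "strand D s" "point D s \<in> N" "point D s \<notin> crossings D"
    show "\<exists>\<sigma> A B x y. (\<sigma> = 1 \<or> \<sigma> = -1) \<and> sides D s \<sigma> A B \<and> (\<forall>p\<in>A. f p = x) \<and> (\<forall>p\<in>B. f p = y) \<and>
        compatible G col (g s) A B x y"
      by (intro exI[of _ 1] exI[of _ L] exI[of _ R] exI[of _ x] exI[of _ y]) (use *[OF s(1,2)] f in auto)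
  qed
  then show ?thesis by blast
qed

section \<open>Checkerboard colourings, and arcs as classes of strands\<close>

definition colouring :: "diagram \<Rightarrow> (complex \<Rightarrow> bool) \<Rightarrow> bool" where
  "colouring D col \<longleftrightarrow> (\<forall>p. p \<notin> link D \<longrightarrow> (\<forall>\<^sub>F q in nhds p. col q = col p)) \<and>
    (\<forall>s. strand D s \<longrightarrow> point D s \<notin> crossings D \<longrightarrow>
      (\<forall>\<^sub>F t in at_right 0. col (point D s + t *\<^sub>R left_normal D s) \<noteq> col (point D s - t *\<^sub>R left_normal D s)))"

definition undercut :: "diagram \<Rightarrow> nat \<times> complex \<Rightarrow> bool" where
  "undercut D s \<longleftrightarrow> (\<exists>c. under_strand D c s)"

text \<open>Arcs are handled through the strands lying on them. At an underpasser the second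
  component is empty, so this is an arc only where \<open>undercut\<close> fails.\<close>

definition arc_of :: "diagram \<Rightarrow> nat \<times> complex \<Rightarrow> nat \<times> complex set" where
  "arc_of D s = (fst s, connected_component_set (sphere 0 1 - {z. undercut D (fst s, z)}) (snd s))"

lemma not_undercut: "point D s \<notin> crossings D \<Longrightarrow> \<not> undercut D s"
  by (auto simp: undercut_def under_strand_def mem_strands_iff)

lemma over_not_undercut: "over_strand D c s \<Longrightarrow> \<not> undercut D s"
  by (auto simp: undercut_def under_strand_def over_strand_def)

lemma arcs_iff: "K \<in> arcs D \<longleftrightarrow> (\<exists>s. strand D s \<and> \<not> undercut D s \<and> K = arc_of D s)"
proof
  assume "K \<in> arcs D"
  then obtain i C where K: "K = (i, C)" "i < num_curves D" "C \<in> components (sphere 0 1 - {z. undercut D (i, z)})"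
    by (auto simp: arcs_def undercut_def)
  then obtain z where "z \<in> sphere 0 1 - {z. undercut D (i, z)}"
    "C = connected_component_set (sphere 0 1 - {z. undercut D (i, z)}) z" by (auto simp: components_iff)
  then show "\<exists>s. strand D s \<and> \<not> undercut D s \<and> K = arc_of D s"
    using K by (intro exI[of _ "(i, z)"]) (auto simp: strand_def arc_of_def)
next
  assume "\<exists>s. strand D s \<and> \<not> undercut D s \<and> K = arc_of D s"
  then obtain s where "strand D s" "\<not> undercut D s" "K = arc_of D s" by blast
  then show "K \<in> arcs D"
    unfolding arcs_def arc_of_def undercut_def[symmetric] strand_def
    by (auto intro!: componentsI)
qed

lemma mem_arc_of: "strand D s \<Longrightarrow> \<not> undercut D s \<Longrightarrow> snd s \<in> snd (arc_of D s)"
  by (auto simp: arc_of_def strand_def)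

lemma arc_eq_arc_of:
  assumes K: "K \<in> arcs D" and s: "fst s = fst K" "snd s \<in> snd K"
  shows "K = arc_of D s" "strand D s" "\<not> undercut D s"
proof -
  obtain r where r: "strand D r" "\<not> undercut D r" "K = arc_of D r" using K arcs_iff by blast
  then show "K = arc_of D s" using s connected_component_eq[of "snd s" _ "snd r"]
    by (auto simp: arc_of_def)
  have "snd s \<in> sphere 0 1 - {z. undercut D (fst s, z)}"
    using s r connected_component_subset[of "sphere 0 1 - {z. undercut D (fst s, z)}" "snd r"]
    by (auto simp: arc_of_def)
  then have "snd s \<in> sphere 0 1" "\<not> undercut D (fst s, snd s)" by auto
  moreover have "fst s < num_curves D" using r(1,3) s(1) by (simp add: strand_def arc_of_def)
  ultimately show "strand D s" "\<not> undercut D s" by (simp_all add: strand_def)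
qed

text \<open>A connected set of angles without underpassers is mapped to a connected part of the cut
  circle, hence into one component.\<close>

lemma arc_of_shift_eq:
  assumes s: "strand D s" and T: "connected T" "t \<in> T" "t' \<in> T" and u: "\<And>r. r \<in> T \<Longrightarrow> \<not> undercut D (shift s r)"
  shows "arc_of D (shift s t) = arc_of D (shift s t')"
proof -
  let ?S = "sphere 0 1 - {z. undercut D (fst s, z)}"
  have "connected ((\<lambda>r. snd s * cis r) ` T)"
    by (intro connected_continuous_image T) (auto simp: cis_conv_exp intro!: continuous_intros)
  moreover have "(\<lambda>r. snd s * cis r) ` T \<subseteq> ?S"
    using u s by (auto simp: strand_def shift_def norm_mult)
  ultimately have "connected_component ?S (snd s * cis t) (snd s * cis t')"
    unfolding connected_component_def using T by blast
  then have "connected_component_set ?S (snd s * cis t) = connected_component_set ?S (snd s * cis t')"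
    by (intro connected_component_eq) (simp add: connected_component_sym)
  then show ?thesis by (simp add: arc_of_def shift_def)
qed

definition crossing_arcs_at :: "diagram \<Rightarrow> nat \<times> complex \<Rightarrow> nat \<times> complex \<Rightarrow>
    nat \<times> complex set \<Rightarrow> nat \<times> complex set \<Rightarrow> real \<Rightarrow> bool" where
  "crossing_arcs_at D a b a2 a3 t \<longleftrightarrow>
    point D (shift a t) \<notin> crossings D \<and> point D (shift a (- t)) \<notin> crossings D \<and>
    point D (shift b t) \<notin> crossings D \<and> point D (shift b (- t)) \<notin> crossings D \<and>
    arc_of D (shift a t) = arc_of D a \<and> arc_of D (shift a (- t)) = arc_of D a \<and>
    arc_of D (shift b (- t)) = a2 \<and> arc_of D (shift b t) = a3"

context
  fixes D assumes D: "link_diagram D"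
begin

lemma crossing_chart_cover:
  assumes ch: "crossing_chart D a b \<sigma> \<eta> N V W Y X" and s: "strand D s" "point D s \<in> N" "point D s \<notin> crossings D"
    and ab: "over_strand D c a" "under_strand D c b"
  obtains t where "0 < t" "t < \<eta>"
    "s = shift a t \<and> sides D s 1 V W \<or> s = shift a (- t) \<and> sides D s 1 Y X \<or>
     s = shift b (\<sigma> * t) \<and> sides D s \<sigma> W X \<or> s = shift b (- (\<sigma> * t)) \<and> sides D s \<sigma> V Y"
proof -
  have "point D a \<in> crossings D" "point D b \<in> crossings D"
    using over_under_strands(5,6)[OF D ab] ab by (auto simp: over_strand_def)
  then have "s \<noteq> a" "s \<noteq> b" using s by auto
  moreover have "s = a \<or> s = b \<or> (\<exists>t. 0 < t \<and> t < \<eta> \<and>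
        (s = shift a t \<or> s = shift a (- t) \<or> s = shift b (\<sigma> * t) \<or> s = shift b (- (\<sigma> * t))))"
    using ch s(1,2) unfolding crossing_chart_def by blast
  ultimately obtain t where t: "0 < t" "t < \<eta>"
    "s = shift a t \<or> s = shift a (- t) \<or> s = shift b (\<sigma> * t) \<or> s = shift b (- (\<sigma> * t))" by blast
  moreover have "(point D (shift a t) \<in> N \<longrightarrow> sides D (shift a t) 1 V W) \<and>
      (point D (shift a (- t)) \<in> N \<longrightarrow> sides D (shift a (- t)) 1 Y X) \<and>
      (point D (shift b (\<sigma> * t)) \<in> N \<longrightarrow> sides D (shift b (\<sigma> * t)) \<sigma> W X) \<and>
      (point D (shift b (- (\<sigma> * t))) \<in> N \<longrightarrow> sides D (shift b (- (\<sigma> * t))) \<sigma> V Y)"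
    using ch t(1,2) unfolding crossing_chart_def by blast
  ultimately show thesis using that[of t] s(2) by blast
qed

text \<open>The quadrants are open and disjoint, so any four values are locally constant. Only the
  four half strands impose conditions, and nothing is asked at the crossing itself.\<close>

lemma solution_at_crossing:
  assumes ch: "crossing_chart D a b \<sigma> \<eta> N V W Y X" and ab: "over_strand D c a" "under_strand D c b"
    and \<sigma>: "\<sigma> = 1 \<or> \<sigma> = -1"
    and car: "v \<in> carrier G" "w \<in> carrier G" "y \<in> carrier G" "x \<in> carrier G"
    and cmp: "\<And>t. 0 < t \<Longrightarrow> t < \<eta> \<Longrightarrow> compatible G col (g (shift a t)) V W v w \<and>
      compatible G col (g (shift a (- t))) Y X y x \<and> compatible G col (g (shift b (\<sigma> * t))) W X w x \<and>
      compatible G col (g (shift b (- (\<sigma> * t)))) V Y v y"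
  shows "\<exists>f. solution D G col g N f"
proof -
  define f where "f p = (if p \<in> V then v else if p \<in> W then w else if p \<in> Y then y else x)" for p
  have op: "open V" "open W" "open Y" "open X" and N: "N - link D = V \<union> W \<union> Y \<union> X"
    and dj: "V \<inter> W = {}" "V \<inter> Y = {}" "V \<inter> X = {}" "W \<inter> Y = {}" "W \<inter> X = {}" "Y \<inter> X = {}"
    using ch unfolding crossing_chart_def by simp_all
  have fv: "\<forall>p\<in>V. f p = v" "\<forall>p\<in>W. f p = w" "\<forall>p\<in>Y. f p = y" "\<forall>p\<in>X. f p = x"
    using dj by (auto simp: f_def)
  have "solution D G col g N f"
  proof (rule solution_piecewise)
    fix p assume "p \<in> N - link D"
    then consider "p \<in> V" | "p \<in> W" | "p \<in> Y" | "p \<in> X" unfolding N by blast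
    then show "f p \<in> carrier G \<and> (\<exists>S. open S \<and> p \<in> S \<and> (\<forall>q\<in>S. f q = f p))"
      using fv op car by cases metis+
  next
    fix s assume s: "strand D s" "point D s \<in> N" "point D s \<notin> crossings D"
    obtain t where t: "0 < t" "t < \<eta>"
      "s = shift a t \<and> sides D s 1 V W \<or> s = shift a (- t) \<and> sides D s 1 Y X \<or>
       s = shift b (\<sigma> * t) \<and> sides D s \<sigma> W X \<or> s = shift b (- (\<sigma> * t)) \<and> sides D s \<sigma> V Y"
      using crossing_chart_cover[OF ch s ab] by blast
    note cm = cmp[OF t(1,2)]
    from t(3) show "\<exists>\<sigma> A B x y. (\<sigma> = 1 \<or> \<sigma> = -1) \<and> sides D s \<sigma> A B \<and> (\<forall>p\<in>A. f p = x) \<and> (\<forall>p\<in>B. f p = y) \<and>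
        compatible G col (g s) A B x y"
    proof (elim disjE conjE)
      assume s: "s = shift a t" "sides D s 1 V W"
      show ?thesis by (intro exI[of _ 1] exI[of _ V] exI[of _ W] exI[of _ v] exI[of _ w]) (use s fv cm in simp)
    next
      assume s: "s = shift a (- t)" "sides D s 1 Y X"
      show ?thesis by (intro exI[of _ 1] exI[of _ Y] exI[of _ X] exI[of _ y] exI[of _ x]) (use s fv cm in simp)
    next
      assume s: "s = shift b (\<sigma> * t)" "sides D s \<sigma> W X"
      show ?thesis by (intro exI[of _ \<sigma>] exI[of _ W] exI[of _ X] exI[of _ w] exI[of _ x]) (use s fv cm \<sigma> in simp)
    next
      assume s: "s = shift b (- (\<sigma> * t))" "sides D s \<sigma> V Y"
      show ?thesis by (intro exI[of _ \<sigma>] exI[of _ V] exI[of _ Y] exI[of _ v] exI[of _ y]) (use s fv cm \<sigma> in simp)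
    qed
  qed
  then show ?thesis by blast
qed

lemma colouring_exists: "\<exists>col. colouring D col"
proof -
  \<comment> \<open>In a group of order two the jump condition is symmetric, so all points may count as coloured.\<close>
  define G where "G = \<lparr>carrier = UNIV :: bool set, mult = (\<noteq>), one = False\<rparr>"
  have G: "group G" by (rule groupI) (auto simp: G_def)
  have "\<exists>f. solution D G (\<lambda>_. True) (\<lambda>_. True) UNIV f"
  proof (rule solution_exists[OF D G])
    fix p assume "p \<in> link D"
    then obtain s where s: "strand D s" "point D s = p" by (auto simp: link_iff)
    show "\<exists>N f. open N \<and> p \<in> N \<and> solution D G (\<lambda>_. True) (\<lambda>_. True) N f"
    proof (cases "p \<in> crossings D")
      case True
      obtain a b where ab: "over_strand D p a" "under_strand D p b" using crossing_over_under[OF D True] by blast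
      obtain \<sigma> \<eta> N V W Y X where \<sigma>: "\<sigma> = 1 \<or> \<sigma> = -1" and ch: "crossing_chart D a b \<sigma> \<eta> N V W Y X"
        using crossing_has_chart[OF D ab open_UNIV UNIV_I zero_less_one] by metis
      have N: "open N" "p \<in> N" using ch over_under_strands(5)[OF D ab] by (auto simp: crossing_chart_def)
      \<comment> \<open>The opposite quadrants V and X get True, W and Y get False, so that each of
        the four half strands separates different values.\<close>
      have "\<exists>f. solution D G (\<lambda>_. True) (\<lambda>_. True) N f"
        by (rule solution_at_crossing[OF ch ab \<sigma>, of True _ False False True]) (auto simp: G_def compatible_def)
      then show ?thesis using N by blast
    next
      case False
      show ?thesis
      proof (rule regular_chart[OF D s(1) _ open_UNIV UNIV_I zero_less_one])
        show "point D s \<notin> crossings D" using s False by simp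
        fix N L R assume N: "open N" "point D s \<in> N" "open L" "open R" "L \<inter> R = {}" "N - link D = L \<union> R"
          and *: "\<And>s'. strand D s' \<Longrightarrow> point D s' \<in> N \<Longrightarrow>
            (\<exists>t. \<bar>t\<bar> < 1 \<and> s' = shift s t) \<and> point D s' \<notin> crossings D \<and> sides D s' 1 L R"
        have "\<exists>f. solution D G (\<lambda>_. True) (\<lambda>_. True) N f"
          by (rule solution_at_regular[OF N(3-6), of True _ False]) (use * in \<open>auto simp: G_def compatible_def\<close>)
        then show ?thesis using N s by blast
      qed
    qed
  qed (auto simp: G_def)
  then obtain f where f: "solution D G (\<lambda>_. True) (\<lambda>_. True) UNIV f" by blast
  have "\<forall>\<^sub>F t in at_right 0. f (point D s + t *\<^sub>R left_normal D s) \<noteq> f (point D s - t *\<^sub>R left_normal D s)"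
    if "strand D s" "point D s \<notin> crossings D" for s
  proof -
    have "\<forall>\<^sub>F t in at_right 0. True \<longrightarrow> f (point D s + (1 * t) *\<^sub>R left_normal D s) =
        True \<otimes>\<^bsub>G\<^esub> f (point D s - (1 * t) *\<^sub>R left_normal D s)"
      using f that unfolding solution_def by blast
    then show ?thesis by (rule eventually_mono) (simp add: G_def)
  qed
  then have "colouring D f" using f unfolding colouring_def solution_def by blast
  then show ?thesis by blast
qed

text \<open>Close to a crossing its two strands pass no other crossing. So the overpasser is not cut
  at all and stays in one arc, while the underpasser is cut only at the crossing, with one arc on
  either side.\<close>

lemma crossing_arcs:
  assumes ab: "over_strand D c a" "under_strand D c b"
  obtains e a2 a3 where "0 < e" "\<And>t. 0 < t \<Longrightarrow> t < e \<Longrightarrow> crossing_arcs_at D a b a2 a3 t"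
    "[(arc_of D a, True), (a2, False), (arc_of D a, True), (a3, False)] \<in> arc_relators D"
proof -
  note os = over_under_strands[OF D ab]
  obtain e where e: "0 < e" "\<And>t. t \<noteq> 0 \<Longrightarrow> \<bar>t\<bar> < e \<Longrightarrow>
    point D (shift a t) \<notin> crossings D \<and> point D (shift b t) \<notin> crossings D"
    using crossing_shift[OF D ab] by blast
  \<comment> \<open>Any angle between 0 and \<open>e\<close> would give the same arcs, by
    \<open>B\<close> and \<open>B'\<close>.\<close>
  define a2 a3 where "a2 = arc_of D (shift b (- (e/2)))" and "a3 = arc_of D (shift b (e/2))"
  have A: "arc_of D (shift a t) = arc_of D (shift a 0)" if "\<bar>t\<bar> < e" for t
  proof (rule arc_of_shift_eq[OF os(3), of "{-e<..<e}"])
    show "\<not> undercut D (shift a r)" if "r \<in> {-e<..<e}" for r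
    proof (cases "r = 0")
      case False
      have "\<bar>r\<bar> < e" using that by auto
      then show ?thesis using e(2)[OF False] by (intro not_undercut) simp
    qed (simp add: over_not_undercut[OF ab(1)])
  qed (use that e in auto)
  have B: "arc_of D (shift b t) = a3" if "0 < t" "t < e" for t
    unfolding a3_def
  proof (rule arc_of_shift_eq[OF os(4), of "{0<..<e}"])
    show "\<not> undercut D (shift b r)" if "r \<in> {0<..<e}" for r
    proof -
      have "\<bar>r\<bar> < e" "r \<noteq> 0" using that by auto
      then show ?thesis using e(2) by (intro not_undercut) simp
    qed
  qed (use that e in auto)
  have B': "arc_of D (shift b (- t)) = a2" if "0 < t" "t < e" for t
    unfolding a2_def
  proof (rule arc_of_shift_eq[OF os(4), of "{-e<..<0}"])
    show "\<not> undercut D (shift b r)" if "r \<in> {-e<..<0}" for r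
    proof -
      have "\<bar>r\<bar> < e" "r \<noteq> 0" using that by auto
      then show ?thesis using e(2) by (intro not_undercut) simp
    qed
  qed (use that e in auto)
  have ev: "\<forall>\<^sub>F t in at_right 0. 0 < t \<and> t < e"
    using e(1) by (auto simp: eventually_at_right_field intro!: exI[of _ e])
  have in2: "\<forall>\<^sub>F t in at_right 0. snd b * cis (- t) \<in> snd a2"
    using ev
  proof eventually_elim
    case (elim t)
    have "snd (shift b (- t)) \<in> snd (arc_of D (shift b (- t)))"
      using e(2)[of "- t"] elim os(4) by (intro mem_arc_of not_undercut) auto
    then show ?case using B'[of t] elim by (simp add: shift_def)
  qed
  have in3: "\<forall>\<^sub>F t in at_right 0. snd b * cis t \<in> snd a3"
    using ev
  proof eventually_elim
    case (elim t)
    have "snd (shift b t) \<in> snd (arc_of D (shift b t))"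
      using e(2)[of t] elim os(4) by (intro mem_arc_of not_undercut) auto
    then show ?case using B[of t] elim by (simp add: shift_def)
  qed
  have "point D (shift b (- (e/2))) \<notin> crossings D" "point D (shift b (e/2)) \<notin> crossings D"
    using e(1) e(2)[of "e/2"] e(2)[of "-(e/2)"] by auto
  then have arcs: "arc_of D a \<in> arcs D" "a2 \<in> arcs D" "a3 \<in> arcs D"
    using os(3,4) over_not_undercut[OF ab(1)] not_undercut strand_shift
    unfolding arcs_iff a2_def a3_def by blast+
  have rel: "[(arc_of D a, True), (a2, False), (arc_of D a, True), (a3, False)] \<in> arc_relators D"
  proof -
    have f: "fst (arc_of D a) = fst a" "fst a2 = fst b" "fst a3 = fst b"
      by (simp_all add: a2_def a3_def arc_of_def shift_def)
    have m: "snd a \<in> snd (arc_of D a)" by (rule mem_arc_of[OF os(3) over_not_undercut[OF ab(1)]])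
    have "over_strand D c (fst a, snd a)" "under_strand D c (fst b, snd b)" using ab by simp_all
    then show ?thesis unfolding arc_relators_def using arcs f m in2 in3 by blast
  qed
  show thesis
    by (rule that[of e a2 a3, OF e(1) _ rel]) (use A B B' e(2) in \<open>auto simp: crossing_arcs_at_def\<close>)
qed

text \<open>A relator names its arcs only through membership of parameter values. They are
  nevertheless the ones found by \<open>crossing_arcs\<close>, since two arcs of one component that
  share a parameter value coincide.\<close>

lemma arc_relatorsE:
  assumes "r \<in> arc_relators D"
  obtains c a b e a2 a3 where "over_strand D c a" "under_strand D c b" "0 < e"
    "\<And>t. 0 < t \<Longrightarrow> t < e \<Longrightarrow> arc_of D (shift a t) = arc_of D a \<and> arc_of D (shift a (- t)) = arc_of D a \<and>
      arc_of D (shift b (- t)) = a2 \<and> arc_of D (shift b t) = a3"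
    "r = [(arc_of D a, True), (a2, False), (arc_of D a, True), (a3, False)]"
proof -
  obtain a1 a2 a3 c i z j w where r: "r = [(a1, True), (a2, False), (a1, True), (a3, False)]"
    and arcs: "a1 \<in> arcs D" "a2 \<in> arcs D" "a3 \<in> arcs D"
    and ab: "over_strand D c (i, z)" "under_strand D c (j, w)"
    and f: "fst a1 = i" "z \<in> snd a1" "fst a2 = j" "fst a3 = j"
    and ev: "\<forall>\<^sub>F t in at_right 0. w * cis (- t) \<in> snd a2" "\<forall>\<^sub>F t in at_right 0. w * cis t \<in> snd a3"
    using assms unfolding arc_relators_def by blast
  show thesis
  proof (rule crossing_arcs[OF ab])
    fix e b2 b3 assume e: "0 < e" and *: "\<And>t. 0 < t \<Longrightarrow> t < e \<Longrightarrow> crossing_arcs_at D (i, z) (j, w) b2 b3 t"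
  have "\<forall>\<^sub>F t in at_right 0. 0 < t \<and> t < e"
    using e by (auto simp: eventually_at_right_field intro!: exI[of _ e])
  with ev have "\<forall>\<^sub>F t in at_right (0::real). b2 = a2 \<and> b3 = a3"
  proof eventually_elim
    case (elim t)
    have "a2 = arc_of D (shift (j, w) (- t))" "a3 = arc_of D (shift (j, w) t)"
      using elim f by (auto intro!: arc_eq_arc_of(1)[OF arcs(2)] arc_eq_arc_of(1)[OF arcs(3)] simp: shift_def)
    then show ?case using *[of t] elim by (simp add: crossing_arcs_at_def)
  qed
  then have "b2 = a2" "b3 = a3" by (simp_all add: eventually_const_iff trivial_limit_at_right_real)
  moreover have "a1 = arc_of D (i, z)" using f by (intro arc_eq_arc_of(1)[OF arcs(1)]) auto
  ultimately show thesis using * r by (intro that[OF ab e, of a2 a3]) (auto simp: crossing_arcs_at_def)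
  qed
qed

text \<open>\<kappa> is compared only off crossings, since a quotient of two sides has no meaning
  where the normal may run along the other strand. These strands are dense in the arc, and the
  hypothesis \<open>over\<close> leads across each overpass, so connectedness of the arc
  applies.\<close>

lemma constant_on_arcs:
  assumes reg: "\<And>s. strand D s \<Longrightarrow> point D s \<notin> crossings D \<Longrightarrow> \<exists>e>0. \<forall>t. \<bar>t\<bar> < e \<longrightarrow> \<kappa> (shift s t) = \<kappa> s"
    and over: "\<And>c s. over_strand D c s \<Longrightarrow> \<exists>e>0. \<forall>t t'. 0 < \<bar>t\<bar> \<and> \<bar>t\<bar> < e \<and> 0 < \<bar>t'\<bar> \<and> \<bar>t'\<bar> < e \<longrightarrow>
      \<kappa> (shift s t) = \<kappa> (shift s t')"
    and s: "strand D s" "point D s \<notin> crossings D" and s': "strand D s'" "point D s' \<notin> crossings D"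
    and eq: "arc_of D s = arc_of D s'"
  shows "\<kappa> s = \<kappa> s'"
proof -
  define i where "i = fst s"
  define K where "K = snd (arc_of D s)"
  have arc: "(i, K) = arc_of D s" by (simp add: K_def i_def arc_of_def)
  have i: "fst s = i" "fst s' = i" using eq by (auto simp: arc_of_def i_def)
  have inK: "(i, K) = arc_of D (i, z) \<and> strand D (i, z) \<and> \<not> undercut D (i, z)" if "z \<in> K" for z
  proof -
    have "(i, K) \<in> arcs D" using arc s not_undercut arcs_iff by blast
    moreover have "fst (i, z) = fst (i, K)" "snd (i, z) \<in> snd (i, K)" using that by simp_all
    ultimately show ?thesis using arc_eq_arc_of by blast
  qed
  have "\<kappa> (i, snd s) = \<kappa> (i, snd s')"
  proof (rule connected_equivalence_relation_gen[of K "snd s" "snd s'" "\<lambda>z. point D (i, z) \<notin> crossings D"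
        "\<lambda>z z'. \<kappa> (i, z) = \<kappa> (i, z')"])
    show "connected K" by (simp add: K_def arc_of_def)
    show "snd s \<in> K" using mem_arc_of[OF s(1) not_undercut[OF s(2)]] by (simp add: K_def)
    show "snd s' \<in> K" using mem_arc_of[OF s'(1) not_undercut[OF s'(2)]] eq by (simp add: K_def)
    show "point D (i, snd s) \<notin> crossings D" using s i by (metis prod.collapse)
    show "point D (i, snd s') \<notin> crossings D" using s' i by (metis prod.collapse)
  next
    fix T z assume T: "openin (top_of_set K) T" "z \<in> T"
    have z: "z \<in> K" using T openin_subset by fastforce
    note zK = inK[OF z]
    show "\<exists>z'. z' \<in> T \<and> point D (i, z') \<notin> crossings D"
    proof (cases "point D (i, z) \<in> crossings D")
      case True
      have sz: "(i, z) \<in> strands D (point D (i, z))" using zK by (simp add: mem_strands_iff)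
      obtain a b where ab: "over_strand D (point D (i, z)) a" "under_strand D (point D (i, z)) b"
        using crossing_over_under[OF D True] by blast
      have a: "a = (i, z)" using over_under_strands(1)[OF D ab] sz zK ab by (auto simp: undercut_def)
      \<comment> \<open>Just beyond the overpass the strand is still on the same arc but no longer
        at a crossing, which gives density.\<close>
      obtain e where e: "0 < e" "\<forall>t. 0 < t \<longrightarrow> t < e \<longrightarrow> point D (shift (i, z) t) \<notin> crossings D \<and> arc_of D (shift (i, z) t) = arc_of D (i, z)"
        by (rule crossing_arcs[OF ab[unfolded a]]) (auto simp: crossing_arcs_at_def)
      obtain Q where Q: "open Q" "T = K \<inter> Q" using T(1) by (auto simp: openin_open)
      have "((\<lambda>t. z * cis t) \<longlongrightarrow> z * cis 0) (at_right 0)"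
        unfolding cis_conv_exp by (intro tendsto_intros)
      then have "\<forall>\<^sub>F t in at_right 0. z * cis t \<in> Q"
        using Q T(2) by (intro topological_tendstoD[where l = z]) simp_all
      moreover have "\<forall>\<^sub>F t in at_right 0. 0 < t \<and> t < e"
        using e(1) by (auto simp: eventually_at_right_field intro!: exI[of _ e])
      ultimately have "\<forall>\<^sub>F t in at_right (0::real). \<exists>z'. z' \<in> T \<and> point D (i, z') \<notin> crossings D"
      proof eventually_elim
        case (elim t)
        have "snd (shift (i, z) t) \<in> snd (arc_of D (shift (i, z) t))"
          using e(2) elim zK by (intro mem_arc_of not_undercut) auto
        then have "z * cis t \<in> K" using e(2) elim zK by (metis shift_def snd_conv)
        then show ?case using e(2) elim Q by (auto simp: shift_def)
      qed
      then show ?thesis by (simp add: eventually_const_iff trivial_limit_at_right_real)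
    qed (use T in blast)
  next
    fix z assume z: "z \<in> K"
    note zK = inK[OF z]
    have "\<exists>e>0. \<forall>t t'. \<bar>t\<bar> < e \<longrightarrow> \<bar>t'\<bar> < e \<longrightarrow> point D (shift (i, z) t) \<notin> crossings D \<longrightarrow>
        point D (shift (i, z) t') \<notin> crossings D \<longrightarrow> \<kappa> (shift (i, z) t) = \<kappa> (shift (i, z) t')"
    proof (cases "point D (i, z) \<in> crossings D")
      case True
      have sz: "(i, z) \<in> strands D (point D (i, z))" using zK by (simp add: mem_strands_iff)
      obtain a b where ab: "over_strand D (point D (i, z)) a" "under_strand D (point D (i, z)) b"
        using crossing_over_under[OF D True] by blast
      have a: "a = (i, z)" using over_under_strands(1)[OF D ab] sz zK ab by (auto simp: undercut_def)
      obtain e where e: "0 < e" "\<forall>t t'. 0 < \<bar>t\<bar> \<and> \<bar>t\<bar> < e \<and> 0 < \<bar>t'\<bar> \<and> \<bar>t'\<bar> < e \<longrightarrow>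
          \<kappa> (shift (i, z) t) = \<kappa> (shift (i, z) t')"
        using over[OF ab(1)] unfolding a by blast
      show ?thesis
      proof (intro exI[of _ e] conjI allI impI e(1))
        fix t t' :: real
        assume "\<bar>t\<bar> < e" "\<bar>t'\<bar> < e" "point D (shift (i, z) t) \<notin> crossings D" "point D (shift (i, z) t') \<notin> crossings D"
        moreover from this have "t \<noteq> 0" "t' \<noteq> 0" using True by auto
        then have "0 < \<bar>t\<bar>" "0 < \<bar>t'\<bar>" by simp_all
        ultimately show "\<kappa> (shift (i, z) t) = \<kappa> (shift (i, z) t')" using e(2) by blast
      qed
    next
      case False
      have "\<exists>e>0. \<forall>t. \<bar>t\<bar> < e \<longrightarrow> \<kappa> (shift (i, z) t) = \<kappa> (i, z)"
        by (rule reg[of "(i, z)"]) (simp_all add: zK False)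
      then obtain e where e: "0 < e" "\<forall>t. \<bar>t\<bar> < e \<longrightarrow> \<kappa> (shift (i, z) t) = \<kappa> (i, z)" by blast
      show ?thesis by (intro exI[of _ e]) (simp add: e)
    qed
    then obtain e where e: "0 < e" "\<And>t t'. \<bar>t\<bar> < e \<Longrightarrow> \<bar>t'\<bar> < e \<Longrightarrow> point D (shift (i, z) t) \<notin> crossings D \<Longrightarrow>
        point D (shift (i, z) t') \<notin> crossings D \<Longrightarrow> \<kappa> (shift (i, z) t) = \<kappa> (shift (i, z) t')" by blast
    \<comment> \<open>Closeness in the plane is translated into a small difference of angles, the
      form in which \<open>reg\<close> and \<open>over\<close> are stated.\<close>
    obtain d where d: "0 < d" "\<And>z z'. z \<in> sphere 0 1 \<Longrightarrow> z' \<in> sphere 0 1 \<Longrightarrow> dist z' z < d \<Longrightarrow>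
        \<exists>t. \<bar>t\<bar> < e \<and> z' = z * cis t" using near_cis[OF e(1)] by metis
    have near: "\<exists>t. \<bar>t\<bar> < e \<and> (i, y) = shift (i, z) t" if "y \<in> K \<inter> ball z d" for y
      using d(2)[of z y] that inK[of y] zK by (simp add: strand_def shift_def dist_commute)
    show "\<exists>T. openin (top_of_set K) T \<and> z \<in> T \<and> (\<forall>x\<in>T. \<forall>y\<in>T.
        point D (i, x) \<notin> crossings D \<and> point D (i, y) \<notin> crossings D \<longrightarrow> \<kappa> (i, x) = \<kappa> (i, y))"
    proof (intro exI[of _ "K \<inter> ball z d"] conjI ballI impI)
      show "openin (top_of_set K) (K \<inter> ball z d)" by (simp add: openin_open_Int)
      fix x y assume xy: "x \<in> K \<inter> ball z d" "y \<in> K \<inter> ball z d"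
        "point D (i, x) \<notin> crossings D \<and> point D (i, y) \<notin> crossings D"
      obtain r where r: "\<bar>r\<bar> < e" "(i, x) = shift (i, z) r" using near[OF xy(1)] by blast
      obtain r' where r': "\<bar>r'\<bar> < e" "(i, y) = shift (i, z) r'" using near[OF xy(2)] by blast
      show "\<kappa> (i, x) = \<kappa> (i, y)" using e(2)[OF r(1) r'(1)] xy(3) r(2) r'(2) by simp
    qed (use z d in auto)
  qed auto
  then show ?thesis using i by (metis prod.collapse)
qed

end

section \<open>Homomorphisms of presented groups and free products\<close>

definition word_prod :: "('g, 'm) monoid_scheme \<Rightarrow> ('a \<Rightarrow> 'g) \<Rightarrow> 'a list \<Rightarrow> 'g" where
  "word_prod H \<phi> w = foldr (\<lambda>x y. \<phi> x \<otimes>\<^bsub>H\<^esub> y) w \<one>\<^bsub>H\<^esub>"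

lemma word_prod_simps [simp]:
  "word_prod H \<phi> [] = \<one>\<^bsub>H\<^esub>" "word_prod H \<phi> (x # w) = \<phi> x \<otimes>\<^bsub>H\<^esub> word_prod H \<phi> w"
  by (simp_all add: word_prod_def)

context Group.monoid
begin

lemma word_prod_closed: "\<phi> \<in> A \<rightarrow> carrier G \<Longrightarrow> w \<in> lists A \<Longrightarrow> word_prod G \<phi> w \<in> carrier G"
  by (induction w) (auto simp del: in_lists_conv_set)

lemma word_prod_append:
  "\<phi> \<in> A \<rightarrow> carrier G \<Longrightarrow> u \<in> lists A \<Longrightarrow> w \<in> lists A \<Longrightarrow>
    word_prod G \<phi> (u @ w) = word_prod G \<phi> u \<otimes> word_prod G \<phi> w"
proof (induction u)
  case (Cons x u)
  then have "\<phi> x \<in> carrier G" "word_prod G \<phi> u \<in> carrier G" "word_prod G \<phi> w \<in> carrier G"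
    using word_prod_closed by auto
  then show ?case using Cons by (simp add: m_assoc)
qed (simp add: word_prod_closed)

end

lemma lists_append_iff: "u @ v \<in> lists A \<longleftrightarrow> u \<in> lists A \<and> v \<in> lists A"
  by auto

text \<open>Induction over words. Agreement at the unit is a hypothesis of its own, as
  \<open>hom\<close> asks for multiplicativity only, which in monoids does not fix the image of the
  unit.\<close>

lemma presented_monoid_hom_ext:
  assumes H: "Group.monoid H" and h: "h1 \<in> hom (presented_monoid A E) H" "h2 \<in> hom (presented_monoid A E) H"
    and one: "h1 \<one>\<^bsub>presented_monoid A E\<^esub> = h2 \<one>\<^bsub>presented_monoid A E\<^esub>"
    and eq: "\<And>x. x \<in> A \<Longrightarrow> h1 (word_class A E [x]) = h2 (word_class A E [x])"
    and P: "P \<in> carrier (presented_monoid A E)"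
  shows "h1 P = h2 P"
proof -
  have car: "carrier (presented_monoid A E) = word_class A E ` lists A"
    by (simp add: presented_monoid_def)
  obtain w where w: "w \<in> lists A" "P = word_class A E w" using P unfolding car by blast
  have "h1 (word_class A E w) = h2 (word_class A E w)" using w(1)
  proof (induction w)
    case Nil
    then show ?case using one by (simp add: presented_monoid_def)
  next
    case (Cons x w)
    have e: "word_class A E (x # w) = word_class A E [x] \<otimes>\<^bsub>presented_monoid A E\<^esub> word_class A E w"
      using presented_monoid_mult[of "[x]" A w E] Cons.hyps by simp
    have m: "word_class A E [x] \<in> carrier (presented_monoid A E)" "word_class A E w \<in> carrier (presented_monoid A E)"
      unfolding car by (intro imageI; use Cons.hyps in simp)+
    show ?case unfolding e using h m Cons.IH eq[OF Cons.hyps(1)] by (simp add: hom_mult)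
  qed
  then show ?thesis by (simp add: w)
qed

text \<open>Universal property of a monoid presentation: the word product respects every rule inside
  any context, hence the congruence, and so it descends to classes.\<close>

lemma presented_monoid_lift:
  assumes H: "Group.monoid H" and \<phi>: "\<phi> \<in> A \<rightarrow> carrier H"
    and rel: "\<And>l r. (l, r) \<in> E \<Longrightarrow> l \<in> lists A \<Longrightarrow> r \<in> lists A \<Longrightarrow> word_prod H \<phi> l = word_prod H \<phi> r"
  obtains h where "h \<in> hom (presented_monoid A E) H"
    "\<And>w. w \<in> lists A \<Longrightarrow> h (word_class A E w) = word_prod H \<phi> w"
proof -
  interpret H: Group.monoid H by fact
  note [simp del] = in_lists_conv_set
  have cong: "word_prod H \<phi> u = word_prod H \<phi> v" if "word_cong A E u v" for u v
    using that
  proof (induction rule: word_cong.induct)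
    case (step l r p q)
    then show ?case
      using rel[OF step(1)] \<phi> by (simp add: lists_append_iff H.word_prod_append)
  qed auto
  \<comment> \<open>The value is read off an arbitrary representative; \<open>cong\<close> makes the
    choice immaterial.\<close>
  define h where "h P = word_prod H \<phi> (SOME w. w \<in> P)" for P
  have h: "h (word_class A E w) = word_prod H \<phi> w" if "w \<in> lists A" for w
  proof -
    have "w \<in> word_class A E w" using that by (simp add: word_class_def word_cong.refl)
    then have "(SOME v. v \<in> word_class A E w) \<in> word_class A E w" by (rule someI)
    then show ?thesis using cong by (simp add: h_def word_class_def)
  qed
  have "h \<in> hom (presented_monoid A E) H"
  proof (rule homI)
    fix P assume "P \<in> carrier (presented_monoid A E)"
    then obtain w where "w \<in> lists A" "P = word_class A E w" unfolding presented_monoid_def by auto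
    then show "h P \<in> carrier H" using h H.word_prod_closed[OF \<phi>] by simp
  next
    fix P Q assume "P \<in> carrier (presented_monoid A E)" "Q \<in> carrier (presented_monoid A E)"
    then obtain u v where uv: "u \<in> lists A" "v \<in> lists A" "P = word_class A E u" "Q = word_class A E v"
      unfolding presented_monoid_def by auto
    then show "h (P \<otimes>\<^bsub>presented_monoid A E\<^esub> Q) = h P \<otimes>\<^bsub>H\<^esub> h Q"
      using h \<phi> by (simp add: presented_monoid_mult lists_append_iff H.word_prod_append)
  qed
  then show thesis using that h by blast
qed

definition presentation_rules :: "'a set \<Rightarrow> ('a \<times> bool) list set \<Rightarrow> (('a \<times> bool) list \<times> ('a \<times> bool) list) set" where
  "presentation_rules X R = {([(x, b), (x, \<not> b)], []) | x b. x \<in> X} \<union> {(r, []) | r. r \<in> R}"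

definition gen :: "'a set \<Rightarrow> ('a \<times> bool) list set \<Rightarrow> 'a \<Rightarrow> ('a \<times> bool) list set" where
  "gen X R x = word_class (X \<times> UNIV) (presentation_rules X R) [(x, True)]"

lemma presented_group_eq: "presented_group X R = presented_monoid (X \<times> UNIV) (presentation_rules X R)"
  by (simp add: presented_group_def presentation_rules_def)

definition letter_val :: "('g, 'm) monoid_scheme \<Rightarrow> ('a \<Rightarrow> 'g) \<Rightarrow> 'a \<times> bool \<Rightarrow> 'g" where
  "letter_val H \<phi> l = (if snd l then \<phi> (fst l) else inv\<^bsub>H\<^esub> \<phi> (fst l))"

lemma gen_closed: "x \<in> X \<Longrightarrow> gen X R x \<in> carrier (presented_group X R)"
  by (auto simp: gen_def presented_group_eq presented_monoid_def)

text \<open>A letter with False is only a formal inverse; the cancellation rule makes its class the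
  inverse of the generator.\<close>

lemma presented_group_letter:
  assumes "x \<in> X"
  shows "word_class (X \<times> UNIV) (presentation_rules X R) [(x, b)] = letter_val (presented_group X R) (gen X R) (x, b)"
proof (cases b)
  case False
  interpret group "presented_group X R" by (rule group_presented_group)
  let ?c = "word_class (X \<times> UNIV) (presentation_rules X R)"
  have "?c [(x, False)] \<otimes>\<^bsub>presented_group X R\<^esub> gen X R x = ?c ([(x, False)] @ [(x, True)])"
    unfolding gen_def presented_group_eq by (rule presented_monoid_mult) (use assms in auto)
  also have "\<dots> = ?c []"
  proof (subst word_class_eq_iff)
    show "word_cong (X \<times> UNIV) (presentation_rules X R) ([(x, False)] @ [(x, True)]) []"
      by (rule word_cong_rel) (use assms in \<open>auto simp: presentation_rules_def\<close>)
  qed (use assms in auto)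
  also have "\<dots> = \<one>\<^bsub>presented_group X R\<^esub>" by (simp add: presented_group_eq presented_monoid_def)
  finally have "?c [(x, False)] = inv\<^bsub>presented_group X R\<^esub> gen X R x"
    using assms gen_closed[of x X R]
    by (intro inv_equality[symmetric]) (auto simp: presented_group_eq presented_monoid_def)
  then show ?thesis using False by (simp add: letter_val_def)
qed (simp add: letter_val_def gen_def)

text \<open>Evaluating a word at the generators returns its class, and a relator has the class of
  the empty word.\<close>

lemma presented_group_relator:
  assumes "r \<in> R" "r \<in> lists (X \<times> UNIV)"
  shows "word_prod (presented_group X R) (letter_val (presented_group X R) (gen X R)) r = \<one>\<^bsub>presented_group X R\<^esub>"
proof -
  let ?c = "word_class (X \<times> UNIV) (presentation_rules X R)"
  have "word_prod (presented_group X R) (letter_val (presented_group X R) (gen X R)) w = ?c w"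
    if "w \<in> lists (X \<times> UNIV)" for w
    using that
  proof (induction w)
    case Nil
    then show ?case by (simp add: presented_group_eq presented_monoid_def)
  next
    case (Cons l w)
    have "?c (l # w) = ?c [l] \<otimes>\<^bsub>presented_group X R\<^esub> ?c w"
      using presented_monoid_mult[of "[l]" "X \<times> UNIV" w "presentation_rules X R"] Cons.hyps
      by (simp add: presented_group_eq)
    also have "?c [l] = letter_val (presented_group X R) (gen X R) l"
      using presented_group_letter[of "fst l" X R "snd l"] Cons.hyps by auto
    finally show ?case using Cons.IH by simp
  qed
  then have "word_prod (presented_group X R) (letter_val (presented_group X R) (gen X R)) r = ?c r"
    using assms by blast
  also have "\<dots> = ?c []"
  proof (subst word_class_eq_iff)
    show "word_cong (X \<times> UNIV) (presentation_rules X R) r []"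
      by (rule word_cong_rel) (use assms in \<open>auto simp: presentation_rules_def\<close>)
  qed (use assms in auto)
  finally show ?thesis by (simp add: presented_group_eq presented_monoid_def)
qed

text \<open>Von Dyck's theorem. The cancellation rules hold for \<open>letter_val\<close> by itself,
  so only the relators impose conditions.\<close>

lemma presented_group_lift:
  assumes H: "group H" and \<phi>: "\<And>x. x \<in> X \<Longrightarrow> \<phi> x \<in> carrier H"
    and rel: "\<And>r. r \<in> R \<Longrightarrow> r \<in> lists (X \<times> UNIV) \<Longrightarrow> word_prod H (letter_val H \<phi>) r = \<one>\<^bsub>H\<^esub>"
  obtains h where "h \<in> hom (presented_group X R) H" "\<And>x. x \<in> X \<Longrightarrow> h (gen X R x) = \<phi> x"
proof -
  interpret H: group H by fact
  have car: "letter_val H \<phi> \<in> X \<times> UNIV \<rightarrow> carrier H" using \<phi> by (auto simp: letter_val_def)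
  obtain h where h: "h \<in> hom (presented_monoid (X \<times> UNIV) (presentation_rules X R)) H"
    "\<And>w. w \<in> lists (X \<times> UNIV) \<Longrightarrow> h (word_class (X \<times> UNIV) (presentation_rules X R) w) = word_prod H (letter_val H \<phi>) w"
  proof (rule presented_monoid_lift[OF H.is_monoid car])
    fix l r assume "(l, r) \<in> presentation_rules X R" "l \<in> lists (X \<times> UNIV)"
    then show "word_prod H (letter_val H \<phi>) l = word_prod H (letter_val H \<phi>) r"
      using rel[of l] \<phi> unfolding presentation_rules_def by (auto simp: letter_val_def simp del: in_lists_conv_set)
  qed (use that in blast)
  show thesis
  proof (rule that[of h])
    show "h (gen X R x) = \<phi> x" if "x \<in> X" for x
      using h(2)[of "[(x, True)]"] that \<phi>[OF that] by (simp add: gen_def letter_val_def)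
  qed (use h in \<open>simp add: presented_group_eq\<close>)
qed

lemma presented_group_hom_ext:
  assumes H: "group H" and h: "h1 \<in> hom (presented_group X R) H" "h2 \<in> hom (presented_group X R) H"
    and eq: "\<And>x. x \<in> X \<Longrightarrow> h1 (gen X R x) = h2 (gen X R x)" and P: "P \<in> carrier (presented_group X R)"
  shows "h1 P = h2 P"
proof -
  interpret g1: group_hom "presented_group X R" H h1
    using H h(1) group_presented_group[of X R] by (auto simp: group_hom_def group_hom_axioms_def)
  interpret g2: group_hom "presented_group X R" H h2
    using H h(2) group_presented_group[of X R] by (auto simp: group_hom_def group_hom_axioms_def)
  show ?thesis
  proof (rule presented_monoid_hom_ext[of H h1 "X \<times> UNIV" "presentation_rules X R" h2 P])
    show "Group.monoid H" using H by (simp add: group.is_monoid)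
    fix l assume "l \<in> X \<times> (UNIV :: bool set)"
    then obtain x b where l: "l = (x, b)" "x \<in> X" by auto
    show "h1 (word_class (X \<times> UNIV) (presentation_rules X R) [l]) = h2 (word_class (X \<times> UNIV) (presentation_rules X R) [l])"
      unfolding l(1) presented_group_letter[OF l(2)]
      using eq[OF l(2)] gen_closed[OF l(2), of R] by (simp add: letter_val_def)
  next
    show "h1 \<one>\<^bsub>presented_monoid (X \<times> UNIV) (presentation_rules X R)\<^esub> = h2 \<one>\<^bsub>presented_monoid (X \<times> UNIV) (presentation_rules X R)\<^esub>"
      using g1.hom_one g2.hom_one by (simp add: presented_group_eq)
  qed (use h P in \<open>simp_all add: presented_group_eq\<close>)
qed

section \<open>Universal property of the free product\<close>

definition free_product_rules where
  "free_product_rules G H = {([Inl a, Inl b], [Inl (a \<otimes>\<^bsub>G\<^esub> b)]) | a b. a \<in> carrier G \<and> b \<in> carrier G}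
     \<union> {([Inr a, Inr b], [Inr (a \<otimes>\<^bsub>H\<^esub> b)]) | a b. a \<in> carrier H \<and> b \<in> carrier H}
     \<union> {([Inl \<one>\<^bsub>G\<^esub>], []), ([Inr \<one>\<^bsub>H\<^esub>], [])}"

definition inl where "inl G H a = word_class (carrier G <+> carrier H) (free_product_rules G H) [Inl a]"
definition inr where "inr G H b = word_class (carrier G <+> carrier H) (free_product_rules G H) [Inr b]"

lemma free_product_eq:
  "free_product G H = presented_monoid (carrier G <+> carrier H) (free_product_rules G H)"
  by (simp add: free_product_def free_product_rules_def)

lemma inl_hom: assumes G: "Group.monoid G" shows "inl G H \<in> hom G (free_product G H)"
proof (rule homI)
  show "inl G H a \<in> carrier (free_product G H)" if "a \<in> carrier G" for a
    using that by (auto simp: inl_def free_product_eq presented_monoid_def)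
  fix a b assume ab: "a \<in> carrier G" "b \<in> carrier G"
  let ?A = "carrier G <+> carrier H"
  have cl: "a \<otimes>\<^bsub>G\<^esub> b \<in> carrier G" using G ab by (rule monoid.m_closed)
  have "word_class ?A (free_product_rules G H) [Inl (a \<otimes>\<^bsub>G\<^esub> b)] = word_class ?A (free_product_rules G H) ([Inl a] @ [Inl b])"
  proof (subst word_class_eq_iff)
    show "word_cong ?A (free_product_rules G H) [Inl (a \<otimes>\<^bsub>G\<^esub> b)] ([Inl a] @ [Inl b])"
      by (rule word_cong.sym, rule word_cong_rel) (use ab cl in \<open>auto simp: free_product_rules_def\<close>)
  qed (use cl in auto)
  then show "inl G H (a \<otimes>\<^bsub>G\<^esub> b) = inl G H a \<otimes>\<^bsub>free_product G H\<^esub> inl G H b"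
    unfolding inl_def free_product_eq by (subst presented_monoid_mult) (use ab in auto)
qed

lemma inr_hom: assumes H: "Group.monoid H" shows "inr G H \<in> hom H (free_product G H)"
proof (rule homI)
  show "inr G H a \<in> carrier (free_product G H)" if "a \<in> carrier H" for a
    using that by (auto simp: inr_def free_product_eq presented_monoid_def)
  fix a b assume ab: "a \<in> carrier H" "b \<in> carrier H"
  let ?A = "carrier G <+> carrier H"
  have cl: "a \<otimes>\<^bsub>H\<^esub> b \<in> carrier H" using H ab by (rule monoid.m_closed)
  have "word_class ?A (free_product_rules G H) [Inr (a \<otimes>\<^bsub>H\<^esub> b)] = word_class ?A (free_product_rules G H) ([Inr a] @ [Inr b])"
  proof (subst word_class_eq_iff)
    show "word_cong ?A (free_product_rules G H) [Inr (a \<otimes>\<^bsub>H\<^esub> b)] ([Inr a] @ [Inr b])"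
      by (rule word_cong.sym, rule word_cong_rel) (use ab cl in \<open>auto simp: free_product_rules_def\<close>)
  qed (use cl in auto)
  then show "inr G H (a \<otimes>\<^bsub>H\<^esub> b) = inr G H a \<otimes>\<^bsub>free_product G H\<^esub> inr G H b"
    unfolding inr_def free_product_eq by (subst presented_monoid_mult) (use ab in auto)
qed

text \<open>On letters take \<open>case_sum f1 f2\<close>; the rules then express multiplicativity
  and preservation of units for the two homomorphisms.\<close>

lemma free_product_lift:
  assumes G: "group G" and H: "group H" and K: "group K" and f: "f1 \<in> hom G K" "f2 \<in> hom H K"
  obtains h where "h \<in> hom (free_product G H) K"
    "\<And>a. a \<in> carrier G \<Longrightarrow> h (inl G H a) = f1 a" "\<And>b. b \<in> carrier H \<Longrightarrow> h (inr G H b) = f2 b"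
proof -
  interpret K: group K by fact
  interpret g1: group_hom G K f1 using G K f by (auto simp: group_hom_def group_hom_axioms_def)
  interpret g2: group_hom H K f2 using H K f by (auto simp: group_hom_def group_hom_axioms_def)
  have car: "case_sum f1 f2 \<in> carrier G <+> carrier H \<rightarrow> carrier K" by auto
  obtain h where h: "h \<in> hom (presented_monoid (carrier G <+> carrier H) (free_product_rules G H)) K"
    "\<And>w. w \<in> lists (carrier G <+> carrier H) \<Longrightarrow>
      h (word_class (carrier G <+> carrier H) (free_product_rules G H) w) = word_prod K (case_sum f1 f2) w"
  proof (rule presented_monoid_lift[OF K.is_monoid car])
    fix l r assume "(l, r) \<in> free_product_rules G H"
    then show "word_prod K (case_sum f1 f2) l = word_prod K (case_sum f1 f2) r"
      by (auto simp: free_product_rules_def)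
  qed (use that in blast)
  show thesis
  proof (rule that[of h])
    show "h (inl G H a) = f1 a" if "a \<in> carrier G" for a
      using h(2)[of "[Inl a]"] that InlI[OF that, of "carrier H"] by (simp add: inl_def)
    show "h (inr G H b) = f2 b" if "b \<in> carrier H" for b
      using h(2)[of "[Inr b]"] that InrI[OF that, of "carrier G"] by (simp add: inr_def)
  qed (use h in \<open>simp add: free_product_eq\<close>)
qed

lemma free_product_hom_ext:
  assumes G: "group G" and H: "group H" and K: "group K"
    and h: "h1 \<in> hom (free_product G H) K" "h2 \<in> hom (free_product G H) K"
    and eq: "\<And>a. a \<in> carrier G \<Longrightarrow> h1 (inl G H a) = h2 (inl G H a)"
      "\<And>b. b \<in> carrier H \<Longrightarrow> h1 (inr G H b) = h2 (inr G H b)" and P: "P \<in> carrier (free_product G H)"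
  shows "h1 P = h2 P"
proof -
  have F: "group (free_product G H)" by (rule group_free_product[OF G H])
  interpret g1: group_hom "free_product G H" K h1
    using F K h(1) by (auto simp: group_hom_def group_hom_axioms_def)
  interpret g2: group_hom "free_product G H" K h2
    using F K h(2) by (auto simp: group_hom_def group_hom_axioms_def)
  show ?thesis
  proof (rule presented_monoid_hom_ext[of K h1 "carrier G <+> carrier H" "free_product_rules G H" h2 P])
    show "Group.monoid K" using K by (simp add: group.is_monoid)
    fix l assume "l \<in> carrier G <+> carrier H"
    then show "h1 (word_class (carrier G <+> carrier H) (free_product_rules G H) [l]) =
        h2 (word_class (carrier G <+> carrier H) (free_product_rules G H) [l])"
      using eq by (auto simp: inl_def inr_def)
  next
    show "h1 \<one>\<^bsub>presented_monoid (carrier G <+> carrier H) (free_product_rules G H)\<^esub> =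
        h2 \<one>\<^bsub>presented_monoid (carrier G <+> carrier H) (free_product_rules G H)\<^esub>"
      using g1.hom_one g2.hom_one by (simp add: free_product_eq)
  qed (use h P in \<open>simp_all add: free_product_eq\<close>)
qed

lemma integer_group_hom_ext:
  assumes K: "group K" and h: "h1 \<in> hom integer_group K" "h2 \<in> hom integer_group K" and eq: "h1 1 = h2 1"
  shows "h1 n = h2 n"
proof -
  interpret g1: group_hom integer_group K h1 using K h by (auto simp: group_hom_def group_hom_axioms_def)
  interpret g2: group_hom integer_group K h2 using K h by (auto simp: group_hom_def group_hom_axioms_def)
  show ?thesis using g1.hom_int_pow[of 1 n] g2.hom_int_pow[of 1 n] eq by simp
qed

text \<open>With \<open>m_assoc\<close> and \<open>inv_mult_group\<close> this rule and the next let
  the simplifier reduce words in a noncommutative group.\<close>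

lemma (in group) cancel_inv_left [simp]:
  "x \<in> carrier G \<Longrightarrow> y \<in> carrier G \<Longrightarrow> inv x \<otimes> (x \<otimes> y) = y"
  by (simp add: m_assoc[symmetric])

lemma (in group) cancel_inv_right [simp]:
  "x \<in> carrier G \<Longrightarrow> y \<in> carrier G \<Longrightarrow> x \<otimes> (inv x \<otimes> y) = y"
  by (simp add: m_assoc[symmetric])

section \<open>Colours, jumps and regions in charts\<close>

lemma sides_colour:
  assumes col: "colouring D col" and s: "strand D s" "point D s \<notin> crossings D" and sd: "sides D s \<sigma> A B" "\<sigma> = 1 \<or> \<sigma> = -1"
    and A: "\<And>p q. p \<in> A \<Longrightarrow> q \<in> A \<Longrightarrow> col p = col q" and B: "\<And>p q. p \<in> B \<Longrightarrow> q \<in> B \<Longrightarrow> col p = col q"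
    and pq: "p \<in> A" "q \<in> B"
  shows "col p = (\<not> col q)"
proof -
  have ev: "\<forall>\<^sub>F t in at_right 0. col (point D s + t *\<^sub>R left_normal D s) \<noteq> col (point D s - t *\<^sub>R left_normal D s)"
    using col s unfolding colouring_def by blast
  have "\<exists>x\<in>A. \<exists>y\<in>B. col x \<noteq> col y"
    by (rule sides_witness[OF sd(1)]) (use ev sd(2) in \<open>auto elim: eventually_mono\<close>)
  then show ?thesis using A B pq by metis
qed

lemma colour_const:
  assumes col: "colouring D col" and S: "connected S" "S \<inter> link D = {}" "p \<in> S" "q \<in> S"
  shows "col p = col q"
  by (rule connected_locally_constant[OF S(1) _ S(3,4)])
    (use col S(2) in \<open>auto simp: colouring_def\<close>)

text \<open>The jump condition concerns points close to the strand only. As \<open>f\<close> is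
  constant on both sides, one witness transfers it to the constants.\<close>

lemma solution_jump:
  assumes f: "solution D G col g U f" and s: "strand D s" "point D s \<in> U" "point D s \<notin> crossings D"
    and sd: "sides D s \<sigma> A B" "\<sigma> = 1 \<or> \<sigma> = -1" and col: "\<And>p. p \<in> A \<Longrightarrow> col p"
    and xy: "\<And>p. p \<in> A \<Longrightarrow> f p = x" "\<And>p. p \<in> B \<Longrightarrow> f p = y"
  shows "x = g s \<otimes>\<^bsub>G\<^esub> y"
proof -
  have "\<sigma> \<in> {1, -1}" using sd by auto
  then have "\<forall>\<^sub>F t in at_right 0. col (point D s + (\<sigma> * t) *\<^sub>R left_normal D s) \<longrightarrow>
        f (point D s + (\<sigma> * t) *\<^sub>R left_normal D s) = g s \<otimes>\<^bsub>G\<^esub> f (point D s - (\<sigma> * t) *\<^sub>R left_normal D s)"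
    using f s unfolding solution_def by blast
  then have "\<exists>p\<in>A. \<exists>q\<in>B. col p \<longrightarrow> f p = g s \<otimes>\<^bsub>G\<^esub> f q" by (rule sides_witness[OF sd(1)])
  then show ?thesis using col xy by auto
qed

text \<open>The region and \<open>V\<close> share points of one ray, and a connected set off the
  link that meets a component lies in it.\<close>

lemma region_towards_subset:
  assumes "region_towards D c d R" "\<forall>\<^sub>F t in at_right 0. c + t *\<^sub>R d \<in> V" "connected V" "V \<inter> link D = {}"
  shows "R \<in> regions D" "V \<subseteq> R"
proof -
  show R: "R \<in> regions D" using assms(1) by (simp add: region_towards_def)
  have "\<forall>\<^sub>F t in at_right (0::real). V \<inter> R \<noteq> {}"
    using eventually_conj[OF assms(2) conjunct2[OF assms(1)[unfolded region_towards_def]]]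
    by (rule eventually_mono) auto
  then have "V \<inter> R \<noteq> {}" by (simp add: eventually_const_iff trivial_limit_at_right_real)
  then show "V \<subseteq> R" using components_maximal[of R "- link D" V] R assms(3,4) by (auto simp: regions_eq)
qed

context
  fixes D assumes D: "link_diagram D"
begin

text \<open>Colours change between V and W, Y and X, and W and X, which determines all four from
  one.\<close>

lemma chart_colours:
  assumes col: "colouring D col" and ch: "crossing_chart D a b \<sigma> \<eta> N V W Y X"
    and ab: "over_strand D c a" "under_strand D c b" and \<sigma>: "\<sigma> = 1 \<or> \<sigma> = -1" and \<eta>: "0 < \<eta>"
  obtains \<alpha> where "\<forall>p\<in>V. col p = \<alpha>" "\<forall>p\<in>W. col p = (\<not> \<alpha>)" "\<forall>p\<in>Y. col p = (\<not> \<alpha>)" "\<forall>p\<in>X. col p = \<alpha>"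
proof (rule crossing_chart_branches[OF D ch ab \<sigma> \<eta>])
  fix e assume e: "0 < e" and br: "\<And>t. 0 < t \<Longrightarrow> t < e \<Longrightarrow> chart_branches D a b \<sigma> N V W Y X t"
  note os = over_under_strands[OF D ab]
  have NV: "N - link D = V \<union> W \<union> Y \<union> X" and conn: "connected V" "connected W" "connected Y" "connected X"
    using ch unfolding crossing_chart_def by simp_all
  have e2: "0 < e/2" "e/2 < e" using e by auto
  note b = br[OF e2, unfolded chart_branches_def branch_def]
  have const: "col p = col q" if "connected S" "S \<subseteq> N - link D" "p \<in> S" "q \<in> S" for S p q
    using colour_const[OF col that(1) _ that(3,4)] that(2) by blast
  have cV: "col p = col q" if "p \<in> V" "q \<in> V" for p q using const[OF conn(1) _ that] NV by blast
  have cW: "col p = col q" if "p \<in> W" "q \<in> W" for p q using const[OF conn(2) _ that] NV by blast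
  have cY: "col p = col q" if "p \<in> Y" "q \<in> Y" for p q using const[OF conn(3) _ that] NV by blast
  have cX: "col p = col q" if "p \<in> X" "q \<in> X" for p q using const[OF conn(4) _ that] NV by blast
  obtain v w where vw: "v \<in> V" "w \<in> W" using sides_witness[of D "shift a (e/2)" 1 V W "\<lambda>_ _. True"] b by auto
  obtain y x where yx: "y \<in> Y" "x \<in> X" using sides_witness[of D "shift a (- (e/2))" 1 Y X "\<lambda>_ _. True"] b by auto
  have s: "strand D (shift a (e/2))" "strand D (shift a (- (e/2)))" "strand D (shift b (\<sigma> * (e/2)))" using os by simp_all
  have "col v = (\<not> col w)" "col y = (\<not> col x)" "col w = (\<not> col x)"
    using sides_colour[OF col s(1) _ _ _ cV cW vw, of 1] sides_colour[OF col s(2) _ _ _ cY cX yx, of 1]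
      sides_colour[OF col s(3) _ _ \<sigma> cW cX vw(2) yx(2)] b by blast+
  then show thesis
    using that[of "col v"] cV[OF _ vw(1)] cW[OF _ vw(2)] cY[OF _ yx(1)] cX[OF _ yx(2)] by blast
qed

text \<open>The hypothesis \<open>rel\<close> is what a solution near a crossing requires: one value
  is chosen freely, three half strands determine the others, and the fourth leaves an equation
  between labels, which is the arc relation.\<close>

lemma labelled_solution_exists:
  assumes G: "group G" and lam: "\<And>K. K \<in> arcs D \<Longrightarrow> lam K \<in> carrier G"
    and rel: "\<And>a1 a2 a3. [(a1, True), (a2, False), (a1, True), (a3, False)] \<in> arc_relators D \<Longrightarrow>
      lam a1 \<otimes>\<^bsub>G\<^esub> inv\<^bsub>G\<^esub> lam a2 \<otimes>\<^bsub>G\<^esub> lam a1 \<otimes>\<^bsub>G\<^esub> inv\<^bsub>G\<^esub> lam a3 = \<one>\<^bsub>G\<^esub>"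
    and col: "colouring D col"
  shows "\<exists>f. solution D G col (\<lambda>s. lam (arc_of D s)) UNIV f"
proof -
  interpret group G by fact
  have lam_car: "lam (arc_of D s) \<in> carrier G" if "strand D s" "\<not> undercut D s" for s
    using lam that arcs_iff by blast
  show ?thesis
  proof (rule solution_exists[OF D G])
    show "lam (arc_of D s) \<in> carrier G" if "strand D s" "point D s \<notin> crossings D" for s
      by (rule lam_car[OF that(1) not_undercut[OF that(2)]])
    show "\<forall>\<^sub>F t in at_right 0. col (point D s + t *\<^sub>R left_normal D s) \<or> col (point D s - t *\<^sub>R left_normal D s)"
      if "strand D s" "point D s \<notin> crossings D" for s
    proof -
      have "\<forall>\<^sub>F t in at_right 0. col (point D s + t *\<^sub>R left_normal D s) \<noteq> col (point D s - t *\<^sub>R left_normal D s)"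
        using col that unfolding colouring_def by blast
      then show ?thesis by (rule eventually_mono) auto
    qed
    fix p assume "p \<in> link D"
    then obtain s where s: "strand D s" "point D s = p" by (auto simp: link_iff)
    show "\<exists>N f. open N \<and> p \<in> N \<and> solution D G col (\<lambda>s. lam (arc_of D s)) N f"
    proof (cases "p \<in> crossings D")
      case False
      obtain e where e: "0 < e" "\<And>t. \<bar>t\<bar> < e \<Longrightarrow> point D (shift s t) \<notin> crossings D"
        using regular_shift[OF D s(1)] s(2) False by metis
      have arc: "arc_of D (shift s t) = arc_of D s" if "\<bar>t\<bar> < e" for t
      proof -
        have "arc_of D (shift s t) = arc_of D (shift s 0)"
        proof (rule arc_of_shift_eq[OF s(1), of "{-e<..<e}"])
          show "\<not> undercut D (shift s r)" if "r \<in> {-e<..<e}" for r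
          proof -
            have "\<bar>r\<bar> < e" using that by auto
            then show ?thesis using e(2) by (intro not_undercut)
          qed
        qed (use that e in auto)
        then show ?thesis by simp
      qed
      define k where "k = lam (arc_of D s)"
      have k: "k \<in> carrier G" unfolding k_def using lam_car s False not_undercut by blast
      show ?thesis
      proof (rule regular_chart[OF D s(1) _ open_UNIV UNIV_I e(1)])
        show "point D s \<notin> crossings D" using s False by simp
        fix N L R assume N: "open N" "point D s \<in> N" "open L" "open R" "L \<inter> R = {}" "N - link D = L \<union> R"
          and LR: "connected L" "connected R"
          and *: "\<And>s'. strand D s' \<Longrightarrow> point D s' \<in> N \<Longrightarrow>
            (\<exists>t. \<bar>t\<bar> < e \<and> s' = shift s t) \<and> point D s' \<notin> crossings D \<and> sides D s' 1 L R"
        have cc: "col p = col q" if "p \<in> L \<and> q \<in> L \<or> p \<in> R \<and> q \<in> R" for p q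
          using that colour_const[OF col LR(1)] colour_const[OF col LR(2)] N(6) by blast
        have opp: "col p = (\<not> col q)" if "p \<in> L" "q \<in> R" for p q
          using sides_colour[OF col s(1), of 1 L R p q] *[OF s(1) N(2)] cc that by blast
        have lk: "lam (arc_of D s') = k" if "strand D s'" "point D s' \<in> N" for s'
          using *[OF that] arc by (auto simp: k_def)
        \<comment> \<open>The coloured side gets the label of the arc, the other side the
          unit.\<close>
        have "\<exists>f. solution D G col (\<lambda>s. lam (arc_of D s)) N f"
        proof (cases "\<exists>p\<in>L. col p")
          case True
          then have n: "\<not> (\<exists>p\<in>R. col p)" using opp cc by blast
          show ?thesis
            by (rule solution_at_regular[OF N(3-6) k one_closed])
              (use * lk n k in \<open>auto simp: compatible_def\<close>)
        next
          case n: False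
          show ?thesis
            by (rule solution_at_regular[OF N(3-6) one_closed k])
              (use * lk n k in \<open>auto simp: compatible_def\<close>)
        qed
        then show ?thesis using N s by blast
      qed
    next
      case True
      obtain a b where ab: "over_strand D p a" "under_strand D p b" using crossing_over_under[OF D True] by blast
      note os = over_under_strands[OF D ab]
      show ?thesis
      proof (rule crossing_arcs[OF D ab])
        fix e a2 a3 assume e: "0 < e" and ar: "\<And>t. 0 < t \<Longrightarrow> t < e \<Longrightarrow> crossing_arcs_at D a b a2 a3 t"
          and r: "[(arc_of D a, True), (a2, False), (arc_of D a, True), (a3, False)] \<in> arc_relators D"
        define g g2 g3 where "g = lam (arc_of D a)" and "g2 = lam a2" and "g3 = lam a3"
        have "e/2 < e" "0 < e/2" using e by auto
        then have a23: "a2 = arc_of D (shift b (- (e/2)))" "a3 = arc_of D (shift b (e/2))"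
          and "point D (shift b (- (e/2))) \<notin> crossings D" "point D (shift b (e/2)) \<notin> crossings D"
          using ar[unfolded crossing_arcs_at_def] by auto
        then have gc: "g \<in> carrier G" "g2 \<in> carrier G" "g3 \<in> carrier G"
          unfolding g_def g2_def g3_def a23 using os over_not_undercut[OF ab(1)]
          by (auto intro!: lam_car not_undercut)
        have rel1: "g \<otimes>\<^bsub>G\<^esub> inv\<^bsub>G\<^esub> g2 \<otimes>\<^bsub>G\<^esub> g \<otimes>\<^bsub>G\<^esub> inv\<^bsub>G\<^esub> g3 = \<one>\<^bsub>G\<^esub>"
          unfolding g_def g2_def g3_def by (rule rel[OF r])
        \<comment> \<open>The relation can be solved for either underpassing arc in the same form,
          so the direction of the underpasser does not matter.\<close>
        then have g3: "g3 = g \<otimes>\<^bsub>G\<^esub> (inv\<^bsub>G\<^esub> g2 \<otimes>\<^bsub>G\<^esub> g)"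
          using gc inv_solve_right'[of "\<one>\<^bsub>G\<^esub>" "g \<otimes>\<^bsub>G\<^esub> inv\<^bsub>G\<^esub> g2 \<otimes>\<^bsub>G\<^esub> g" g3] by (simp add: m_assoc)
        then have g2: "g2 = g \<otimes>\<^bsub>G\<^esub> (inv\<^bsub>G\<^esub> g3 \<otimes>\<^bsub>G\<^esub> g)"
          using gc by (simp add: inv_mult_group m_assoc)
        obtain \<sigma> \<eta> N V W Y X where \<sigma>: "\<sigma> = 1 \<or> \<sigma> = -1" and \<eta>: "0 < \<eta>" "\<eta> \<le> e"
          and ch: "crossing_chart D a b \<sigma> \<eta> N V W Y X"
          using crossing_has_chart[OF D ab open_UNIV UNIV_I e] by metis
        have N: "open N" "p \<in> N" using ch os by (auto simp: crossing_chart_def)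
        \<comment> \<open>\<open>h\<close> labels the right half of the underpasser, between W and
          X, and \<open>k\<close> the left half, between V and Y. The arc \<open>a3\<close> along
          the parametrization is the right one for \<sigma> = 1.\<close>
        define h k where "h = (if \<sigma> = 1 then g3 else g2)" and "k = (if \<sigma> = 1 then g2 else g3)"
        have hk: "h \<in> carrier G" "k \<in> carrier G" using gc by (simp_all add: h_def k_def)
        have h: "h = g \<otimes>\<^bsub>G\<^esub> (inv\<^bsub>G\<^esub> k \<otimes>\<^bsub>G\<^esub> g)"
        proof (cases "\<sigma> = 1")
          case True
          show ?thesis unfolding h_def k_def if_P[OF True] by (rule g3)
        next
          case False
          show ?thesis unfolding h_def k_def if_not_P[OF False] by (rule g2)
        qed
        have k: "k = g \<otimes>\<^bsub>G\<^esub> (inv\<^bsub>G\<^esub> h \<otimes>\<^bsub>G\<^esub> g)"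
        proof (cases "\<sigma> = 1")
          case True
          show ?thesis unfolding h_def k_def if_P[OF True] by (rule g2)
        next
          case False
          show ?thesis unfolding h_def k_def if_not_P[OF False] by (rule g3)
        qed
        have lk: "lam (arc_of D (shift a t)) = g" "lam (arc_of D (shift a (- t))) = g"
          "lam (arc_of D (shift b (\<sigma> * t))) = h" "lam (arc_of D (shift b (- (\<sigma> * t)))) = k" if "0 < t" "t < \<eta>" for t
        proof -
          have t: "0 < t" "t < e" using that \<eta> by auto
          show "lam (arc_of D (shift a t)) = g" "lam (arc_of D (shift a (- t))) = g"
            using ar[OF t] by (simp_all add: g_def crossing_arcs_at_def)
          show "lam (arc_of D (shift b (\<sigma> * t))) = h" "lam (arc_of D (shift b (- (\<sigma> * t)))) = k"
            using ar[OF t] \<sigma> by (auto simp: h_def k_def g2_def g3_def crossing_arcs_at_def)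
        qed
        obtain \<alpha> where \<alpha>: "\<forall>p\<in>V. col p = \<alpha>" "\<forall>p\<in>W. col p = (\<not> \<alpha>)" "\<forall>p\<in>Y. col p = (\<not> \<alpha>)" "\<forall>p\<in>X. col p = \<alpha>"
          by (rule chart_colours[OF col ch ab \<sigma> \<eta>(1)])
        have "\<exists>f. solution D G col (\<lambda>s. lam (arc_of D s)) N f"
        proof (cases \<alpha>)
          case True
          \<comment> \<open>V and X are coloured. With the unit on W the jumps give \<open>g\<close>
            on V, \<open>h\<close> on X and \<open>inv k * g\<close> on Y; the half strand between Y
            and X then asks for \<open>h = g * inv k * g\<close>.\<close>
          have 1: "g \<otimes>\<^bsub>G\<^esub> \<one>\<^bsub>G\<^esub> = g" "h \<otimes>\<^bsub>G\<^esub> \<one>\<^bsub>G\<^esub> = h" using gc hk by auto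
          have 2: "g \<otimes>\<^bsub>G\<^esub> (inv\<^bsub>G\<^esub> k \<otimes>\<^bsub>G\<^esub> g) = h" by (rule h[symmetric])
          have 3: "k \<otimes>\<^bsub>G\<^esub> (inv\<^bsub>G\<^esub> k \<otimes>\<^bsub>G\<^esub> g) = g" using hk(2) gc by simp
          show ?thesis
            by (rule solution_at_crossing[OF D ch ab \<sigma> gc(1) one_closed _ hk(1), where y = "inv\<^bsub>G\<^esub> k \<otimes>\<^bsub>G\<^esub> g"])
              (use hk gc in simp, unfold compatible_def, use lk \<alpha> True in \<open>auto simp: 1 2 3\<close>)
        next
          case False
          \<comment> \<open>W and Y are coloured. With the unit on V the jumps give \<open>g\<close>
            on W, \<open>k\<close> on Y and \<open>inv h * g\<close> on X; the half strand between Y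
            and X then asks for \<open>k = g * inv h * g\<close>.\<close>
          have 1: "g \<otimes>\<^bsub>G\<^esub> \<one>\<^bsub>G\<^esub> = g" "k \<otimes>\<^bsub>G\<^esub> \<one>\<^bsub>G\<^esub> = k" using gc hk by auto
          have 2: "g \<otimes>\<^bsub>G\<^esub> (inv\<^bsub>G\<^esub> h \<otimes>\<^bsub>G\<^esub> g) = k" by (rule k[symmetric])
          have 3: "h \<otimes>\<^bsub>G\<^esub> (inv\<^bsub>G\<^esub> h \<otimes>\<^bsub>G\<^esub> g) = g" using hk(1) gc by simp
          show ?thesis
            by (rule solution_at_crossing[OF D ch ab \<sigma> one_closed gc(1) hk(2), where x = "inv\<^bsub>G\<^esub> h \<otimes>\<^bsub>G\<^esub> g"])
              (use hk gc in simp, unfold compatible_def, use lk \<alpha> False in \<open>auto simp: 1 2 3\<close>)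
        qed
        then show ?thesis using N by blast
      qed
    qed
  qed
qed

text \<open>A relator names regions by directions from the crossing. The quadrants of the chart
  contain short segments in these directions, so each named region contains its quadrant.\<close>

lemma region_relatorsE:
  assumes "r \<in> region_relators D"
  obtains c a b \<sigma> \<eta> N V W Y X V' W' Y' X' where "over_strand D c a" "under_strand D c b" "\<sigma> = 1 \<or> \<sigma> = -1" "0 < \<eta>"
    "crossing_chart D a b \<sigma> \<eta> N V W Y X" "V \<subseteq> V'" "W \<subseteq> W'" "Y \<subseteq> Y'" "X \<subseteq> X'"
    "V' \<in> regions D" "W' \<in> regions D" "Y' \<in> regions D" "X' \<in> regions D"
    "r = [(V', True), (W', False), (Y', True), (X', False)]"
proof -
  obtain V' W' Y' X' c a b u v where r: "r = [(V', True), (W', False), (Y', True), (X', False)]"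
    and ab: "over_strand D c a" "under_strand D c b" and uv: "u = tangent D a" "v = tangent D b \<or> v = - tangent D b"
    "Im (cnj v * u) > 0"
    and rt: "region_towards D c (u - v) V'" "region_towards D c (u + v) W'"
      "region_towards D c (- u - v) Y'" "region_towards D c (- u + v) X'"
    using assms unfolding region_relators_def by blast
  note os = over_under_strands[OF D ab]
  obtain \<sigma> \<eta> N V W Y X where \<sigma>: "\<sigma> = 1 \<or> \<sigma> = -1" "0 < Im (cnj (\<sigma> *\<^sub>R tangent D b) * tangent D a)" and \<eta>: "0 < \<eta>"
    and ch: "crossing_chart D a b \<sigma> \<eta> N V W Y X"
    using crossing_has_chart[OF D ab open_UNIV UNIV_I zero_less_one] by metis
  \<comment> \<open>Of the two opposite tangent vectors of the underpasser only one points to the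
    right of the overpasser.\<close>
  have v: "v = \<sigma> *\<^sub>R tangent D b" using uv \<sigma> by auto
  have NV: "N - link D = V \<union> W \<union> Y \<union> X" and conn: "connected V" "connected W" "connected Y" "connected X"
    using ch unfolding crossing_chart_def by simp_all
  have dj: "V \<inter> link D = {}" "W \<inter> link D = {}" "Y \<inter> link D = {}" "X \<inter> link D = {}" using NV by auto
  have ev: "\<forall>\<^sub>F h in at_right 0. c + h *\<^sub>R (u - v) \<in> V \<and> c + h *\<^sub>R (u + v) \<in> W \<and>
      c + h *\<^sub>R (- u - v) \<in> Y \<and> c + h *\<^sub>R (- u + v) \<in> X"
    using ch os(5) unfolding crossing_chart_def v uv(1) by simp
  have evs: "\<forall>\<^sub>F h in at_right 0. c + h *\<^sub>R (u - v) \<in> V" "\<forall>\<^sub>F h in at_right 0. c + h *\<^sub>R (u + v) \<in> W"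
    "\<forall>\<^sub>F h in at_right 0. c + h *\<^sub>R (- u - v) \<in> Y" "\<forall>\<^sub>F h in at_right 0. c + h *\<^sub>R (- u + v) \<in> X"
    using ev by (auto elim: eventually_mono)
  show thesis
    by (rule that[OF ab \<sigma>(1) \<eta> ch])
      (use region_towards_subset[OF rt(1) evs(1) conn(1) dj(1)] region_towards_subset[OF rt(2) evs(2) conn(2) dj(2)]
        region_towards_subset[OF rt(3) evs(3) conn(3) dj(3)] region_towards_subset[OF rt(4) evs(4) conn(4) dj(4)] r in auto)
qed

lemma chart_region_relator:
  assumes ab: "over_strand D c a" "under_strand D c b" and \<sigma>: "\<sigma> = 1 \<or> \<sigma> = -1"
      "0 < Im (cnj (\<sigma> *\<^sub>R tangent D b) * tangent D a)"
    and ch: "crossing_chart D a b \<sigma> \<eta> N V W Y X"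
    and R: "V \<subseteq> V'" "W \<subseteq> W'" "Y \<subseteq> Y'" "X \<subseteq> X'" "V' \<in> regions D" "W' \<in> regions D" "Y' \<in> regions D" "X' \<in> regions D"
  shows "[(V', True), (W', False), (Y', True), (X', False)] \<in> region_relators D"
proof -
  define u v where "u = tangent D a" and "v = \<sigma> *\<^sub>R tangent D b"
  note os = over_under_strands[OF D ab]
  have ev: "\<forall>\<^sub>F h in at_right 0. c + h *\<^sub>R (u - v) \<in> V \<and> c + h *\<^sub>R (u + v) \<in> W \<and>
      c + h *\<^sub>R (- u - v) \<in> Y \<and> c + h *\<^sub>R (- u + v) \<in> X"
    using ch os(5) unfolding crossing_chart_def u_def v_def by simp
  have "region_towards D c (u - v) V'" "region_towards D c (u + v) W'"
      "region_towards D c (- u - v) Y'" "region_towards D c (- u + v) X'"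
    unfolding region_towards_def using R ev by (auto elim: eventually_mono)
  moreover have "v = tangent D b \<or> v = - tangent D b" using \<sigma> by (auto simp: v_def)
  moreover have "Im (cnj v * u) > 0" using \<sigma>(2) by (simp only: u_def v_def)
  ultimately have ex: "\<exists>c s s' u v. over_strand D c s \<and> under_strand D c s' \<and> u = tangent D s \<and>
      (v = tangent D s' \<or> v = - tangent D s') \<and> Im (cnj v * u) > 0 \<and>
      region_towards D c (u - v) V' \<and> region_towards D c (u + v) W' \<and>
      region_towards D c (- u - v) Y' \<and> region_towards D c (- u + v) X'"
    using ab
    by - (rule exI[of _ c], rule exI[of _ a], rule exI[of _ b], rule exI[of _ u], rule exI[of _ v], simp add: u_def)
  show ?thesis
    unfolding region_relators_def mem_Collect_eq
    using ex by simp
qed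

end

section \<open>The isomorphism\<close>

text \<open>Arbitrary unless \<open>f\<close> is eventually constant along the normal.\<close>

definition side_val :: "diagram \<Rightarrow> (complex \<Rightarrow> 'v) \<Rightarrow> nat \<times> complex \<Rightarrow> real \<Rightarrow> 'v" where
  "side_val D f s \<sigma> = (SOME y. \<forall>\<^sub>F t in at_right 0. f (point D s + (\<sigma> * t) *\<^sub>R left_normal D s) = y)"

lemma side_val_left:
  assumes "sides D s \<sigma> A B" "\<forall>p\<in>A. f p = x"
  shows "side_val D f s \<sigma> = x"
proof -
  have x: "\<forall>\<^sub>F t in at_right 0. f (point D s + (\<sigma> * t) *\<^sub>R left_normal D s) = x"
    using assms(1) unfolding sides_def by (rule eventually_mono) (use assms(2) in blast)
  then have "\<forall>\<^sub>F t in at_right 0. f (point D s + (\<sigma> * t) *\<^sub>R left_normal D s) = side_val D f s \<sigma>"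
    unfolding side_val_def by (rule someI)
  with x have "\<forall>\<^sub>F t in at_right (0::real). side_val D f s \<sigma> = x" by eventually_elim simp
  then show ?thesis by (simp add: eventually_const_iff trivial_limit_at_right_real)
qed

lemma side_val_right: "sides D s \<sigma> A B \<Longrightarrow> \<forall>p\<in>B. f p = y \<Longrightarrow> side_val D f s (- \<sigma>) = y"
  using side_val_left[of D s "- \<sigma>" B A f y] by (simp add: sides_minus)

text \<open>The coloured side comes first. Testing the left side suffices, as the sides of a strand
  off crossings have different colours.\<close>

definition arc_ratio :: "diagram \<Rightarrow> ('g, 'm) monoid_scheme \<Rightarrow> (complex \<Rightarrow> bool) \<Rightarrow> (complex \<Rightarrow> 'g) \<Rightarrow> nat \<times> complex \<Rightarrow> 'g" where
  "arc_ratio D G col f s = (if side_val D col s 1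
    then side_val D f s 1 \<otimes>\<^bsub>G\<^esub> inv\<^bsub>G\<^esub> side_val D f s (-1)
    else side_val D f s (-1) \<otimes>\<^bsub>G\<^esub> inv\<^bsub>G\<^esub> side_val D f s 1)"

lemma arc_ratio_eq:
  assumes sd: "sides D s \<sigma> A B" "\<sigma> = 1 \<or> \<sigma> = -1" and col: "\<forall>p\<in>A. col p = \<alpha>" "\<forall>p\<in>B. col p = (\<not> \<alpha>)"
    and f: "\<forall>p\<in>A. f p = x" "\<forall>p\<in>B. f p = y"
  shows "arc_ratio D G col f s = (if \<alpha> then x \<otimes>\<^bsub>G\<^esub> inv\<^bsub>G\<^esub> y else y \<otimes>\<^bsub>G\<^esub> inv\<^bsub>G\<^esub> x)"
  using side_val_left[OF sd(1) f(1)] side_val_right[OF sd(1) f(2)]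
    side_val_left[OF sd(1) col(1)] side_val_right[OF sd(1) col(2)] sd(2)
  by (auto simp: arc_ratio_def)

text \<open>Everything follows by substituting \<open>v = x * inv y * w\<close>. The first two
  equations say that the coloured quotient across the overpasser is the same before and after the
  crossing, for either colouring of the quadrants. The other four are the arc relator for the
  quotients: two colourings times two orders of the underpassing arcs.\<close>

lemma (in group) crossing_relation_cases:
  assumes car: "v \<in> carrier G" "w \<in> carrier G" "y \<in> carrier G" "x \<in> carrier G"
    and rel: "v \<otimes> inv w \<otimes> y \<otimes> inv x = \<one>"
  shows "v \<otimes> inv w = x \<otimes> inv y" "w \<otimes> inv v = y \<otimes> inv x"
    "v \<otimes> inv w \<otimes> inv (x \<otimes> inv w) \<otimes> (v \<otimes> inv w) \<otimes> inv (v \<otimes> inv y) = \<one>"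
    "v \<otimes> inv w \<otimes> inv (v \<otimes> inv y) \<otimes> (v \<otimes> inv w) \<otimes> inv (x \<otimes> inv w) = \<one>"
    "w \<otimes> inv v \<otimes> inv (w \<otimes> inv x) \<otimes> (w \<otimes> inv v) \<otimes> inv (y \<otimes> inv v) = \<one>"
    "w \<otimes> inv v \<otimes> inv (y \<otimes> inv v) \<otimes> (w \<otimes> inv v) \<otimes> inv (w \<otimes> inv x) = \<one>"
proof -
  have "v \<otimes> inv w \<otimes> y = x"
    using rel car inv_solve_right'[of \<one> "v \<otimes> inv w \<otimes> y" x] by simp
  then have v: "v = x \<otimes> inv y \<otimes> w"
    using car by (metis inv_closed inv_solve_right' m_closed inv_inv)
  show "v \<otimes> inv w = x \<otimes> inv y" "w \<otimes> inv v = y \<otimes> inv x"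
    "v \<otimes> inv w \<otimes> inv (x \<otimes> inv w) \<otimes> (v \<otimes> inv w) \<otimes> inv (v \<otimes> inv y) = \<one>"
    "v \<otimes> inv w \<otimes> inv (v \<otimes> inv y) \<otimes> (v \<otimes> inv w) \<otimes> inv (x \<otimes> inv w) = \<one>"
    "w \<otimes> inv v \<otimes> inv (w \<otimes> inv x) \<otimes> (w \<otimes> inv v) \<otimes> inv (y \<otimes> inv v) = \<one>"
    "w \<otimes> inv v \<otimes> inv (y \<otimes> inv v) \<otimes> (w \<otimes> inv v) \<otimes> inv (w \<otimes> inv x) = \<one>"
    unfolding v using car by (simp_all add: m_assoc inv_mult_group)
qed

lemma chart_nonempty:
  assumes ch: "crossing_chart D a b \<sigma> \<eta> N V W Y X"
  shows "\<exists>p. p \<in> V" "\<exists>p. p \<in> W" "\<exists>p. p \<in> Y" "\<exists>p. p \<in> X"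
proof -
  have "\<forall>\<^sub>F h in at_right (0::real). (\<exists>p. p \<in> V) \<and> (\<exists>p. p \<in> W) \<and> (\<exists>p. p \<in> Y) \<and> (\<exists>p. p \<in> X)"
    using ch unfolding crossing_chart_def by (auto elim!: eventually_mono)
  then have "(\<exists>p. p \<in> V) \<and> (\<exists>p. p \<in> W) \<and> (\<exists>p. p \<in> Y) \<and> (\<exists>p. p \<in> X)"
    by (simp add: eventually_const_iff trivial_limit_at_right_real)
  then show "\<exists>p. p \<in> V" "\<exists>p. p \<in> W" "\<exists>p. p \<in> Y" "\<exists>p. p \<in> X" by blast+
qed

section \<open>Quotients of neighbouring regions as labels of arcs\<close>

context
  fixes D assumes D: "link_diagram D"
begin

definition region_of :: "complex \<Rightarrow> complex set" where
  "region_of p = connected_component_set (- link D) p"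

lemma region_of_mem: "p \<notin> link D \<Longrightarrow> region_of p \<in> regions D \<and> p \<in> region_of p"
  by (auto simp: region_of_def regions_eq intro!: componentsI)

lemma region_of_eq: "R \<in> regions D \<Longrightarrow> p \<in> R \<Longrightarrow> region_of p = R"
  unfolding region_of_def regions_eq components_iff by (metis connected_component_eq)

lemma region_disjoint_link: "R \<in> regions D \<Longrightarrow> R \<inter> link D = {}"
  using in_components_subset[of R "- link D"] by (auto simp: regions_eq)

lemma region_of_const:
  assumes "connected S" "S \<inter> link D = {}" "p \<in> S" "q \<in> S"
  shows "region_of q = region_of p"
proof -
  have "q \<in> connected_component_set (- link D) p"
    using connected_component_maximal[of p S "- link D"] assms by blast
  then show ?thesis unfolding region_of_def by (rule connected_component_eq)
qed

lemma region_of_locally_const: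
  assumes "p \<notin> link D"
  shows "\<forall>\<^sub>F q in nhds p. region_of q = region_of p"
proof -
  have "open (region_of p)" unfolding region_of_def by (rule open_connected_component[OF open_minus_link[OF D]])
  then have "\<forall>\<^sub>F q in nhds p. q \<in> region_of p" using region_of_mem[OF assms] by (intro eventually_nhds_in_open) auto
  then show ?thesis by (rule eventually_mono) (use region_of_eq region_of_mem[OF assms] in blast)
qed

abbreviation "RC_gen \<equiv> gen (regions D) (region_relators D)"
abbreviation "AC_gen \<equiv> gen (arcs D) (arc_relators D)"

lemma group_RC: "group (RC D)" and group_AC: "group (AC D)"
  unfolding RC_def AC_def by (rule group_presented_group)+

lemma RC_gen_closed: "p \<notin> link D \<Longrightarrow> RC_gen (region_of p) \<in> carrier (RC D)"
  unfolding RC_def using region_of_mem by (intro gen_closed) blast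

text \<open>Turns a relator between regions into a relation between the values of one function on
  the quadrants, the form in which jumps are compared.\<close>

lemma RC_chart_values:
  assumes ab: "over_strand D c a" "under_strand D c b" and \<sigma>: "\<sigma> = 1 \<or> \<sigma> = -1"
      "0 < Im (cnj (\<sigma> *\<^sub>R tangent D b) * tangent D a)"
    and ch: "crossing_chart D a b \<sigma> \<eta> N V W Y X"
  obtains v w y x where "v \<in> carrier (RC D)" "w \<in> carrier (RC D)" "y \<in> carrier (RC D)" "x \<in> carrier (RC D)"
    "\<forall>p\<in>V. RC_gen (region_of p) = v" "\<forall>p\<in>W. RC_gen (region_of p) = w"
    "\<forall>p\<in>Y. RC_gen (region_of p) = y" "\<forall>p\<in>X. RC_gen (region_of p) = x"
    "v \<otimes>\<^bsub>RC D\<^esub> inv\<^bsub>RC D\<^esub> w \<otimes>\<^bsub>RC D\<^esub> y \<otimes>\<^bsub>RC D\<^esub> inv\<^bsub>RC D\<^esub> x = \<one>\<^bsub>RC D\<^esub>"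
proof -
  interpret R: group "RC D" by (rule group_RC)
  obtain pv pw py px where p: "pv \<in> V" "pw \<in> W" "py \<in> Y" "px \<in> X" using chart_nonempty[OF ch] by blast
  have NV: "N - link D = V \<union> W \<union> Y \<union> X" and conn: "connected V" "connected W" "connected Y" "connected X"
    using ch unfolding crossing_chart_def by simp_all
  have dj: "V \<inter> link D = {}" "W \<inter> link D = {}" "Y \<inter> link D = {}" "X \<inter> link D = {}" using NV by auto
  have sub: "S \<subseteq> region_of q" if "connected S" "S \<inter> link D = {}" "q \<in> S" for S q
    unfolding region_of_def using that by (intro connected_component_maximal) auto
  have nl: "pv \<notin> link D" "pw \<notin> link D" "py \<notin> link D" "px \<notin> link D" using p dj by auto
  have rg: "region_of pv \<in> regions D" "region_of pw \<in> regions D" "region_of py \<in> regions D" "region_of px \<in> regions D"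
    using region_of_mem nl by blast+
  let ?r = "[(region_of pv, True), (region_of pw, False), (region_of py, True), (region_of px, False)]"
  have "?r \<in> region_relators D"
    by (rule chart_region_relator[OF D ab \<sigma> ch sub[OF conn(1) dj(1) p(1)] sub[OF conn(2) dj(2) p(2)]
        sub[OF conn(3) dj(3) p(3)] sub[OF conn(4) dj(4) p(4)] rg])
  then have "word_prod (RC D) (letter_val (RC D) RC_gen) ?r = \<one>\<^bsub>RC D\<^esub>"
    unfolding RC_def by (rule presented_group_relator) (use rg in auto)
  then have rel: "RC_gen (region_of pv) \<otimes>\<^bsub>RC D\<^esub> inv\<^bsub>RC D\<^esub> RC_gen (region_of pw) \<otimes>\<^bsub>RC D\<^esub> RC_gen (region_of py)
      \<otimes>\<^bsub>RC D\<^esub> inv\<^bsub>RC D\<^esub> RC_gen (region_of px) = \<one>\<^bsub>RC D\<^esub>"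
    using nl by (simp add: letter_val_def RC_gen_closed R.m_assoc)
  have val: "\<forall>p\<in>V. RC_gen (region_of p) = RC_gen (region_of pv)" "\<forall>p\<in>W. RC_gen (region_of p) = RC_gen (region_of pw)"
    "\<forall>p\<in>Y. RC_gen (region_of p) = RC_gen (region_of py)" "\<forall>p\<in>X. RC_gen (region_of p) = RC_gen (region_of px)"
    using region_of_const[OF conn(1) dj(1) p(1)] region_of_const[OF conn(2) dj(2) p(2)]
      region_of_const[OF conn(3) dj(3) p(3)] region_of_const[OF conn(4) dj(4) p(4)] by metis+
  show thesis
    by (rule that[OF RC_gen_closed[OF nl(1)] RC_gen_closed[OF nl(2)] RC_gen_closed[OF nl(3)]
        RC_gen_closed[OF nl(4)] val rel])
qed

context
  fixes col assumes col: "colouring D col"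
begin

abbreviation "ratio \<equiv> arc_ratio D (RC D) col (\<lambda>p. RC_gen (region_of p))"

text \<open>All strands in a regular chart have the same sides \<open>L\<close> and
  \<open>R\<close>, so the quotient is locally constant along the link. The values on both sides are
  recorded for the comparison with jumps.\<close>

lemma ratio_regular:
  assumes s: "strand D s" "point D s \<notin> crossings D"
  obtains e \<alpha> x y N L R where "0 < e" "\<And>t. \<bar>t\<bar> < e \<Longrightarrow> ratio (shift s t) = ratio s"
    "x \<in> carrier (RC D)" "y \<in> carrier (RC D)" "sides D s 1 L R" "\<forall>p\<in>L. col p = \<alpha>" "\<forall>p\<in>R. col p = (\<not> \<alpha>)"
    "\<forall>p\<in>L. RC_gen (region_of p) = x" "\<forall>p\<in>R. RC_gen (region_of p) = y" "connected L" "connected R"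
    "L \<inter> link D = {}" "R \<inter> link D = {}"
    "ratio s = (if \<alpha> then x \<otimes>\<^bsub>RC D\<^esub> inv\<^bsub>RC D\<^esub> y else y \<otimes>\<^bsub>RC D\<^esub> inv\<^bsub>RC D\<^esub> x)"
proof (rule regular_chart[OF D s open_UNIV UNIV_I zero_less_one])
  fix N L R assume N: "open N" "point D s \<in> N" and NL: "N - link D = L \<union> R"
    and LR: "connected L" "connected R"
    and *: "\<And>s'. strand D s' \<Longrightarrow> point D s' \<in> N \<Longrightarrow>
      (\<exists>t. \<bar>t\<bar> < 1 \<and> s' = shift s t) \<and> point D s' \<notin> crossings D \<and> sides D s' 1 L R"
  have sd: "sides D s 1 L R" using *[OF s(1) N(2)] by blast
  have dj: "L \<inter> link D = {}" "R \<inter> link D = {}" using NL by auto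
  obtain p q where pq: "p \<in> L" "q \<in> R" using sides_witness[OF sd, of "\<lambda>_ _. True"] by auto
  have nl: "p \<notin> link D" "q \<notin> link D" using pq dj by auto
  define x y where "x = RC_gen (region_of p)" and "y = RC_gen (region_of q)"
  have cl: "col p' = col p" if "p' \<in> L" for p' using colour_const[OF col LR(1) dj(1) that pq(1)] .
  have cr: "col q' = col q" if "q' \<in> R" for q' using colour_const[OF col LR(2) dj(2) that pq(2)] .
  have "col p = (\<not> col q)"
    using sides_colour[OF col s sd _ _ _ pq] cl cr by blast
  then have c: "\<forall>p'\<in>L. col p' = col p" "\<forall>q\<in>R. col q = (\<not> col p)" using cl cr by auto
  have g: "\<forall>p\<in>L. RC_gen (region_of p) = x" "\<forall>p\<in>R. RC_gen (region_of p) = y"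
    unfolding x_def y_def using region_of_const[OF LR(1) dj(1) pq(1)] region_of_const[OF LR(2) dj(2) pq(2)] by metis+
  have r: "ratio s' = (if col p then x \<otimes>\<^bsub>RC D\<^esub> inv\<^bsub>RC D\<^esub> y else y \<otimes>\<^bsub>RC D\<^esub> inv\<^bsub>RC D\<^esub> x)"
    if "strand D s'" "point D s' \<in> N" for s'
    by (rule arc_ratio_eq[OF _ _ c g]) (use *[OF that] in auto)
  obtain e where e: "0 < e" "\<And>t. \<bar>t\<bar> < e \<Longrightarrow> point D (shift s t) \<in> N"
    using stays_in_open[OF D s(1) N] by blast
  show thesis
  proof (rule that[OF e(1) _ _ _ sd c g LR dj r[OF s(1) N(2)]])
    show "ratio (shift s t) = ratio s" if "\<bar>t\<bar> < e" for t
      using r[OF s(1) N(2)] r[of "shift s t"] e(2)[OF that] s by simp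
  qed (use RC_gen_closed nl in \<open>auto simp: x_def y_def\<close>)
qed

text \<open>The regional relator gives one quotient \<open>g\<close> on both halves of the
  overpasser, and the arc relation between \<open>g\<close> and the quotients \<open>h\<close> and
  \<open>k\<close> on the halves of the underpasser.\<close>

lemma ratio_crossing:
  assumes ab: "over_strand D c a" "under_strand D c b"
  obtains e g h k where "0 < e" "g \<in> carrier (RC D)" "h \<in> carrier (RC D)" "k \<in> carrier (RC D)"
    "\<And>t. 0 < t \<Longrightarrow> t < e \<Longrightarrow> ratio (shift a t) = g \<and> ratio (shift a (- t)) = g \<and>
      ratio (shift b (- t)) = h \<and> ratio (shift b t) = k"
    "g \<otimes>\<^bsub>RC D\<^esub> inv\<^bsub>RC D\<^esub> h \<otimes>\<^bsub>RC D\<^esub> g \<otimes>\<^bsub>RC D\<^esub> inv\<^bsub>RC D\<^esub> k = \<one>\<^bsub>RC D\<^esub>"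
proof -
  interpret R: group "RC D" by (rule group_RC)
  obtain \<sigma> \<eta> N V W Y X where \<sigma>: "\<sigma> = 1 \<or> \<sigma> = -1" "0 < Im (cnj (\<sigma> *\<^sub>R tangent D b) * tangent D a)" and \<eta>: "0 < \<eta>"
    and ch: "crossing_chart D a b \<sigma> \<eta> N V W Y X"
    by (rule crossing_has_chart[OF D ab open_UNIV UNIV_I zero_less_one])
  obtain \<alpha> where \<alpha>: "\<forall>p\<in>V. col p = \<alpha>" "\<forall>p\<in>W. col p = (\<not> \<alpha>)" "\<forall>p\<in>Y. col p = (\<not> \<alpha>)" "\<forall>p\<in>X. col p = \<alpha>"
    by (rule chart_colours[OF D col ch ab \<sigma>(1) \<eta>])
  obtain v w y x where car: "v \<in> carrier (RC D)" "w \<in> carrier (RC D)" "y \<in> carrier (RC D)" "x \<in> carrier (RC D)"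
    and val: "\<forall>p\<in>V. RC_gen (region_of p) = v" "\<forall>p\<in>W. RC_gen (region_of p) = w"
      "\<forall>p\<in>Y. RC_gen (region_of p) = y" "\<forall>p\<in>X. RC_gen (region_of p) = x"
    and rel: "v \<otimes>\<^bsub>RC D\<^esub> inv\<^bsub>RC D\<^esub> w \<otimes>\<^bsub>RC D\<^esub> y \<otimes>\<^bsub>RC D\<^esub> inv\<^bsub>RC D\<^esub> x = \<one>\<^bsub>RC D\<^esub>"
    by (rule RC_chart_values[OF ab \<sigma> ch])
  note rc = R.crossing_relation_cases[OF car rel]
  define g where "g = (if \<alpha> then v \<otimes>\<^bsub>RC D\<^esub> inv\<^bsub>RC D\<^esub> w else w \<otimes>\<^bsub>RC D\<^esub> inv\<^bsub>RC D\<^esub> v)"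
  \<comment> \<open>\<open>l\<close> and \<open>m\<close> are the quotients across the right and the
    left half of the underpasser. Which of them comes first depends on \<sigma>, hence both orders
    in \<open>rels\<close>.\<close>
  define l where "l = (if \<alpha> then x \<otimes>\<^bsub>RC D\<^esub> inv\<^bsub>RC D\<^esub> w else w \<otimes>\<^bsub>RC D\<^esub> inv\<^bsub>RC D\<^esub> x)"
  define m where "m = (if \<alpha> then v \<otimes>\<^bsub>RC D\<^esub> inv\<^bsub>RC D\<^esub> y else y \<otimes>\<^bsub>RC D\<^esub> inv\<^bsub>RC D\<^esub> v)"
  have glm: "g \<in> carrier (RC D)" "l \<in> carrier (RC D)" "m \<in> carrier (RC D)" using car by (auto simp: g_def l_def m_def)
  have rels: "g \<otimes>\<^bsub>RC D\<^esub> inv\<^bsub>RC D\<^esub> l \<otimes>\<^bsub>RC D\<^esub> g \<otimes>\<^bsub>RC D\<^esub> inv\<^bsub>RC D\<^esub> m = \<one>\<^bsub>RC D\<^esub>"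
    "g \<otimes>\<^bsub>RC D\<^esub> inv\<^bsub>RC D\<^esub> m \<otimes>\<^bsub>RC D\<^esub> g \<otimes>\<^bsub>RC D\<^esub> inv\<^bsub>RC D\<^esub> l = \<one>\<^bsub>RC D\<^esub>"
    unfolding g_def l_def m_def using rc(3-6) by (cases \<alpha>; simp only: if_True if_False simp_thms)+
  show thesis
  proof (rule crossing_chart_branches[OF D ch ab \<sigma>(1) \<eta>])
    fix e assume e: "0 < e" and br: "\<And>t. 0 < t \<Longrightarrow> t < e \<Longrightarrow> chart_branches D a b \<sigma> N V W Y X t"
    have ra: "ratio (shift a t) = g" "ratio (shift a (- t)) = g" "ratio (shift b (\<sigma> * t)) = l"
      "ratio (shift b (- (\<sigma> * t))) = m" if t: "0 < t" "t < e" for t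
    proof -
      have sd: "sides D (shift a t) 1 V W" "sides D (shift a (- t)) 1 Y X" "sides D (shift b (\<sigma> * t)) \<sigma> W X"
        "sides D (shift b (- (\<sigma> * t))) \<sigma> V Y" using br[OF t] unfolding chart_branches_def branch_def by blast+
      show "ratio (shift a t) = g"
        unfolding g_def by (rule arc_ratio_eq[OF sd(1) _ \<alpha>(1,2) val(1,2)]) simp
      have "ratio (shift a (- t)) = (if \<not> \<alpha> then y \<otimes>\<^bsub>RC D\<^esub> inv\<^bsub>RC D\<^esub> x else x \<otimes>\<^bsub>RC D\<^esub> inv\<^bsub>RC D\<^esub> y)"
        by (rule arc_ratio_eq[OF sd(2) _ \<alpha>(3) _ val(3,4)]) (use \<alpha> in auto)
      then show "ratio (shift a (- t)) = g" using rc(1,2) by (simp add: g_def)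
      have "ratio (shift b (\<sigma> * t)) = (if \<not> \<alpha> then w \<otimes>\<^bsub>RC D\<^esub> inv\<^bsub>RC D\<^esub> x else x \<otimes>\<^bsub>RC D\<^esub> inv\<^bsub>RC D\<^esub> w)"
        by (rule arc_ratio_eq[OF sd(3) \<sigma>(1) \<alpha>(2) _ val(2,4)]) (use \<alpha> in auto)
      then show "ratio (shift b (\<sigma> * t)) = l" by (simp add: l_def)
      show "ratio (shift b (- (\<sigma> * t))) = m"
        unfolding m_def by (rule arc_ratio_eq[OF sd(4) \<sigma>(1) \<alpha>(1,3) val(1,3)])
    qed
    from \<sigma>(1) show thesis
    proof
      assume "\<sigma> = 1"
      then show ?thesis using ra by (intro that[OF e glm(1,3,2) _ rels(2)]) auto
    next
      assume "\<sigma> = -1"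
      then show ?thesis using ra by (intro that[OF e glm(1,2,3) _ rels(1)]) auto
    qed
  qed
qed

lemma ratio_arc:
  assumes "strand D s" "point D s \<notin> crossings D" "strand D s'" "point D s' \<notin> crossings D" "arc_of D s = arc_of D s'"
  shows "ratio s = ratio s'"
proof (rule constant_on_arcs[OF D _ _ assms])
  show "\<exists>e>0. \<forall>t. \<bar>t\<bar> < e \<longrightarrow> ratio (shift s t) = ratio s" if s: "strand D s" "point D s \<notin> crossings D" for s
    by (rule ratio_regular[OF s]) blast
  fix c s assume o: "over_strand D c s"
  then have "c \<in> crossings D" by (simp add: over_strand_def)
  then obtain b where b: "under_strand D c b" using crossing_over_under[OF D] by blast
  show "\<exists>e>0. \<forall>t t'. 0 < \<bar>t\<bar> \<and> \<bar>t\<bar> < e \<and> 0 < \<bar>t'\<bar> \<and> \<bar>t'\<bar> < e \<longrightarrow> ratio (shift s t) = ratio (shift s t')"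
  proof (rule ratio_crossing[OF o b])
    fix e g h k assume e: "0 < e" and *: "\<And>t. 0 < t \<Longrightarrow> t < e \<Longrightarrow> ratio (shift s t) = g \<and> ratio (shift s (- t)) = g \<and>
      ratio (shift b (- t)) = h \<and> ratio (shift b t) = k"
    have "ratio (shift s t) = g" if "0 < \<bar>t\<bar>" "\<bar>t\<bar> < e" for t
      using *[of t] *[of "- t"] that by (cases "0 < t") auto
    then show ?thesis using e by (intro exI[of _ e]) auto
  qed
qed

text \<open>The sample strand has to avoid crossings, where the normal need not lead into two sides;
  \<open>ratio_arc\<close> makes the choice immaterial.\<close>

definition arc_label :: "nat \<times> complex set \<Rightarrow> (complex set \<times> bool) list set" where
  "arc_label K = ratio (SOME s. strand D s \<and> point D s \<notin> crossings D \<and> arc_of D s = K)"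

lemma arc_label_arc_of:
  assumes s: "strand D s" "point D s \<notin> crossings D"
  shows "arc_label (arc_of D s) = ratio s"
proof -
  define s' where "s' = (SOME s'. strand D s' \<and> point D s' \<notin> crossings D \<and> arc_of D s' = arc_of D s)"
  have "strand D s' \<and> point D s' \<notin> crossings D \<and> arc_of D s' = arc_of D s"
    unfolding s'_def by (rule someI[of _ s]) (simp add: s)
  then show ?thesis unfolding arc_label_def s'_def[symmetric] by (intro ratio_arc s) auto
qed

text \<open>A strand of an arc that sits at a crossing is the overpasser there, so a small shift
  stays on the arc and leaves the crossing.\<close>

lemma arc_regular_strand:
  assumes "K \<in> arcs D"
  obtains s where "strand D s" "point D s \<notin> crossings D" "K = arc_of D s"
proof -
  obtain s where s: "strand D s" "\<not> undercut D s" "K = arc_of D s" using assms arcs_iff by blast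
  show thesis
  proof (cases "point D s \<in> crossings D")
    case True
    obtain a b where ab: "over_strand D (point D s) a" "under_strand D (point D s) b"
      using crossing_over_under[OF D True] by blast
    have "s \<in> strands D (point D s)" using s by (simp add: mem_strands_iff)
    then have a: "a = s" using over_under_strands(1)[OF D ab] s ab by (auto simp: undercut_def)
    show thesis
    proof (rule crossing_arcs[OF D ab])
      fix e a2 a3 assume e: "0 < e" and *: "\<And>t. 0 < t \<Longrightarrow> t < e \<Longrightarrow> crossing_arcs_at D a b a2 a3 t"
      have "0 < e/2" "e/2 < e" using e by auto
      then show thesis using *[of "e/2"] that[of "shift s (e/2)"] s a by (simp add: crossing_arcs_at_def)
    qed
  qed (use s that in blast)
qed

lemma arc_label_closed:
  assumes "K \<in> arcs D"
  shows "arc_label K \<in> carrier (RC D)"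
proof (rule arc_regular_strand[OF assms])
  interpret R: group "RC D" by (rule group_RC)
  fix s assume s: "strand D s" "point D s \<notin> crossings D" "K = arc_of D s"
  have "ratio s \<in> carrier (RC D)" by (rule ratio_regular[OF s(1,2)]) auto
  then show ?thesis using arc_label_arc_of[OF s(1,2)] s(3) by simp
qed

lemma arc_label_relator:
  assumes r: "r \<in> arc_relators D"
  shows "word_prod (RC D) (letter_val (RC D) arc_label) r = \<one>\<^bsub>RC D\<^esub>"
proof (rule arc_relatorsE[OF D r])
  interpret R: group "RC D" by (rule group_RC)
  fix c a b e a2 a3 assume ab: "over_strand D c a" "under_strand D c b" and e: "0 < e"
    and ar: "\<And>t. 0 < t \<Longrightarrow> t < e \<Longrightarrow> arc_of D (shift a t) = arc_of D a \<and> arc_of D (shift a (- t)) = arc_of D a \<and>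
      arc_of D (shift b (- t)) = a2 \<and> arc_of D (shift b t) = a3"
    and r: "r = [(arc_of D a, True), (a2, False), (arc_of D a, True), (a3, False)]"
  note os = over_under_strands[OF D ab]
  obtain e' where e': "0 < e'" "\<And>t. t \<noteq> 0 \<Longrightarrow> \<bar>t\<bar> < e' \<Longrightarrow> point D (shift a t) \<notin> crossings D \<and> point D (shift b t) \<notin> crossings D"
    using crossing_shift[OF D ab] by blast
  show ?thesis
  proof (rule ratio_crossing[OF ab])
    fix e'' g h k assume e'': "0 < e''" and car: "g \<in> carrier (RC D)" "h \<in> carrier (RC D)" "k \<in> carrier (RC D)"
      and ra: "\<And>t. 0 < t \<Longrightarrow> t < e'' \<Longrightarrow> ratio (shift a t) = g \<and> ratio (shift a (- t)) = g \<and>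
        ratio (shift b (- t)) = h \<and> ratio (shift b t) = k"
      and rel: "g \<otimes>\<^bsub>RC D\<^esub> inv\<^bsub>RC D\<^esub> h \<otimes>\<^bsub>RC D\<^esub> g \<otimes>\<^bsub>RC D\<^esub> inv\<^bsub>RC D\<^esub> k = \<one>\<^bsub>RC D\<^esub>"
    \<comment> \<open>One angle that is small enough for the arcs, for the quotients and for the
      absence of crossings.\<close>
    define t where "t = min e (min e' e'') / 2"
    have t: "0 < t" "t < e" "t < e''" "t \<noteq> 0" "- t \<noteq> 0" "\<bar>t\<bar> < e'" "\<bar>- t\<bar> < e'"
      using e e'(1) e'' by (auto simp: t_def)
    have "arc_label (arc_of D a) = g" "arc_label a2 = h" "arc_label a3 = k"
      using arc_label_arc_of[of "shift a t"] arc_label_arc_of[of "shift b (- t)"] arc_label_arc_of[of "shift b t"]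
        ar[OF t(1,2)] ra[OF t(1,3)] e'(2)[OF t(4,6)] e'(2)[OF t(5,7)] os by auto
    then show ?thesis using rel car by (simp add: r letter_val_def R.m_assoc)
  qed
qed

text \<open>Tautologically \<open>x = (x * inv y) * y\<close>: the generators of the regions
  themselves solve the jump problem in \<open>RC D\<close> for the labels \<open>arc_label\<close>.
  This makes \<open>solution_unique\<close> applicable to them.\<close>

lemma ratio_solution: "solution D (RC D) col (\<lambda>s. arc_label (arc_of D s)) UNIV (\<lambda>p. RC_gen (region_of p))"
proof (rule solution_piecewise)
  interpret R: group "RC D" by (rule group_RC)
  fix p assume "p \<in> UNIV - link D"
  then have p: "p \<notin> link D" by simp
  show "RC_gen (region_of p) \<in> carrier (RC D) \<and>
      (\<exists>S. open S \<and> p \<in> S \<and> (\<forall>q\<in>S. RC_gen (region_of q) = RC_gen (region_of p)))"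
    using region_of_locally_const[OF p] RC_gen_closed[OF p] unfolding eventually_nhds by metis
next
  interpret R: group "RC D" by (rule group_RC)
  fix s assume s: "strand D s" "point D s \<notin> crossings D"
  show "\<exists>\<sigma> A B x y. (\<sigma> = 1 \<or> \<sigma> = -1) \<and> sides D s \<sigma> A B \<and> (\<forall>p\<in>A. RC_gen (region_of p) = x) \<and>
      (\<forall>p\<in>B. RC_gen (region_of p) = y) \<and> compatible (RC D) col (arc_label (arc_of D s)) A B x y"
  proof (rule ratio_regular[OF s])
    fix \<alpha> x y L R assume *: "x \<in> carrier (RC D)" "y \<in> carrier (RC D)" "sides D s 1 L R"
      "\<forall>p\<in>L. col p = \<alpha>" "\<forall>p\<in>R. col p = (\<not> \<alpha>)"
      "\<forall>p\<in>L. RC_gen (region_of p) = x" "\<forall>p\<in>R. RC_gen (region_of p) = y"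
      "ratio s = (if \<alpha> then x \<otimes>\<^bsub>RC D\<^esub> inv\<^bsub>RC D\<^esub> y else y \<otimes>\<^bsub>RC D\<^esub> inv\<^bsub>RC D\<^esub> x)"
    have "compatible (RC D) col (arc_label (arc_of D s)) L R x y"
      unfolding compatible_def arc_label_arc_of[OF s] using * by (auto simp: R.m_assoc)
    then show ?thesis using * by blast
  qed
qed

text \<open>Both halves of the overpasser belong to one arc, so \<open>f\<close> jumps by the same
  factor before and after the crossing; the colours decide in which direction.\<close>

lemma solution_over_jumps:
  assumes f: "solution D G col (\<lambda>s. lam (arc_of D s)) UNIV f"
    and ab: "over_strand D c a" "under_strand D c b" and \<sigma>: "\<sigma> = 1 \<or> \<sigma> = -1" and \<eta>: "0 < \<eta>"
    and ch: "crossing_chart D a b \<sigma> \<eta> N V W Y X"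
    and val: "\<And>p. p \<in> V \<Longrightarrow> f p = v" "\<And>p. p \<in> W \<Longrightarrow> f p = w" "\<And>p. p \<in> Y \<Longrightarrow> f p = y" "\<And>p. p \<in> X \<Longrightarrow> f p = x"
    and \<alpha>: "\<forall>p\<in>V. col p = \<alpha>" "\<forall>p\<in>W. col p = (\<not> \<alpha>)" "\<forall>p\<in>Y. col p = (\<not> \<alpha>)" "\<forall>p\<in>X. col p = \<alpha>"
    and g: "g = lam (arc_of D a)"
  shows "(if \<alpha> then v = g \<otimes>\<^bsub>G\<^esub> w else w = g \<otimes>\<^bsub>G\<^esub> v) \<and>
    (if \<alpha> then x = g \<otimes>\<^bsub>G\<^esub> y else y = g \<otimes>\<^bsub>G\<^esub> x)"
proof (rule crossing_chart_branches[OF D ch ab \<sigma> \<eta>], rule crossing_arcs[OF D ab])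
  fix e e' a2 a3 assume e: "0 < e" "0 < e'" and br: "\<And>t. 0 < t \<Longrightarrow> t < e \<Longrightarrow> chart_branches D a b \<sigma> N V W Y X t"
    and ar: "\<And>t. 0 < t \<Longrightarrow> t < e' \<Longrightarrow> crossing_arcs_at D a b a2 a3 t"
  define t where "t = min e e' / 2"
  have t: "0 < t" "t < e" "t < e'" using e by (auto simp: t_def)
  have 1: "strand D (shift a t)" "point D (shift a t) \<in> UNIV" "point D (shift a t) \<notin> crossings D" "sides D (shift a t) 1 V W"
    and 2: "strand D (shift a (- t))" "point D (shift a (- t)) \<in> UNIV" "point D (shift a (- t)) \<notin> crossings D" "sides D (shift a (- t)) 1 Y X"
    using br[OF t(1,2)] over_under_strands[OF D ab] by (simp_all add: chart_branches_def branch_def)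
  have sd1: "sides D (shift a t) (-1) W V" and sd2: "sides D (shift a (- t)) (-1) X Y"
    using 1(4) 2(4) sides_minus[of D "shift a t" 1 W V] sides_minus[of D "shift a (- t)" 1 X Y] by simp_all
  have lg: "lam (arc_of D (shift a t)) = g" "lam (arc_of D (shift a (- t))) = g"
    using ar[OF t(1,3)] g by (simp_all add: crossing_arcs_at_def)
  show ?thesis
  proof (cases \<alpha>)
    case True
    have "v = g \<otimes>\<^bsub>G\<^esub> w"
      using solution_jump[OF f 1 _ _ val(1) val(2)] \<alpha> True unfolding lg by blast
    moreover have "x = g \<otimes>\<^bsub>G\<^esub> y"
      using solution_jump[OF f 2(1-3) sd2 _ _ val(4) val(3)] \<alpha> True unfolding lg by blast
    ultimately show ?thesis using True by simp
  next
    case False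
    have "w = g \<otimes>\<^bsub>G\<^esub> v"
      using solution_jump[OF f 1(1-3) sd1 _ _ val(2) val(1)] \<alpha> False unfolding lg by blast
    moreover have "y = g \<otimes>\<^bsub>G\<^esub> x"
      using solution_jump[OF f 2 _ _ val(3) val(4)] \<alpha> False unfolding lg by blast
    ultimately show ?thesis using False by simp
  qed
qed

text \<open>The equal jumps across the overpasser cancel: V = g W with X = g Y, and likewise W = g V
  with Y = g X, make V W^-1 Y X^-1 trivial. The arc relation has already entered through the
  existence of \<open>f\<close>.\<close>

lemma solution_region_relator:
  assumes G: "group G" and lam: "\<And>K. K \<in> arcs D \<Longrightarrow> lam K \<in> carrier G"
    and f: "solution D G col (\<lambda>s. lam (arc_of D s)) UNIV f" and r: "r \<in> region_relators D"
    and \<phi>: "\<And>R p. R \<in> regions D \<Longrightarrow> p \<in> R \<Longrightarrow> f p = \<phi> R"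
  shows "word_prod G (letter_val G \<phi>) r = \<one>\<^bsub>G\<^esub>"
proof (rule region_relatorsE[OF D r])
  interpret group G by fact
  fix c a b \<sigma> \<eta> N V W Y X V' W' Y' X'
  assume ab: "over_strand D c a" "under_strand D c b" and \<sigma>: "\<sigma> = 1 \<or> \<sigma> = -1" and \<eta>: "0 < \<eta>"
    and ch: "crossing_chart D a b \<sigma> \<eta> N V W Y X"
    and sub: "V \<subseteq> V'" "W \<subseteq> W'" "Y \<subseteq> Y'" "X \<subseteq> X'"
    and rg: "V' \<in> regions D" "W' \<in> regions D" "Y' \<in> regions D" "X' \<in> regions D"
    and r: "r = [(V', True), (W', False), (Y', True), (X', False)]"
  note os = over_under_strands[OF D ab]
  have val: "\<And>p. p \<in> V \<Longrightarrow> f p = \<phi> V'" "\<And>p. p \<in> W \<Longrightarrow> f p = \<phi> W'" "\<And>p. p \<in> Y \<Longrightarrow> f p = \<phi> Y'" "\<And>p. p \<in> X \<Longrightarrow> f p = \<phi> X'"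
    by (rule \<phi>[OF rg(1) subsetD[OF sub(1)]], assumption, rule \<phi>[OF rg(2) subsetD[OF sub(2)]], assumption,
        rule \<phi>[OF rg(3) subsetD[OF sub(3)]], assumption, rule \<phi>[OF rg(4) subsetD[OF sub(4)]], assumption)
  obtain pv pw py px where p: "pv \<in> V" "pw \<in> W" "py \<in> Y" "px \<in> X" using chart_nonempty[OF ch] by blast
  have cR: "\<phi> R \<in> carrier G" if "q \<in> R" "R \<in> regions D" for q R
  proof -
    have "q \<in> UNIV - link D" using region_disjoint_link[OF that(2)] that(1) by blast
    then have "f q \<in> carrier G" using f unfolding solution_def by blast
    then show ?thesis unfolding \<phi>[OF that(2,1)] .
  qed
  have car: "\<phi> V' \<in> carrier G" "\<phi> W' \<in> carrier G" "\<phi> Y' \<in> carrier G" "\<phi> X' \<in> carrier G"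
    using cR[OF subsetD[OF sub(1) p(1)] rg(1)] cR[OF subsetD[OF sub(2) p(2)] rg(2)]
      cR[OF subsetD[OF sub(3) p(3)] rg(3)] cR[OF subsetD[OF sub(4) p(4)] rg(4)] .
  obtain \<alpha> where \<alpha>: "\<forall>p\<in>V. col p = \<alpha>" "\<forall>p\<in>W. col p = (\<not> \<alpha>)" "\<forall>p\<in>Y. col p = (\<not> \<alpha>)" "\<forall>p\<in>X. col p = \<alpha>"
    by (rule chart_colours[OF D col ch ab \<sigma> \<eta>])
  define g where "g = lam (arc_of D a)"
  have g: "g \<in> carrier G"
    unfolding g_def using lam arcs_iff os(3) over_not_undercut[OF ab(1)] by blast
  have jumps: "(if \<alpha> then \<phi> V' = g \<otimes>\<^bsub>G\<^esub> \<phi> W' else \<phi> W' = g \<otimes>\<^bsub>G\<^esub> \<phi> V') \<and>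
      (if \<alpha> then \<phi> X' = g \<otimes>\<^bsub>G\<^esub> \<phi> Y' else \<phi> Y' = g \<otimes>\<^bsub>G\<^esub> \<phi> X')"
    by (rule solution_over_jumps[OF f ab \<sigma> \<eta> ch val \<alpha> g_def]) assumption+
  show ?thesis
    unfolding r using jumps car g by (cases \<alpha>) (simp_all add: letter_val_def inv_mult_group m_assoc)
qed

end

text \<open>Both maps come from universal properties, and each composite is checked on generators.
  That \<Psi> after \<Phi> fixes the generators of regions rests on uniqueness of solutions; that
  \<Phi> after \<Psi> fixes those of arcs is the jump condition of \<open>f\<close>.\<close>

lemma RC_iso: "RC D \<cong> free_product integer_group (AC D)"
proof -
  define F where "F = free_product integer_group (AC D)"
  interpret R: group "RC D" by (rule group_RC)
  interpret A: group "AC D" by (rule group_AC)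
  interpret F: group F unfolding F_def by (rule group_free_product[OF group_integer_group group_AC])
  obtain col where col: "colouring D col" using colouring_exists[OF D] by blast
  obtain x0 where x0: "x0 \<notin> link D" using dense_minus_link[OF D open_UNIV UNIV_I] by blast
  define \<iota> where "\<iota> = inl integer_group (AC D)"
  define \<kappa> where "\<kappa> = inr integer_group (AC D)"
  have \<iota>: "\<iota> \<in> hom integer_group F" unfolding \<iota>_def F_def
    by (rule inl_hom) (simp add: group.is_monoid)
  have \<kappa>: "\<kappa> \<in> hom (AC D) F" unfolding \<kappa>_def F_def by (rule inr_hom) (rule A.is_monoid)
  have \<iota>1: "\<iota> 1 \<in> carrier F" using \<iota> by (auto simp: hom_def)
  interpret k: group_hom "AC D" F \<kappa> using \<kappa> by unfold_locales
  define lam where "lam K = \<kappa> (AC_gen K)" for K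
  have AC_gen_closed: "AC_gen K \<in> carrier (AC D)" if "K \<in> arcs D" for K
    using gen_closed[OF that] by (simp add: AC_def)
  have lam: "lam K \<in> carrier F" if "K \<in> arcs D" for K
    using AC_gen_closed[OF that] by (simp add: lam_def)
  have rel: "lam a1 \<otimes>\<^bsub>F\<^esub> inv\<^bsub>F\<^esub> lam a2 \<otimes>\<^bsub>F\<^esub> lam a1 \<otimes>\<^bsub>F\<^esub> inv\<^bsub>F\<^esub> lam a3 = \<one>\<^bsub>F\<^esub>"
    if r: "[(a1, True), (a2, False), (a1, True), (a3, False)] \<in> arc_relators D" for a1 a2 a3
  proof -
    have arcs: "a1 \<in> arcs D" "a2 \<in> arcs D" "a3 \<in> arcs D" using r by (auto simp: arc_relators_def)
    have "word_prod (AC D) (letter_val (AC D) AC_gen) [(a1, True), (a2, False), (a1, True), (a3, False)] = \<one>\<^bsub>AC D\<^esub>"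
      unfolding AC_def by (rule presented_group_relator[OF r]) (use arcs in auto)
    then have "AC_gen a1 \<otimes>\<^bsub>AC D\<^esub> inv\<^bsub>AC D\<^esub> AC_gen a2 \<otimes>\<^bsub>AC D\<^esub> AC_gen a1 \<otimes>\<^bsub>AC D\<^esub> inv\<^bsub>AC D\<^esub> AC_gen a3 = \<one>\<^bsub>AC D\<^esub>"
      using AC_gen_closed arcs by (simp add: letter_val_def A.m_assoc)
    then have "\<kappa> (AC_gen a1 \<otimes>\<^bsub>AC D\<^esub> inv\<^bsub>AC D\<^esub> AC_gen a2 \<otimes>\<^bsub>AC D\<^esub> AC_gen a1 \<otimes>\<^bsub>AC D\<^esub> inv\<^bsub>AC D\<^esub> AC_gen a3) = \<one>\<^bsub>F\<^esub>"
      by simp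
    then show ?thesis using AC_gen_closed arcs by (simp add: lam_def)
  qed
  have lam_reg: "lam (arc_of D s) \<in> carrier F" if "strand D s" "point D s \<notin> crossings D" for s
    using lam arcs_iff not_undercut that by blast
  obtain f0 where f0: "solution D F col (\<lambda>s. lam (arc_of D s)) UNIV f0"
    using labelled_solution_exists[where lam = lam, OF D F.group_axioms lam rel col] by blast
  have f0x: "f0 x0 \<in> carrier F" using f0 x0 by (simp add: solution_def)
  \<comment> \<open>A right multiplication moves the value at the base point to the generator of
    Z.\<close>
  define f where "f p = f0 p \<otimes>\<^bsub>F\<^esub> (inv\<^bsub>F\<^esub> f0 x0 \<otimes>\<^bsub>F\<^esub> \<iota> 1)" for p
  have f: "solution D F col (\<lambda>s. lam (arc_of D s)) UNIV f"
    unfolding f_def by (rule solution_mult[OF D F.group_axioms f0 _ open_UNIV]) (use f0x \<iota>1 lam_reg in auto)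
  have fx0: "f x0 = \<iota> 1" using f0x \<iota>1 by (simp add: f_def)
  \<comment> \<open>\<open>f\<close> is constant on each region, so any of its points may
    serve.\<close>
  define \<phi> where "\<phi> R = f (SOME p. p \<in> R)" for R
  have \<phi>: "f p = \<phi> R" if R: "R \<in> regions D" "p \<in> R" for R p
  proof -
    have "(SOME p. p \<in> R) \<in> R" using R(2) by (rule someI)
    moreover have "connected R" using R(1) in_components_connected by (auto simp: regions_eq)
    ultimately show ?thesis unfolding \<phi>_def
      using f region_disjoint_link[OF R(1)] R(2)
      by (intro connected_locally_constant[of R f]) (auto simp: solution_def)
  qed
  have \<phi>c: "\<phi> R \<in> carrier F" if R: "R \<in> regions D" for R
  proof -
    obtain p where p: "p \<in> R" using R in_components_nonempty[of R "- link D"] by (auto simp: regions_eq)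
    then have "f p \<in> carrier F" using f region_disjoint_link[OF R] by (auto simp: solution_def)
    then show ?thesis using \<phi>[OF R p] by simp
  qed
  obtain \<Phi> where \<Phi>: "\<Phi> \<in> hom (RC D) F" "\<And>R. R \<in> regions D \<Longrightarrow> \<Phi> (RC_gen R) = \<phi> R"
  proof (rule presented_group_lift[where \<phi> = \<phi>, OF F.group_axioms \<phi>c])
    show "word_prod F (letter_val F \<phi>) r = \<one>\<^bsub>F\<^esub>" if "r \<in> region_relators D" for r
      by (rule solution_region_relator[where lam = lam and \<phi> = \<phi>, OF col F.group_axioms lam f that \<phi>])
  qed (use that in \<open>auto simp: RC_def\<close>)
  obtain \<psi> where \<psi>: "\<psi> \<in> hom (AC D) (RC D)" "\<And>K. K \<in> arcs D \<Longrightarrow> \<psi> (AC_gen K) = arc_label col K"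
  proof (rule presented_group_lift[where \<phi> = "arc_label col", OF group_RC arc_label_closed[OF col]])
    show "word_prod (RC D) (letter_val (RC D) (arc_label col)) r = \<one>\<^bsub>RC D\<^esub>" if "r \<in> arc_relators D" for r
      by (rule arc_label_relator[OF col that])
  qed (use that in \<open>auto simp: AC_def\<close>)
  define \<gamma> where "\<gamma> p = RC_gen (region_of p)" for p
  have \<gamma>c: "\<gamma> p \<in> carrier (RC D)" if "p \<notin> link D" for p using RC_gen_closed[OF that] by (simp add: \<gamma>_def)
  have pow: "(\<lambda>n::int. \<gamma> x0 [^]\<^bsub>RC D\<^esub> n) \<in> hom integer_group (RC D)"
    by (rule R.hom_integer_group_pow[OF \<gamma>c[OF x0]])
  obtain \<Psi> where \<Psi>: "\<Psi> \<in> hom F (RC D)" "\<And>n. \<Psi> (\<iota> n) = \<gamma> x0 [^]\<^bsub>RC D\<^esub> n"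
    "\<And>b. b \<in> carrier (AC D) \<Longrightarrow> \<Psi> (\<kappa> b) = \<psi> b"
    using free_product_lift[OF group_integer_group group_AC group_RC pow \<psi>(1)]
    unfolding F_def \<iota>_def \<kappa>_def by auto
  interpret P: group_hom "RC D" F \<Phi> using \<Phi>(1) by unfold_locales
  interpret Q: group_hom F "RC D" \<Psi> using \<Psi>(1) by unfold_locales
  have \<Psi>1: "\<Psi> (\<iota> 1) = \<gamma> x0" using \<gamma>c[OF x0] by (simp add: \<Psi>(2) R.int_pow_1)
  have \<Psi>lam: "\<Psi> (lam K) = arc_label col K" if "K \<in> arcs D" for K
    using \<Psi>(3)[OF AC_gen_closed[OF that]] \<psi>(2)[OF that] by (simp add: lam_def)
  \<comment> \<open>A homomorphism carries solutions to solutions for the image labels. Here these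
    are \<open>arc_label\<close>, so \<Psi> after \<open>f\<close> solves the same problem as
    \<gamma>.\<close>
  have \<Psi>sol: "solution D (RC D) col (\<lambda>s. arc_label col (arc_of D s)) UNIV (\<lambda>p. \<Psi> (f p))"
    unfolding solution_def
  proof (intro conjI ballI allI impI)
    fix p assume p: "p \<in> UNIV - link D"
    then show "\<Psi> (f p) \<in> carrier (RC D)" using f by (simp add: solution_def)
    have "\<forall>\<^sub>F q in nhds p. f q = f p" using f p by (simp add: solution_def)
    then show "\<forall>\<^sub>F q in nhds p. \<Psi> (f q) = \<Psi> (f p)" by (rule eventually_mono) simp
  next
    fix s \<tau> assume s: "strand D s" "point D s \<in> UNIV" "point D s \<notin> crossings D" and \<tau>: "\<tau> \<in> {1, -1::real}"
    have K: "arc_of D s \<in> arcs D" using arcs_iff not_undercut s by blast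
    have "\<forall>\<^sub>F t in at_right 0. col (point D s + (\<tau> * t) *\<^sub>R left_normal D s) \<longrightarrow>
        f (point D s + (\<tau> * t) *\<^sub>R left_normal D s) = lam (arc_of D s) \<otimes>\<^bsub>F\<^esub> f (point D s - (\<tau> * t) *\<^sub>R left_normal D s)"
      using f s \<tau> unfolding solution_def by blast
    with eventually_normal_minus_link[OF D s(1,3,2) open_UNIV]
    show "\<forall>\<^sub>F t in at_right 0. col (point D s + (\<tau> * t) *\<^sub>R left_normal D s) \<longrightarrow>
        \<Psi> (f (point D s + (\<tau> * t) *\<^sub>R left_normal D s)) =
        arc_label col (arc_of D s) \<otimes>\<^bsub>RC D\<^esub> \<Psi> (f (point D s - (\<tau> * t) *\<^sub>R left_normal D s))"
    proof eventually_elim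
      case (elim t)
      have "f (point D s - (\<tau> * t) *\<^sub>R left_normal D s) \<in> carrier F"
        using elim(1) \<tau> f by (auto simp: solution_def)
      then show ?case using elim(2) lam[OF K] \<Psi>lam[OF K] by simp
    qed
  qed
  have \<gamma>sol: "solution D (RC D) col (\<lambda>s. arc_label col (arc_of D s)) UNIV \<gamma>"
    using ratio_solution[OF col] by (simp only: \<gamma>_def[abs_def])
  have "\<exists>k\<in>carrier (RC D). \<forall>p\<in>UNIV - link D. \<Psi> (f p) = \<gamma> p \<otimes>\<^bsub>RC D\<^esub> k"
  proof (rule solution_unique[OF D group_RC open_UNIV connected_UNIV \<gamma>sol \<Psi>sol])
    show "arc_label col (arc_of D s) \<in> carrier (RC D)" if "strand D s" "point D s \<notin> crossings D" for s
      using arc_label_closed[OF col] arcs_iff not_undercut that by blast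
    show "\<forall>\<^sub>F t in at_right 0. col (point D s + t *\<^sub>R left_normal D s) \<or> col (point D s - t *\<^sub>R left_normal D s)"
      if "strand D s" "point D s \<notin> crossings D" for s
    proof -
      have "\<forall>\<^sub>F t in at_right 0. col (point D s + t *\<^sub>R left_normal D s) \<noteq> col (point D s - t *\<^sub>R left_normal D s)"
        using col that unfolding colouring_def by blast
      then show ?thesis by (rule eventually_mono) auto
    qed
  qed
  then obtain k where k: "k \<in> carrier (RC D)" "\<And>p. p \<notin> link D \<Longrightarrow> \<Psi> (f p) = \<gamma> p \<otimes>\<^bsub>RC D\<^esub> k" by auto
  \<comment> \<open>Both solutions take the value \<open>\<gamma> x0\<close> at the base point,
    which forces the constant to be the unit.\<close>
  have "\<gamma> x0 = \<gamma> x0 \<otimes>\<^bsub>RC D\<^esub> k" using k(2)[OF x0] fx0 \<Psi>1 by simp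
  then have "k = \<one>\<^bsub>RC D\<^esub>" using k(1) \<gamma>c[OF x0] by (metis R.l_cancel_one')
  then have \<Psi>f: "\<Psi> (f p) = \<gamma> p" if "p \<notin> link D" for p using k(2)[OF that] \<gamma>c[OF that] by simp
  have \<Phi>\<gamma>: "\<Phi> (\<gamma> p) = f p" if "p \<notin> link D" for p
    using \<Phi>(2)[of "region_of p"] \<phi>[of "region_of p" p] region_of_mem[OF that] by (simp add: \<gamma>_def)
  have left: "\<Psi> (\<Phi> g) = g" if g: "g \<in> carrier (RC D)" for g
  proof -
    have "(\<Psi> \<circ> \<Phi>) g = id g"
    proof (rule presented_group_hom_ext[OF group_RC, of "\<Psi> \<circ> \<Phi>" "regions D" "region_relators D" id g])
      show "\<Psi> \<circ> \<Phi> \<in> hom (presented_group (regions D) (region_relators D)) (RC D)"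
        using hom_compose[OF \<Phi>(1) \<Psi>(1)] by (simp add: RC_def)
      show "id \<in> hom (presented_group (regions D) (region_relators D)) (RC D)"
        by (auto simp: hom_def RC_def)
      show "g \<in> carrier (presented_group (regions D) (region_relators D))" using g by (simp add: RC_def)
      fix R assume R: "R \<in> regions D"
      obtain p where p: "p \<in> R" using R in_components_nonempty[of R "- link D"] by (auto simp: regions_eq)
      have pl: "p \<notin> link D" using region_disjoint_link[OF R] p by blast
      have "RC_gen R = \<gamma> p" using region_of_eq[OF R p] by (simp add: \<gamma>_def)
      then show "(\<Psi> \<circ> \<Phi>) (RC_gen R) = id (RC_gen R)" using \<Phi>\<gamma>[OF pl] \<Psi>f[OF pl] by simp
    qed
    then show ?thesis by simp
  qed
  have right: "\<Phi> (\<Psi> h) = h" if h: "h \<in> carrier F" for h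
  proof -
    have comp: "\<Phi> \<circ> \<Psi> \<in> hom F F" by (rule hom_compose[OF \<Psi>(1) \<Phi>(1)])
    have idF: "id \<in> hom F F" by (auto simp: hom_def)
    have 1: "(\<Phi> \<circ> \<Psi>) (\<iota> n) = id (\<iota> n)" for n
    proof -
      have "((\<Phi> \<circ> \<Psi>) \<circ> \<iota>) n = (id \<circ> \<iota>) n"
      proof (rule integer_group_hom_ext[OF F.group_axioms, of "(\<Phi> \<circ> \<Psi>) \<circ> \<iota>" "id \<circ> \<iota>"])
        \<comment> \<open>The generator of Z goes to \<open>\<gamma> x0\<close> and back to
          \<open>f x0\<close>, which is \<open>\<iota> 1\<close> by the normalization of
          \<open>f\<close>.\<close>
        show "((\<Phi> \<circ> \<Psi>) \<circ> \<iota>) 1 = (id \<circ> \<iota>) 1" using \<Psi>1 \<Phi>\<gamma>[OF x0] fx0 by simp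
      qed (rule hom_compose[OF \<iota> comp] hom_compose[OF \<iota> idF])+
      then show ?thesis by simp
    qed
    have 2: "(\<Phi> \<circ> \<Psi>) (\<kappa> b) = id (\<kappa> b)" if b: "b \<in> carrier (AC D)" for b
    proof -
      have "((\<Phi> \<circ> \<Psi>) \<circ> \<kappa>) b = (id \<circ> \<kappa>) b"
      proof (rule presented_group_hom_ext[OF F.group_axioms, of "(\<Phi> \<circ> \<Psi>) \<circ> \<kappa>" "arcs D" "arc_relators D" "id \<circ> \<kappa>" b])
        show "((\<Phi> \<circ> \<Psi>) \<circ> \<kappa>) \<in> hom (presented_group (arcs D) (arc_relators D)) F"
          "id \<circ> \<kappa> \<in> hom (presented_group (arcs D) (arc_relators D)) F"
          using hom_compose[OF \<kappa> comp] hom_compose[OF \<kappa> idF] by (simp_all add: AC_def)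
        show "b \<in> carrier (presented_group (arcs D) (arc_relators D))" using b by (simp add: AC_def)
        fix K assume K: "K \<in> arcs D"
        \<comment> \<open>\<Phi> turns the quotient of the two sides of the arc into the quotient of
          the values of \<open>f\<close> there, and this is the jump \<open>lam K\<close>.\<close>
        have "\<Phi> (arc_label col K) = lam K"
        proof (rule arc_regular_strand[OF col K], rule ratio_regular[OF col], assumption, assumption)
          fix s \<alpha> x y L R' assume s: "strand D s" "point D s \<notin> crossings D" "K = arc_of D s"
            and xy: "x \<in> carrier (RC D)" "y \<in> carrier (RC D)" and sd: "sides D s 1 L R'"
            and c: "\<forall>p\<in>L. col p = \<alpha>" "\<forall>p\<in>R'. col p = (\<not> \<alpha>)"
            and v: "\<forall>p\<in>L. RC_gen (region_of p) = x" "\<forall>p\<in>R'. RC_gen (region_of p) = y"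
            and dj: "L \<inter> link D = {}" "R' \<inter> link D = {}"
            and ra: "arc_ratio D (RC D) col (\<lambda>p. RC_gen (region_of p)) s =
              (if \<alpha> then x \<otimes>\<^bsub>RC D\<^esub> inv\<^bsub>RC D\<^esub> y else y \<otimes>\<^bsub>RC D\<^esub> inv\<^bsub>RC D\<^esub> x)"
          have fL: "f p = \<Phi> x" if "p \<in> L" for p
          proof -
            have "p \<notin> link D" using that dj(1) by blast
            then show ?thesis using \<Phi>\<gamma>[of p] v(1) that by (simp add: \<gamma>_def)
          qed
          have fR: "f p = \<Phi> y" if "p \<in> R'" for p
          proof -
            have "p \<notin> link D" using that dj(2) by blast
            then show ?thesis using \<Phi>\<gamma>[of p] v(2) that by (simp add: \<gamma>_def)
          qed
          have sd': "sides D s (-1) R' L" using sd sides_minus[of D s 1 R' L] by simp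
          have lab: "arc_label col K = (if \<alpha> then x \<otimes>\<^bsub>RC D\<^esub> inv\<^bsub>RC D\<^esub> y else y \<otimes>\<^bsub>RC D\<^esub> inv\<^bsub>RC D\<^esub> x)"
            using arc_label_arc_of[OF col s(1,2)] ra s(3) by simp
          show ?thesis
          proof (cases \<alpha>)
            case True
            have "\<Phi> x = lam K \<otimes>\<^bsub>F\<^esub> \<Phi> y"
              using solution_jump[OF f s(1) UNIV_I s(2) sd _ _ fL fR] c True s(3) by blast
            then show ?thesis using True lab xy lam[OF K] by (simp add: F.m_assoc)
          next
            case False
            have "\<Phi> y = lam K \<otimes>\<^bsub>F\<^esub> \<Phi> x"
              using solution_jump[OF f s(1) UNIV_I s(2) sd' _ _ fR fL] c False s(3) by blast
            then show ?thesis using False lab xy lam[OF K] by (simp add: F.m_assoc)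
          qed
        qed
        then show "((\<Phi> \<circ> \<Psi>) \<circ> \<kappa>) (AC_gen K) = (id \<circ> \<kappa>) (AC_gen K)"
          using \<Psi>lam[OF K] by (simp add: lam_def)
      qed
      then show ?thesis by simp
    qed
    have "(\<Phi> \<circ> \<Psi>) h = id h"
      by (rule free_product_hom_ext[OF group_integer_group group_AC F.group_axioms, of "\<Phi> \<circ> \<Psi>" id h, folded F_def \<iota>_def \<kappa>_def,
            OF comp idF 1 2 h])
    then show ?thesis by simp
  qed
  have "bij_betw \<Phi> (carrier (RC D)) (carrier F)"
    by (rule bij_betw_byWitness[where f' = \<Psi>]) (use left right in auto)
  then show ?thesis unfolding F_def[symmetric] is_iso_def iso_def using \<Phi>(1) by blast
qed

end

theorem theorem1p4:
  assumes "link_diagram D"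
  shows "RC D \<cong> free_product integer_group (AC D)"
  by (rule RC_iso[OF assms])

end
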